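(* Let $R$ be a simple root system of rank $n$ and let $R^+\subset R$ be a choice of positive roots. The maximal cocardinality $|R^+\setminus S|$ of a well-balanced subset $S\subset R^+$ is the following, according to the Dynkin type of $R$: \begin{itemize} \item $\mathrm{A}_n$: $0$ if $n=4k$; $2k+1$ if $n=4k+1$; $0$ if $n=4k+2$; $2k+2$ if $n=4k+3$. \item $\mathrm{B}_n$: $2k$ if $n=4k$; $2k+1$ if $n=4k+1$; $2k+1$ if $n=4k+2$; $2k+2$ if $n=4k+3$. \item $\mathrm{C}_n$: $4k$ if $n=4k$; $4k+1$ if $n=4k+1$; $4k+1$ if $n=4k+2$; $4k+2$ if $n=4k+3$. \item $\mathrm{D}_n$: $4k$ if $n=4k$; $4k$ if $n=4k+1$; $4k+2$ if $n=4k+2$; $4k+2$ if $n=4k+3$. \item $\mathrm{E}_6$: $4$; $\mathrm{E}_7$: $7$; $\mathrm{E}_8$: $8$; $\mathrm{F}_4$: $4$; $\mathrm{G}_2$: $2$. \end{itemize} Here $k\ge 0$ is an integer.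
   Context: Root systems are finite, reduced and crystallographic; "simple root system" means irreducible root system, and the types are the usual Dynkin types ($\mathrm{A}_n$ with $n\ge1$, $\mathrm{B}_n$ and $\mathrm{C}_n$ with $n\ge2$, $\mathrm{D}_n$ with $n\ge3$, and $\mathrm{E}_6,\mathrm{E}_7,\mathrm{E}_8,\mathrm{F}_4,\mathrm{G}_2$). Let $R$ be a root system and $R^+\subset R$ a choice of positive roots. A subset $S\subset R^+$ is called: (i) balanced if there exist signs $s_\alpha\in\{+1,-1\}$, $\alpha\in S$, such that $\sum_{\alpha\in S}s_\alpha\alpha=0$ (the empty set is balanced); (ii) strongly orthogonal if for any two elements $\alpha,\beta\in S$, neither $\alpha+\beta$ nor $\alpha-\beta$ is a root; (iii) well-balanced if $S$ is balanced and $R^+\setminus S$ is strongly orthogonal. The cocardinality of $S\subset R^+$ is $|R^+\setminus S|$. *)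

theory Defs
  imports "HOL-Analysis.Analysis"
begin

section \<open>Root systems\<close>

definition cartan_number :: "'a::euclidean_space \<Rightarrow> 'a \<Rightarrow> real" where
  "cartan_number \<alpha> \<beta> = 2 * (\<alpha> \<bullet> \<beta>) / (\<beta> \<bullet> \<beta>)"

definition root_reflection :: "'a::euclidean_space \<Rightarrow> 'a \<Rightarrow> 'a" where
  "root_reflection \<alpha> \<beta> = \<beta> - cartan_number \<beta> \<alpha> *\<^sub>R \<alpha>"

text \<open>
  Finite, reduced, crystallographic root systems. The Euclidean space of which \<open>R\<close> is a root
  system is \<open>span R\<close>, which may be a proper subspace of the ambient type; accordingly the rank
  of \<open>R\<close> is \<open>dim R\<close>, the dimension of \<open>span R\<close>.
\<close>

definition root_system :: "'a::euclidean_space set \<Rightarrow> bool" where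
  "root_system R \<longleftrightarrow>
     finite R \<and> 0 \<notin> R \<and>
     (\<forall>\<alpha>\<in>R. \<forall>\<beta>\<in>R. root_reflection \<alpha> \<beta> \<in> R) \<and>
     (\<forall>\<alpha>\<in>R. \<forall>\<beta>\<in>R. cartan_number \<beta> \<alpha> \<in> \<int>) \<and>
     (\<forall>\<alpha>\<in>R. \<forall>c. c *\<^sub>R \<alpha> \<in> R \<longrightarrow> c = 1 \<or> c = -1)"

definition simple_root_system :: "'a::euclidean_space set \<Rightarrow> bool" where
  "simple_root_system R \<longleftrightarrow>
     root_system R \<and> R \<noteq> {} \<and>
     (\<nexists>R1 R2. R1 \<noteq> {} \<and> R2 \<noteq> {} \<and> R = R1 \<union> R2 \<and> (\<forall>\<alpha>\<in>R1. \<forall>\<beta>\<in>R2. \<alpha> \<bullet> \<beta> = 0))"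

definition positive_roots :: "'a::euclidean_space set \<Rightarrow> 'a set \<Rightarrow> bool" where
  "positive_roots R P \<longleftrightarrow>
     P \<subseteq> R \<and>
     (\<forall>\<alpha>\<in>R. (\<alpha> \<in> P) \<noteq> (- \<alpha> \<in> P)) \<and>
     (\<forall>\<alpha>\<in>P. \<forall>\<beta>\<in>P. \<alpha> + \<beta> \<in> R \<longrightarrow> \<alpha> + \<beta> \<in> P)"

definition root_base :: "'a::euclidean_space set \<Rightarrow> 'a set \<Rightarrow> bool" where
  "root_base R \<Delta> \<longleftrightarrow>
     \<Delta> \<subseteq> R \<and> independent \<Delta> \<and>
     (\<forall>\<beta>\<in>R. \<exists>c :: 'a \<Rightarrow> int.
        \<beta> = (\<Sum>\<alpha>\<in>\<Delta>. of_int (c \<alpha>) *\<^sub>R \<alpha>) \<and>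
        ((\<forall>\<alpha>\<in>\<Delta>. c \<alpha> \<ge> 0) \<or> (\<forall>\<alpha>\<in>\<Delta>. c \<alpha> \<le> 0)))"

section \<open>Dynkin types\<close>

datatype dynkin_type =
    Type_A nat | Type_B nat | Type_C nat | Type_D nat
  | Type_E6 | Type_E7 | Type_E8 | Type_F4 | Type_G2

fun dynkin_rank :: "dynkin_type \<Rightarrow> nat" where
  "dynkin_rank (Type_A n) = n"
| "dynkin_rank (Type_B n) = n"
| "dynkin_rank (Type_C n) = n"
| "dynkin_rank (Type_D n) = n"
| "dynkin_rank Type_E6 = 6"
| "dynkin_rank Type_E7 = 7"
| "dynkin_rank Type_E8 = 8"
| "dynkin_rank Type_F4 = 4"
| "dynkin_rank Type_G2 = 2"

fun admissible_type :: "dynkin_type \<Rightarrow> bool" where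
  "admissible_type (Type_A n) \<longleftrightarrow> n \<ge> 1"
| "admissible_type (Type_B n) \<longleftrightarrow> n \<ge> 2"
| "admissible_type (Type_C n) \<longleftrightarrow> n \<ge> 2"
| "admissible_type (Type_D n) \<longleftrightarrow> n \<ge> 3"
| "admissible_type _ \<longleftrightarrow> True"

text \<open>
  Nodes of the Dynkin diagrams are numbered from 1 to the rank as in Bourbaki.
  Nodes outside that range are to be ignored.
\<close>

definition E_edges :: "(nat \<times> nat) set" where
  "E_edges = {(1,3), (3,4), (2,4), (4,5), (5,6), (6,7), (7,8)}"

fun dynkin_edge :: "dynkin_type \<Rightarrow> nat \<Rightarrow> nat \<Rightarrow> bool" where
  "dynkin_edge (Type_D n) i j \<longleftrightarrow>
     (i < n \<and> j < n \<and> (j = i + 1 \<or> i = j + 1)) \<or> (j = n \<and> i + 2 = n) \<or> (i = n \<and> j + 2 = n)"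
| "dynkin_edge Type_E6 i j \<longleftrightarrow> (i, j) \<in> E_edges \<or> (j, i) \<in> E_edges"
| "dynkin_edge Type_E7 i j \<longleftrightarrow> (i, j) \<in> E_edges \<or> (j, i) \<in> E_edges"
| "dynkin_edge Type_E8 i j \<longleftrightarrow> (i, j) \<in> E_edges \<or> (j, i) \<in> E_edges"
| "dynkin_edge _ i j \<longleftrightarrow> j = i + 1 \<or> i = j + 1"

text \<open>
  \<open>long_to_short X i j\<close> marks the entry \<open>(i, j)\<close> of a multiple edge for which \<open>\<alpha>\<^sub>i\<close> is longer than
  \<open>\<alpha>\<^sub>j\<close>. Since \<open>cartan_number \<alpha>\<^sub>i \<alpha>\<^sub>j\<close> divides by the squared length of its second argument, this is
  where the Cartan matrix has the entry \<open>-2\<close> or \<open>-3\<close>; the transposed entry is \<open>-1\<close>.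
\<close>

fun long_to_short :: "dynkin_type \<Rightarrow> nat \<Rightarrow> nat \<Rightarrow> bool" where
  "long_to_short (Type_B n) i j \<longleftrightarrow> i + 1 = n \<and> j = n"
| "long_to_short (Type_C n) i j \<longleftrightarrow> i = n \<and> j + 1 = n"
| "long_to_short Type_F4 i j \<longleftrightarrow> i = 2 \<and> j = 3"
| "long_to_short Type_G2 i j \<longleftrightarrow> i = 2 \<and> j = 1"
| "long_to_short _ i j \<longleftrightarrow> False"

definition cartan_matrix :: "dynkin_type \<Rightarrow> nat \<Rightarrow> nat \<Rightarrow> int" where
  "cartan_matrix X i j =
     (if i = j then 2
      else if \<not> dynkin_edge X i j then 0
      else if long_to_short X i j then (if X = Type_G2 then -3 else -2)
      else -1)"

definition has_dynkin_type :: "'a::euclidean_space set \<Rightarrow> dynkin_type \<Rightarrow> bool" where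
  "has_dynkin_type R X \<longleftrightarrow>
     admissible_type X \<and>
     (\<exists>a :: nat \<Rightarrow> 'a.
        inj_on a {1..dynkin_rank X} \<and>
        root_base R (a ` {1..dynkin_rank X}) \<and>
        (\<forall>i\<in>{1..dynkin_rank X}. \<forall>j\<in>{1..dynkin_rank X}.
           cartan_number (a i) (a j) = of_int (cartan_matrix X i j)))"

section \<open>Well-balanced subsets\<close>

definition balanced :: "'a::euclidean_space set \<Rightarrow> bool" where
  "balanced S \<longleftrightarrow>
     (\<exists>s :: 'a \<Rightarrow> real. (\<forall>\<alpha>\<in>S. s \<alpha> \<in> {1, -1}) \<and> (\<Sum>\<alpha>\<in>S. s \<alpha> *\<^sub>R \<alpha>) = 0)"

text \<open>
  The case \<open>\<alpha> = \<beta>\<close> below imposes no condition, as neither \<open>0\<close> nor \<open>2\<alpha>\<close> lies in a reduced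
  root system.
\<close>

definition strongly_orthogonal :: "'a::euclidean_space set \<Rightarrow> 'a set \<Rightarrow> bool" where
  "strongly_orthogonal R S \<longleftrightarrow> (\<forall>\<alpha>\<in>S. \<forall>\<beta>\<in>S. \<alpha> + \<beta> \<notin> R \<and> \<alpha> - \<beta> \<notin> R)"

definition well_balanced :: "'a::euclidean_space set \<Rightarrow> 'a set \<Rightarrow> 'a set \<Rightarrow> bool" where
  "well_balanced R P S \<longleftrightarrow> S \<subseteq> P \<and> balanced S \<and> strongly_orthogonal R (P - S)"

definition is_max_cocardinality :: "'a::euclidean_space set \<Rightarrow> 'a set \<Rightarrow> nat \<Rightarrow> bool" where
  "is_max_cocardinality R P m \<longleftrightarrow>
     (\<exists>S. well_balanced R P S \<and> card (P - S) = m) \<and>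
     (\<forall>S. well_balanced R P S \<longrightarrow> card (P - S) \<le> m)"

end

theory Submission
  imports Defs
begin

text \<open>
  Replacing a positive root by its negative changes neither balancedness, since the sign absorbs
  the change, nor strong orthogonality, since \<open>R = -R\<close>. So the answer is the same for every choice
  of one root from each pair \<open>\<plusminus>\<alpha>\<close> (\<open>is_max_cocardinality_change_half\<close>), and in each type an explicit
  choice can be used. The roots themselves are identified by \<open>roots_subset_closed\<close>: a set that
  contains the base and is closed under negation and simple reflections contains every root.

  Let \<open>T = P - S\<close> be the complement of a well-balanced set \<open>S\<close>. Upper bounds for \<open>card T\<close> come from
  two facts. Strongly orthogonal roots are orthogonal, so \<open>card T\<close> is at most the rank
  (\<open>card_strongly_orthogonal_le_dim\<close>). And if a signed sum over \<open>S\<close> vanishes, then the sum of \<open>S\<close> is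
  twice a sum of roots, so a linear functional with integral values on the roots takes values of
  equal parity on the sums of \<open>P\<close> and of \<open>T\<close> (\<open>balanced_parity\<close>). Applied to coordinate functionals:

  \<^item> Type A, roots \<open>e\<^sub>i - e\<^sub>j\<close>: \<open>T\<close> is a matching on \<open>n + 1\<close> points, and for even \<open>n\<close> no point may be
    matched.
  \<^item> Type B, roots \<open>\<plusminus>e\<^sub>i \<plusminus> e\<^sub>j\<close> and \<open>\<plusminus>e\<^sub>i\<close>: every index occurs in exactly one root of \<open>T\<close>, and at most
    one of these roots is some \<open>e\<^sub>i\<close>.
  \<^item> Type C, roots \<open>\<plusminus>e\<^sub>i \<plusminus> e\<^sub>j\<close> and \<open>\<plusminus>2e\<^sub>i\<close>: \<open>T\<close> consists of roots \<open>2e\<^sub>i\<close>, and half the sum of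
    the coordinates shows that not all of them occur when \<open>n\<close> is 2 or 3 modulo 4.
  \<^item> Type D, roots \<open>\<plusminus>e\<^sub>i \<plusminus> e\<^sub>j\<close>: strong orthogonality makes the pairs \<open>{i, j}\<close> of \<open>T\<close> a matching in
    which each pair carries at most two roots.
  \<^item> Types E7, E8, F4, G2: the rank. Type E6: no five positive roots are strongly orthogonal.

  For the lower bounds in the classical types the indices are grouped into blocks \<open>{2q, 2q + 1}\<close>,
  and \<open>T\<close> is built from the roots inside the blocks or from the multiples of the \<open>e\<^sub>i\<close>. In types B, C
  and D, the roots \<open>e\<^sub>j + e\<^sub>i\<close> and \<open>e\<^sub>j - e\<^sub>i\<close> contribute \<open>\<plusminus>2e\<^sub>j\<close> if their signs agree, so that with signs
  alternating in \<open>i\<close> nearly all contributions for a fixed \<open>j\<close> cancel; in type A the signs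
  \<open>(-1)\<^bsup>i + j\<^esup>\<close> have this effect. What is left is removed by local corrections. In the exceptional
  types the signs are listed in tables, and their properties are verified by evaluation.
\<close>

section \<open>Sign changes\<close>

text \<open>
  This property survives sign changes of individual roots, so a convenient half can be exhibited
  for each type.
\<close>

definition half_of :: "'a::euclidean_space set \<Rightarrow> 'a set \<Rightarrow> bool" where
  "half_of R P \<longleftrightarrow> P \<subseteq> R \<and> (\<forall>\<alpha>\<in>R. (\<alpha> \<in> P) \<noteq> (- \<alpha> \<in> P))"

lemma half_of_positive_roots: "positive_roots R P \<Longrightarrow> half_of R P"
  by (auto simp: positive_roots_def half_of_def)

lemma root_system_uminus:
  assumes "root_system R" "\<alpha> \<in> R"
  shows "- \<alpha> \<in> R"
proof -
  have "\<alpha> \<noteq> 0" using assms by (auto simp: root_system_def)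
  then have "root_reflection \<alpha> \<alpha> = - \<alpha>"
    by (simp add: root_reflection_def cartan_number_def algebra_simps scaleR_2)
  then show ?thesis using assms by (metis root_system_def)
qed

lemma half_of_functional:
  fixes g :: "'a::euclidean_space \<Rightarrow> real"
  assumes "linear g" "P \<subseteq> R" "R \<subseteq> P \<union> uminus ` P" "\<And>\<alpha>. \<alpha> \<in> P \<Longrightarrow> g \<alpha> > 0"
  shows "half_of R P"
proof -
  have neg: "- \<alpha> \<notin> P" if "\<alpha> \<in> P" for \<alpha>
    using assms(4)[OF that] assms(4)[of "- \<alpha>"] linear_neg[OF assms(1), of \<alpha>] by auto
  show ?thesis unfolding half_of_def
  proof (intro conjI ballI)
    fix \<alpha> assume "\<alpha> \<in> R"
    then have "\<alpha> \<in> P \<or> \<alpha> \<in> uminus ` P" using assms(3) by auto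
    then show "(\<alpha> \<in> P) \<noteq> (- \<alpha> \<in> P)" using neg by auto
  qed (fact assms(2))
qed

text \<open>
  Vanishing signed sums are evaluated over index sets. The two families are for the roots
  \<open>e\<^sub>j \<plusminus> e\<^sub>i\<close> and the multiples of the \<open>e\<^sub>i\<close> in types B and C.
\<close>

lemma balancedI:
  fixes r :: "'i \<Rightarrow> 'a::euclidean_space" and q :: "'j \<Rightarrow> 'a"
  assumes fin: "finite K" "finite L" and inj: "inj_on r K" "inj_on q L"
    and disj: "r ` K \<inter> q ` L = {}"
    and \<sigma>: "\<And>k. k \<in> K \<Longrightarrow> \<sigma> k \<in> {1, -1}" "\<And>l. l \<in> L \<Longrightarrow> \<tau> l \<in> {1, -1}"
    and zero: "(\<Sum>k\<in>K. \<sigma> k *\<^sub>R r k) + (\<Sum>l\<in>L. \<tau> l *\<^sub>R q l) = 0"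
  shows "balanced (r ` K \<union> q ` L)"
proof -
  define s where "s \<alpha> = (if \<alpha> \<in> r ` K then \<sigma> (the_inv_into K r \<alpha>) else \<tau> (the_inv_into L q \<alpha>))" for \<alpha>
  have sr: "s (r k) = \<sigma> k" if "k \<in> K" for k
    using that inj by (auto simp: s_def the_inv_into_f_f)
  have sq: "s (q l) = \<tau> l" if "l \<in> L" for l
    using that inj disj by (auto simp: s_def the_inv_into_f_f)
  have "(\<Sum>\<alpha>\<in>r ` K \<union> q ` L. s \<alpha> *\<^sub>R \<alpha>) = (\<Sum>\<alpha>\<in>r ` K. s \<alpha> *\<^sub>R \<alpha>) + (\<Sum>\<alpha>\<in>q ` L. s \<alpha> *\<^sub>R \<alpha>)"
    using fin disj by (intro sum.union_disjoint) auto
  also have "\<dots> = 0"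
    using zero by (simp add: sum.reindex inj sr sq)
  finally have "(\<Sum>\<alpha>\<in>r ` K \<union> q ` L. s \<alpha> *\<^sub>R \<alpha>) = 0" .
  moreover have "s \<alpha> \<in> {1, -1}" if "\<alpha> \<in> r ` K \<union> q ` L" for \<alpha>
    using that sr sq \<sigma> by (metis UnE imageE)
  ultimately show ?thesis unfolding balanced_def by blast
qed

lemma balanced_imageI:
  fixes r :: "'i \<Rightarrow> 'a::euclidean_space"
  assumes "finite K" "inj_on r K" "\<And>k. k \<in> K \<Longrightarrow> \<sigma> k \<in> {1, -1}" "(\<Sum>k\<in>K. \<sigma> k *\<^sub>R r k) = 0"
  shows "balanced (r ` K)"
  using balancedI[of K "{} :: nat set" r "\<lambda>_. 0" \<sigma>] assms by simp

text \<open>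
  The sign of \<open>\<alpha>\<close> absorbs the passage from \<open>\<alpha>\<close> to \<open>-\<alpha>\<close>, and flipping roots permutes the vectors
  \<open>\<plusminus>(\<alpha> + \<beta>)\<close>, \<open>\<plusminus>(\<alpha> - \<beta>)\<close> among themselves.
\<close>

lemma well_balanced_change_half:
  assumes R: "root_system R" and P: "half_of R P" and P': "half_of R P'" and S: "well_balanced R P S"
  shows "\<exists>S'. well_balanced R P' S' \<and> card (P' - S') = card (P - S)"
proof -
  define \<kappa> where "\<kappa> \<alpha> = (if \<alpha> \<in> P' then \<alpha> else - \<alpha>)" for \<alpha>
  have neg: "- \<alpha> \<in> R" if "\<alpha> \<in> R" for \<alpha> using root_system_uminus[OF R that] .
  have nz: "0 \<notin> R" and finR: "finite R" using R by (auto simp: root_system_def)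
  have SP: "S \<subseteq> P" and PR: "P \<subseteq> R" "P' \<subseteq> R"
    using S P P' by (auto simp: well_balanced_def half_of_def)
  have inj: "inj_on \<kappa> P"
  proof
    fix x y assume "x \<in> P" "y \<in> P" "\<kappa> x = \<kappa> y"
    then show "x = y"
      using P PR unfolding \<kappa>_def half_of_def by (auto split: if_splits)
  qed
  have img: "\<kappa> ` P = P'"
  proof
    show "\<kappa> ` P \<subseteq> P'" using P' PR unfolding \<kappa>_def half_of_def by auto
    show "P' \<subseteq> \<kappa> ` P"
    proof
      fix x assume x: "x \<in> P'"
      then have "x \<in> P \<or> - x \<in> P" using P PR unfolding half_of_def by auto
      moreover have "\<kappa> x = x" "\<kappa> (- x) = x" using x P' PR unfolding half_of_def \<kappa>_def by auto
      ultimately show "x \<in> \<kappa> ` P" by (metis imageI)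
    qed
  qed
  have diff: "P' - \<kappa> ` S = \<kappa> ` (P - S)"
    using inj img SP by (auto simp: inj_on_image_set_diff[of \<kappa> P P S])
  obtain s where s: "\<forall>\<alpha>\<in>S. s \<alpha> \<in> {1, -1::real}" "(\<Sum>\<alpha>\<in>S. s \<alpha> *\<^sub>R \<alpha>) = 0"
    using S unfolding well_balanced_def balanced_def by blast
  have "balanced (\<kappa> ` S)"
  proof (rule balanced_imageI[where \<sigma> = "\<lambda>\<alpha>. if \<alpha> \<in> P' then s \<alpha> else - s \<alpha>"])
    show "finite S" using finite_subset[OF SP finite_subset[OF PR(1) finR]] .
    show "inj_on \<kappa> S" using inj_on_subset[OF inj SP] .
    show "(if \<alpha> \<in> P' then s \<alpha> else - s \<alpha>) \<in> {1, -1}" if "\<alpha> \<in> S" for \<alpha> using bspec[OF s(1) that] by auto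
    show "(\<Sum>\<alpha>\<in>S. (if \<alpha> \<in> P' then s \<alpha> else - s \<alpha>) *\<^sub>R \<kappa> \<alpha>) = 0"
      unfolding s(2)[symmetric] by (rule sum.cong) (auto simp: \<kappa>_def)
  qed
  moreover have "strongly_orthogonal R (\<kappa> ` (P - S))"
    unfolding strongly_orthogonal_def
  proof (intro ballI)
    fix x y assume "x \<in> \<kappa> ` (P - S)" "y \<in> \<kappa> ` (P - S)"
    then obtain \<alpha> \<beta> where ab: "\<alpha> \<in> P - S" "\<beta> \<in> P - S" "x = \<alpha> \<or> x = - \<alpha>" "y = \<beta> \<or> y = - \<beta>"
      unfolding \<kappa>_def by (auto split: if_splits)
    have "\<alpha> + \<beta> \<notin> R" "\<alpha> - \<beta> \<notin> R"
      using S ab unfolding well_balanced_def strongly_orthogonal_def by auto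
    moreover have "- \<alpha> - \<beta> \<notin> R" "\<beta> - \<alpha> \<notin> R"
      using calculation neg[of "- \<alpha> - \<beta>"] neg[of "\<beta> - \<alpha>"] by (auto simp: add.commute)
    ultimately show "x + y \<notin> R \<and> x - y \<notin> R"
      using ab(3,4) by (elim disjE) (simp_all add: add.commute)
  qed
  ultimately have "well_balanced R P' (\<kappa> ` S)"
    unfolding well_balanced_def using diff img SP by auto
  moreover have "card (P' - \<kappa> ` S) = card (P - S)"
    unfolding diff using inj_on_subset[OF inj Diff_subset] by (rule card_image)
  ultimately show ?thesis by blast
qed

lemma is_max_cocardinality_change_half:
  assumes "root_system R" "half_of R P" "half_of R P'" "is_max_cocardinality R P m"
  shows "is_max_cocardinality R P' m"
proof -
  obtain S where S: "well_balanced R P S" "card (P - S) = m"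
    and max: "\<And>S. well_balanced R P S \<Longrightarrow> card (P - S) \<le> m"
    using assms(4) unfolding is_max_cocardinality_def by blast
  have "\<exists>S'. well_balanced R P' S' \<and> card (P' - S') = m"
    using well_balanced_change_half[OF assms(1-3) S(1)] S(2) by simp
  moreover have "card (P' - S') \<le> m" if "well_balanced R P' S'" for S'
    using well_balanced_change_half[OF assms(1,3,2) that] max by force
  ultimately show ?thesis unfolding is_max_cocardinality_def by blast
qed

section \<open>Generating the roots by simple reflections\<close>

lemma cartan_number_linear: "linear (\<lambda>x. cartan_number x \<alpha>)"
  unfolding cartan_number_def
  by (intro linearI) (simp_all add: inner_add_left add_divide_distrib distrib_left)

lemma root_reflection_linear: "linear (root_reflection \<alpha>)"
  unfolding root_reflection_def
  by (intro linearI)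
    (simp_all add: linear_add[OF cartan_number_linear] linear_scale[OF cartan_number_linear]
      scaleR_add_left scaleR_diff_right)

lemma root_reflection_involution: "root_reflection \<alpha> (root_reflection \<alpha> \<beta>) = \<beta>"
proof (cases "\<alpha> = 0")
  case True
  then show ?thesis by (simp add: root_reflection_def)
next
  case False
  then have "cartan_number (root_reflection \<alpha> \<beta>) \<alpha> = - cartan_number \<beta> \<alpha>"
    by (simp add: root_reflection_def cartan_number_def inner_diff_left divide_simps)
  then show ?thesis by (simp add: root_reflection_def[of \<alpha> "root_reflection \<alpha> \<beta>"]) (simp add: root_reflection_def)
qed

text \<open>
  Induction on the height of a positive root \<open>\<beta>\<close>. As \<open>\<beta> \<bullet> \<beta> > 0\<close>, some \<open>\<alpha>\<close> in the base with positive
  coefficient in \<open>\<beta>\<close> satisfies \<open>\<beta> \<bullet> \<alpha> > 0\<close>. Unless \<open>\<beta> = \<alpha>\<close>, the reflection of \<open>\<beta>\<close> in \<open>\<alpha>\<close> is a positive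
  root of smaller height, and reflecting once more returns to \<open>\<beta>\<close>.
\<close>

lemma roots_subset_closed:
  fixes R :: "'a::euclidean_space set"
  assumes R: "root_system R" and base: "root_base R \<Delta>"
    and E: "\<Delta> \<subseteq> E" "\<And>\<beta>. \<beta> \<in> E \<Longrightarrow> - \<beta> \<in> E"
      "\<And>\<alpha> \<beta>. \<alpha> \<in> \<Delta> \<Longrightarrow> \<beta> \<in> E \<Longrightarrow> root_reflection \<alpha> \<beta> \<in> E"
  shows "R \<subseteq> E"
proof -
  have \<Delta>: "\<Delta> \<subseteq> R" "independent \<Delta>" using base by (auto simp: root_base_def)
  have fin: "finite \<Delta>" using \<Delta>(1) R finite_subset by (auto simp: root_system_def)
  have pos: "\<beta> \<in> E"
    if "\<beta> \<in> R" "\<beta> = (\<Sum>\<alpha>\<in>\<Delta>. of_int (c \<alpha>) *\<^sub>R \<alpha>)" "\<And>\<alpha>. \<alpha> \<in> \<Delta> \<Longrightarrow> c \<alpha> \<ge> 0"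
    for \<beta> and c :: "'a \<Rightarrow> int"
    using that
  proof (induction "nat (\<Sum>\<alpha>\<in>\<Delta>. c \<alpha>)" arbitrary: \<beta> c rule: less_induct)
    case less
    have "\<beta> \<noteq> 0" using less.prems(1) R by (auto simp: root_system_def)
    then have "0 < \<beta> \<bullet> \<beta>" by simp
    also have "\<beta> \<bullet> \<beta> = (\<Sum>\<alpha>\<in>\<Delta>. of_int (c \<alpha>) * (\<beta> \<bullet> \<alpha>))"
      by (subst (2) less.prems(2)) (simp add: inner_sum_right)
    finally obtain \<alpha> where \<alpha>: "\<alpha> \<in> \<Delta>" "of_int (c \<alpha>) * (\<beta> \<bullet> \<alpha>) > 0"
      by (metis (no_types, lifting) not_le sum_nonpos)
    have c\<alpha>: "c \<alpha> > 0" "\<beta> \<bullet> \<alpha> > 0"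
      using \<alpha> less.prems(3)[of \<alpha>] by (auto simp: zero_less_mult_iff)
    have \<alpha>R: "\<alpha> \<in> R" using \<alpha> \<Delta> by auto
    show "\<beta> \<in> E"
    proof (cases "\<forall>\<gamma>\<in>\<Delta>. \<gamma> \<noteq> \<alpha> \<longrightarrow> c \<gamma> = 0")
      case True
      then have "\<beta> = of_int (c \<alpha>) *\<^sub>R \<alpha>"
        unfolding less.prems(2) using fin \<alpha>(1) by (subst sum.remove[of _ \<alpha>]) auto
      moreover from this have "of_int (c \<alpha>) = (1::real) \<or> of_int (c \<alpha>) = (-1::real)"
        using R \<alpha>R less.prems(1) unfolding root_system_def by metis
      ultimately show ?thesis using E(1) \<alpha>(1) c\<alpha> by auto
    next
      case False
      then obtain \<gamma> where \<gamma>: "\<gamma> \<in> \<Delta>" "\<gamma> \<noteq> \<alpha>" "c \<gamma> > 0"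
        using less.prems(3) by force
      obtain k :: int where k: "cartan_number \<beta> \<alpha> = of_int k"
        using R \<alpha>R less.prems(1) unfolding root_system_def by (metis Ints_cases)
      have "\<alpha> \<noteq> 0" using \<alpha>R R by (auto simp: root_system_def)
      then have "cartan_number \<beta> \<alpha> > 0" using c\<alpha> by (simp add: cartan_number_def)
      then have k0: "k > 0" using k by simp
      define \<beta>' where "\<beta>' = root_reflection \<alpha> \<beta>"
      define c' where "c' = c(\<alpha> := c \<alpha> - k)"
      have \<beta>'R: "\<beta>' \<in> R" using R \<alpha>R less.prems(1) by (auto simp: root_system_def \<beta>'_def)
      have \<beta>': "\<beta>' = (\<Sum>\<delta>\<in>\<Delta>. of_int (c' \<delta>) *\<^sub>R \<delta>)"
      proof -
        have "\<beta>' = \<beta> - of_int k *\<^sub>R \<alpha>" by (simp add: \<beta>'_def root_reflection_def k)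
        also have "\<dots> = (\<Sum>\<delta>\<in>\<Delta>. of_int (c' \<delta>) *\<^sub>R \<delta>)"
          unfolding less.prems(2) c'_def using fin \<alpha>(1)
          by (simp add: sum.remove[of _ \<alpha>] algebra_simps)
        finally show ?thesis .
      qed
      obtain d :: "'a \<Rightarrow> int" where d: "\<beta>' = (\<Sum>\<delta>\<in>\<Delta>. of_int (d \<delta>) *\<^sub>R \<delta>)"
        "(\<forall>\<delta>\<in>\<Delta>. d \<delta> \<ge> 0) \<or> (\<forall>\<delta>\<in>\<Delta>. d \<delta> \<le> 0)"
        using base \<beta>'R unfolding root_base_def by blast
      have eq: "d \<delta> = c' \<delta>" if "\<delta> \<in> \<Delta>" for \<delta>
      proof -
        obtain g :: "'a \<Rightarrow> real" where g: "linear g"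
          "\<forall>\<epsilon>\<in>\<Delta>. g \<epsilon> = (if \<epsilon> = \<delta> then 1 else 0)"
          using linear_independent_extend[OF \<Delta>(2), of "\<lambda>\<epsilon>. if \<epsilon> = \<delta> then 1 else 0"] by blast
        have "g (\<Sum>\<epsilon>\<in>\<Delta>. of_int (m \<epsilon>) *\<^sub>R \<epsilon>) = of_int (m \<delta>)" for m :: "'a \<Rightarrow> int"
          using fin that by (simp add: linear_sum[OF g(1)] linear_scale[OF g(1)] g(2) if_distrib sum.delta' cong: if_cong)
        from this[of d] this[of c'] show ?thesis using d(1) \<beta>' by (metis of_int_eq_iff)
      qed
      \<comment> \<open>The reflection leaves the coefficient of \<open>\<gamma>\<close> alone, and a root has no coefficients of both signs.\<close>
      have "d \<gamma> > 0" using eq[OF \<gamma>(1)] \<gamma> by (simp add: c'_def)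
      then have c'0: "c' \<delta> \<ge> 0" if "\<delta> \<in> \<Delta>" for \<delta>
        using d(2) \<gamma>(1) eq[OF that] that by force
      have "(\<Sum>\<delta>\<in>\<Delta>. c' \<delta>) = (\<Sum>\<delta>\<in>\<Delta>. c \<delta>) - k"
        unfolding c'_def using fin \<alpha>(1) by (simp add: sum.remove[of _ \<alpha>])
      moreover have "(\<Sum>\<delta>\<in>\<Delta>. c' \<delta>) \<ge> 0" using c'0 by (simp add: sum_nonneg)
      ultimately have "nat (\<Sum>\<delta>\<in>\<Delta>. c' \<delta>) < nat (\<Sum>\<delta>\<in>\<Delta>. c \<delta>)" using k0 by linarith
      then have "\<beta>' \<in> E" using less.hyps \<beta>'R \<beta>' c'0 by blast
      then have "root_reflection \<alpha> \<beta>' \<in> E" using E(3) \<alpha>(1) by blast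
      then show ?thesis by (simp add: \<beta>'_def root_reflection_involution)
    qed
  qed
  show ?thesis
  proof
    fix \<beta> assume \<beta>: "\<beta> \<in> R"
    then obtain c :: "'a \<Rightarrow> int" where c: "\<beta> = (\<Sum>\<alpha>\<in>\<Delta>. of_int (c \<alpha>) *\<^sub>R \<alpha>)"
      "(\<forall>\<alpha>\<in>\<Delta>. c \<alpha> \<ge> 0) \<or> (\<forall>\<alpha>\<in>\<Delta>. c \<alpha> \<le> 0)"
      using base unfolding root_base_def by blast
    show "\<beta> \<in> E"
    proof (cases "\<forall>\<alpha>\<in>\<Delta>. c \<alpha> \<ge> 0")
      case True
      then show ?thesis using pos[OF \<beta> c(1)] by blast
    next
      case False
      then have "- \<beta> \<in> E"
        using c root_system_uminus[OF R \<beta>]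
        by (intro pos[where c = "\<lambda>\<alpha>. - c \<alpha>"]) (auto simp: sum_negf)
      then show ?thesis using E(2) by force
    qed
  qed
qed

section \<open>Orthogonality and parity\<close>

text \<open>
  If \<open>\<alpha> \<bullet> \<beta> > 0\<close>, both Cartan numbers are positive integers, and their product is below 4 by the strict
  Cauchy-Schwarz inequality. So one of them is 1, and the corresponding reflection gives
  \<open>\<plusminus>(\<alpha> - \<beta>)\<close> as a root.
\<close>

lemma strongly_orthogonal_imp_orthogonal:
  assumes R: "root_system R" and "\<alpha> \<in> R" "\<beta> \<in> R" "\<alpha> \<noteq> \<beta>" "\<alpha> \<noteq> - \<beta>" "\<alpha> + \<beta> \<notin> R" "\<alpha> - \<beta> \<notin> R"
  shows "\<alpha> \<bullet> \<beta> = 0"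
proof -
  have main: "\<alpha> - \<beta> \<in> R" if ab: "\<alpha> \<in> R" "\<beta> \<in> R" "\<alpha> \<noteq> \<beta>" "\<alpha> \<noteq> - \<beta>" "\<alpha> \<bullet> \<beta> > 0" for \<alpha> \<beta>
  proof -
    have nz: "\<alpha> \<noteq> 0" "\<beta> \<noteq> 0" using ab R by (auto simp: root_system_def)
    obtain p q :: int where pq: "cartan_number \<alpha> \<beta> = of_int p" "cartan_number \<beta> \<alpha> = of_int q"
      using R ab(1,2) unfolding root_system_def by (metis Ints_cases)
    have "cartan_number \<alpha> \<beta> > 0" "cartan_number \<beta> \<alpha> > 0"
      using ab(5) nz by (auto simp: cartan_number_def inner_commute)
    then have pos: "p > 0" "q > 0" using pq by auto
    have "(\<alpha> \<bullet> \<beta>)\<^sup>2 < (\<alpha> \<bullet> \<alpha>) * (\<beta> \<bullet> \<beta>)"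
    proof (rule ccontr)
      assume "\<not> ?thesis"
      then have "(\<alpha> \<bullet> \<beta>)\<^sup>2 = (norm \<alpha> * norm \<beta>)\<^sup>2"
        using Cauchy_Schwarz_ineq[of \<alpha> \<beta>] by (simp add: power_mult_distrib dot_square_norm)
      then have "\<alpha> \<bullet> \<beta> = norm \<alpha> * norm \<beta>"
        using ab(5) by (metis less_eq_real_def mult_nonneg_nonneg norm_ge_zero power2_eq_imp_eq)
      then have "norm \<alpha> *\<^sub>R \<beta> = norm \<beta> *\<^sub>R \<alpha>" by (simp add: norm_cauchy_schwarz_eq)
      then have "\<beta> = (norm \<beta> / norm \<alpha>) *\<^sub>R \<alpha>" using nz
        by (metis divide_inverse mult.commute norm_eq_zero real_vector.scale_scale scaleR_left_imp_eq vector_fraction_eq_iff)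
      then have "norm \<beta> / norm \<alpha> = 1 \<or> norm \<beta> / norm \<alpha> = - 1"
        using R ab(1,2) unfolding root_system_def by metis
      then have "\<beta> = \<alpha> \<or> \<beta> = - \<alpha>" using \<open>\<beta> = _\<close> by (metis scaleR_minus1_left scaleR_one)
      then show False using ab(3,4) by auto
    qed
    then have "cartan_number \<alpha> \<beta> * cartan_number \<beta> \<alpha> < 4"
      using nz by (simp add: cartan_number_def inner_commute divide_simps power2_eq_square mult.commute)
    then have "real_of_int (p * q) < 4" unfolding pq by simp
    then have "p * q < 4" by linarith
    have "p = 1 \<or> q = 1"
    proof (rule ccontr)
      assume "\<not> ?thesis"
      then have "p \<ge> 2" "q \<ge> 2" using pos by auto
      then have "p * q \<ge> 2 * 2" by (intro mult_mono) auto
      then show False using \<open>p * q < 4\<close> by simp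
    qed
    then show ?thesis
    proof
      assume "p = 1"
      then have "root_reflection \<beta> \<alpha> = \<alpha> - \<beta>" by (simp add: root_reflection_def pq)
      then show ?thesis using R ab(1,2) unfolding root_system_def by metis
    next
      assume "q = 1"
      then have "root_reflection \<alpha> \<beta> = - (\<alpha> - \<beta>)" by (simp add: root_reflection_def pq)
      then show ?thesis using R ab(1,2) root_system_uminus unfolding root_system_def by (metis minus_minus)
    qed
  qed
  have "\<not> \<alpha> \<bullet> \<beta> > 0" using main[of \<alpha> \<beta>] assms by blast
  moreover have "\<not> \<alpha> \<bullet> - \<beta> > 0"
    using main[of \<alpha> "- \<beta>"] assms root_system_uminus[OF R] by auto
  ultimately show ?thesis by simp
qed

lemma card_strongly_orthogonal_le_dim:
  assumes R: "root_system R" and P: "half_of R P" and T: "T \<subseteq> P" "strongly_orthogonal R T" "T \<subseteq> span B"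
  shows "card T \<le> dim B"
proof -
  have "pairwise orthogonal T"
    unfolding pairwise_def orthogonal_def
  proof (intro ballI impI)
    fix \<alpha> \<beta> assume ab: "\<alpha> \<in> T" "\<beta> \<in> T" "\<alpha> \<noteq> \<beta>"
    then have "\<alpha> \<in> P" "\<beta> \<in> P" "\<beta> \<in> R" using T P by (auto simp: half_of_def)
    then have "\<alpha> \<noteq> - \<beta>" using P by (auto simp: half_of_def)
    then show "\<alpha> \<bullet> \<beta> = 0"
      using strongly_orthogonal_imp_orthogonal[OF R, of \<alpha> \<beta>] ab T P
      unfolding half_of_def strongly_orthogonal_def by blast
  qed
  moreover have "0 \<notin> T" using R P T by (auto simp: root_system_def half_of_def)
  ultimately have "independent T" by (rule pairwise_orthogonal_independent)
  then show ?thesis using T(3) by (metis dim_eq_card_independent dim_mono)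
qed

text \<open>
  Adding the vanishing signed sum to the sum of \<open>S\<close> doubles the roots of sign \<open>1\<close> and cancels the
  others.
\<close>

lemma balanced_parity:
  fixes f :: "'a::euclidean_space \<Rightarrow> real"
  assumes P: "finite P" and S: "S \<subseteq> P" "balanced S" and f: "linear f"
    and int: "\<And>\<alpha>. \<alpha> \<in> P \<Longrightarrow> f \<alpha> \<in> \<int>"
  shows "\<exists>m::int. f (\<Sum>P) = f (\<Sum>(P - S)) + 2 * of_int m"
proof -
  obtain s where s: "\<forall>\<alpha>\<in>S. s \<alpha> \<in> {1, -1::real}" "(\<Sum>\<alpha>\<in>S. s \<alpha> *\<^sub>R \<alpha>) = 0"
    using S(2) unfolding balanced_def by blast
  have fin: "finite S" using finite_subset[OF S(1) P] .
  define U where "U = {\<alpha>\<in>S. s \<alpha> = 1}"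
  have "\<Sum>S = (\<Sum>\<alpha>\<in>S. (1 + s \<alpha>) *\<^sub>R \<alpha>) - (\<Sum>\<alpha>\<in>S. s \<alpha> *\<^sub>R \<alpha>)"
    by (simp add: sum_subtractf[symmetric] algebra_simps)
  also have "\<dots> = (\<Sum>\<alpha>\<in>S. if s \<alpha> = 1 then 2 *\<^sub>R \<alpha> else 0)"
    using s by (auto intro!: sum.cong)
  also have "\<dots> = (\<Sum>\<alpha>\<in>U. 2 *\<^sub>R \<alpha>)"
    unfolding U_def using fin by (intro sum.inter_filter[symmetric])
  finally have "f (\<Sum>S) = 2 * (\<Sum>\<alpha>\<in>U. f \<alpha>)"
    by (simp add: linear_sum[OF f] linear_scale[OF f] sum_distrib_left)
  moreover have "(\<Sum>\<alpha>\<in>U. f \<alpha>) \<in> \<int>"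
    using int S(1) by (intro Ints_sum) (auto simp: U_def)
  then obtain m where "(\<Sum>\<alpha>\<in>U. f \<alpha>) = of_int m" by (elim Ints_cases)
  moreover have "\<Sum>P = \<Sum>(P - S) + \<Sum>S"
    using P S(1) by (simp add: sum.subset_diff)
  ultimately have "f (\<Sum>P) = f (\<Sum>(P - S)) + 2 * of_int m"
    by (simp add: linear_add[OF f])
  then show ?thesis ..
qed

lemma is_max_cocardinalityI:
  assumes "root_system R" "half_of R P" "half_of R P'"
    and "\<exists>S. well_balanced R P' S \<and> card (P' - S) = m"
    and "\<And>S. well_balanced R P' S \<Longrightarrow> card (P' - S) \<le> m"
  shows "is_max_cocardinality R P m"
  using is_max_cocardinality_change_half[OF assms(1,3,2)] assms(4,5)
  unfolding is_max_cocardinality_def by blast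

section \<open>The classical root systems in coordinates\<close>

text \<open>
  The base is renumbered from 0, in agreement with the coordinate vectors introduced below.
\<close>

lemma dynkin_base_from_0:
  fixes R :: "'a::euclidean_space set"
  assumes "has_dynkin_type R X" "dynkin_rank X = n"
  shows "\<exists>b. inj_on b {..<n} \<and> root_base R (b ` {..<n}) \<and>
    (\<forall>i<n. \<forall>j<n. cartan_number (b i) (b j) = of_int (cartan_matrix X (Suc i) (Suc j)))"
proof -
  obtain a :: "nat \<Rightarrow> 'a" where a: "inj_on a {1..n}" "root_base R (a ` {1..n})"
    "\<forall>i\<in>{1..n}. \<forall>j\<in>{1..n}. cartan_number (a i) (a j) = of_int (cartan_matrix X i j)"
    using assms unfolding has_dynkin_type_def by blast
  have Suc: "Suc ` {..<n} = {1..n}"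
    by (simp add: lessThan_atLeast0 image_Suc_atLeastLessThan atLeastLessThanSuc_atLeastAtMost)
  show ?thesis
  proof (intro exI[of _ "a \<circ> Suc"] conjI allI impI)
    show "inj_on (a \<circ> Suc) {..<n}" using a(1) Suc by (intro comp_inj_on) auto
    show "root_base R ((a \<circ> Suc) ` {..<n})" using a(2) Suc by (metis image_comp)
    show "cartan_number ((a \<circ> Suc) i) ((a \<circ> Suc) j) = of_int (cartan_matrix X (Suc i) (Suc j))"
      if "i < n" "j < n" for i j using a(3) that by auto
  qed
qed

lemma base_functional:
  fixes R :: "'a::euclidean_space set" and f :: "nat \<Rightarrow> real"
  assumes "inj_on b {..<n}" "root_base R (b ` {..<n})"
  shows "\<exists>g. linear g \<and> (\<forall>k<n. g (b k) = f k)"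
proof -
  have "independent (b ` {..<n})" using assms(2) by (simp add: root_base_def)
  from linear_independent_extend[OF this, of "\<lambda>x. f (the_inv_into {..<n} b x)"]
  obtain g :: "'a \<Rightarrow> real" where g: "linear g"
    "\<forall>\<delta>\<in>b ` {..<n}. g \<delta> = f (the_inv_into {..<n} b \<delta>)" by blast
  then show ?thesis using assms(1) by (intro exI[of _ g]) (auto simp: the_inv_into_f_f)
qed

lemma base_in_roots: "root_base R (b ` {..<n}) \<Longrightarrow> k < n \<Longrightarrow> b k \<in> R"
  by (auto simp: root_base_def)

lemma root_reflection_in_roots:
  "root_system R \<Longrightarrow> \<alpha> \<in> R \<Longrightarrow> \<beta> \<in> R \<Longrightarrow> root_reflection \<alpha> \<beta> \<in> R"
  by (simp add: root_system_def)

text \<open>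
  Along a chain \<open>e\<^sub>0 - e\<^sub>1, e\<^sub>1 - e\<^sub>2, \<dots>\<close> of base roots, linear functions of the \<open>e\<^sub>i\<close> are given through
  their differences.
\<close>

lemma equal_differences:
  fixes f g :: "nat \<Rightarrow> real"
  assumes "\<And>i. Suc i < n \<Longrightarrow> f i - f (Suc i) = g i - g (Suc i)" "i < n" "j < n"
  shows "f i - f j = g i - g j"
proof -
  have "f 0 - f i = g 0 - g i" if "i < n" for i
    using that
  proof (induction i)
    case (Suc i)
    then show ?case using assms(1)[of i] by simp
  qed simp
  from this[OF assms(2)] this[OF assms(3)] show ?thesis by simp
qed

text \<open>
  The reflection in \<open>e\<^sub>k - e\<^sub>k\<^sub>+\<^sub>1\<close> permutes the \<open>e\<^sub>i\<close> by this transposition.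
\<close>

definition adjacent_swap :: "nat \<Rightarrow> nat \<Rightarrow> nat" where
  "adjacent_swap k i = (if i = k then Suc k else if i = Suc k then k else i)"

lemma adjacent_swap_eq_iff: "adjacent_swap k i = adjacent_swap k j \<longleftrightarrow> i = j"
  by (auto simp: adjacent_swap_def)

definition A_roots :: "(nat \<Rightarrow> 'a::euclidean_space) \<Rightarrow> nat \<Rightarrow> 'a set" where
  "A_roots e N = {e i - e j | i j. i < N \<and> j < N \<and> i \<noteq> j}"

lemma adjacent_swap_less: "i < N \<Longrightarrow> Suc k < N \<Longrightarrow> adjacent_swap k i < N"
  by (auto simp: adjacent_swap_def)

text \<open>
  The reflection in \<open>e\<^sub>j - e\<^sub>j\<^sub>+\<^sub>1\<close> moves \<open>e\<^sub>i - e\<^sub>j\<close> to \<open>e\<^sub>i - e\<^sub>j\<^sub>+\<^sub>1\<close>.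
\<close>

lemma differences_in_roots:
  assumes R: "root_system R"
    and b: "\<And>k. Suc k < N \<Longrightarrow> e k - e (Suc k) \<in> R"
    and refl: "\<And>k i j. Suc k < N \<Longrightarrow> i < N \<Longrightarrow> j < N \<Longrightarrow> root_reflection (e k - e (Suc k)) (e i - e j)
        = e (adjacent_swap k i) - e (adjacent_swap k j)"
    and ij: "i < j" "j < N"
  shows "e i - e j \<in> R"
  using ij
proof (induction j)
  case (Suc j)
  show ?case
  proof (cases "i = j")
    case False
    then have "e i - e j \<in> R" using Suc by simp
    then have "root_reflection (e j - e (Suc j)) (e i - e j) \<in> R"
      using R b[of j] Suc.prems by (simp add: root_reflection_in_roots)
    then show ?thesis using refl[of j i j] Suc.prems False by (simp add: adjacent_swap_def)
  qed (use b Suc in simp)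
qed simp

text \<open>
  The base determines the \<open>n + 1\<close> vectors \<open>e\<^sub>i\<close> only up to a common translation, and the span of the
  roots has dimension \<open>n\<close>. So the functionals \<open>c\<^sub>v\<close> are dual to the \<open>e\<^sub>i\<close> on differences only.
\<close>

lemma type_A_coordinates:
  fixes R :: "'a::euclidean_space set"
  assumes R: "root_system R" and A: "has_dynkin_type R (Type_A n)"
  obtains e :: "nat \<Rightarrow> 'a" and c :: "nat \<Rightarrow> 'a \<Rightarrow> real" where
    "\<And>v. linear (c v)"
    "\<And>v i j. v < Suc n \<Longrightarrow> i < Suc n \<Longrightarrow> j < Suc n \<Longrightarrow>
       c v (e i - e j) = (if v = i then 1 else 0) - (if v = j then 1 else 0)"
    "R = A_roots e (Suc n)"
proof -
  obtain b where b: "inj_on b {..<n}" "root_base R (b ` {..<n})"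
    "\<forall>i<n. \<forall>j<n. cartan_number (b i) (b j) = of_int (cartan_matrix (Type_A n) (Suc i) (Suc j))"
    using dynkin_base_from_0[OF A dynkin_rank.simps(1)] by blast
  have "\<exists>g :: 'a \<Rightarrow> real. linear g \<and> (\<forall>k<n. g (b k) = (if v = k then 1 else 0) - (if v = Suc k then 1 else 0))"
    for v :: nat
    by (rule base_functional[OF b(1,2)])
  then obtain c :: "nat \<Rightarrow> 'a \<Rightarrow> real" where
    "\<forall>v. linear (c v) \<and> (\<forall>k<n. c v (b k) = (if v = k then 1 else 0) - (if v = Suc k then 1 else 0))"
    by (atomize_elim, intro choice allI)
  then have c: "linear (c v)"
    "k < n \<Longrightarrow> c v (b k) = (if v = k then 1 else 0) - (if v = Suc k then 1 else 0)" for v k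
    by blast+
  define e where "e i = - (\<Sum>k<i. b k)" for i
  have diff: "e k - e (Suc k) = b k" for k by (simp add: e_def)
  have coord: "c v (e i - e j) = (if v = i then 1 else 0) - (if v = j then 1 else 0)"
    if "i < Suc n" "j < Suc n" for v i j
  proof -
    have "c v (e k) - c v (e (Suc k)) = (if v = k then 1 else 0) - (if v = Suc k then 1 else 0)"
      if "Suc k < Suc n" for k
      using that c by (simp flip: linear_diff[OF c(1)] add: diff)
    from equal_differences[where f = "\<lambda>k. c v (e k)" and g = "\<lambda>k. if v = k then 1 else 0", OF this that] show ?thesis by (simp add: linear_diff[OF c(1)])
  qed
  have cartan: "cartan_number (e i - e j) (b k) =
      (((if i = k then 1 else 0) - (if i = Suc k then 1 else 0)) -
       ((if j = k then 1 else 0) - (if j = Suc k then 1 else 0)))"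
    if "i < Suc n" "j < Suc n" "k < n" for i j k
  proof -
    have "cartan_number (e i) (b k) - cartan_number (e (Suc i)) (b k) =
       ((if i = k then 1 else 0) - (if i = Suc k then 1 else 0)) -
       ((if Suc i = k then 1 else 0) - (if Suc i = Suc k then 1 else 0))" if "Suc i < Suc n" for i
      using that b(3)[rule_format, of i k] \<open>k < n\<close>
      by (simp flip: linear_diff[OF cartan_number_linear] add: diff cartan_matrix_def)
    from equal_differences[where f = "\<lambda>i. cartan_number (e i) (b k)" and
        g = "\<lambda>i. (if i = k then 1 else 0) - (if i = Suc k then 1 else 0)", OF this that(1,2)] show ?thesis
      by (simp add: linear_diff[OF cartan_number_linear])
  qed
  have refl: "root_reflection (e k - e (Suc k)) (e i - e j) =
      e (adjacent_swap k i) - e (adjacent_swap k j)"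
    if "i < Suc n" "j < Suc n" "Suc k < Suc n" for i j k
  proof -
    define \<phi> :: "nat \<Rightarrow> real" where
      "\<phi> i = (if i = k then 1 else 0) - (if i = Suc k then 1 else 0)" for i
    have "e i - \<phi> i *\<^sub>R b k = e (adjacent_swap k i)" for i
      unfolding \<phi>_def adjacent_swap_def diff[symmetric] by simp
    moreover have "root_reflection (b k) (e i - e j) = (e i - \<phi> i *\<^sub>R b k) - (e j - \<phi> j *\<^sub>R b k)"
      using cartan[of i j k] that unfolding root_reflection_def \<phi>_def[symmetric]
      by (simp add: scaleR_left_diff_distrib)
    ultimately show ?thesis by (simp add: diff)
  qed
  have "R \<subseteq> A_roots e (Suc n)"
  proof (rule roots_subset_closed[OF R b(2)])
    show "b ` {..<n} \<subseteq> A_roots e (Suc n)"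
      unfolding A_roots_def diff[symmetric] by fastforce
    show "- \<beta> \<in> A_roots e (Suc n)" if "\<beta> \<in> A_roots e (Suc n)" for \<beta>
      using that unfolding A_roots_def by (smt (verit) minus_diff_eq mem_Collect_eq)
    show "root_reflection \<alpha> \<beta> \<in> A_roots e (Suc n)"
      if \<alpha>\<beta>: "\<alpha> \<in> b ` {..<n}" "\<beta> \<in> A_roots e (Suc n)" for \<alpha> \<beta>
    proof -
      obtain k i j where k: "k < n" "\<alpha> = b k" and ij: "\<beta> = e i - e j" "i < Suc n" "j < Suc n" "i \<noteq> j"
        using \<alpha>\<beta> unfolding A_roots_def by blast
      have "root_reflection \<alpha> \<beta> = e (adjacent_swap k i) - e (adjacent_swap k j)"
        using refl[of i j k] k ij by (simp add: diff)
      moreover have "adjacent_swap k i \<noteq> adjacent_swap k j" using ij(4) by (simp add: adjacent_swap_eq_iff)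
      ultimately show ?thesis
        unfolding A_roots_def using k ij adjacent_swap_less[of _ "Suc n" k] by blast
    qed
  qed
  moreover have "A_roots e (Suc n) \<subseteq> R"
  proof
    fix \<alpha> assume "\<alpha> \<in> A_roots e (Suc n)"
    then obtain i j where ij: "\<alpha> = e i - e j" "i < Suc n" "j < Suc n" "i \<noteq> j"
      unfolding A_roots_def by blast
    have dR: "e i - e j \<in> R" if "i < j" "j < Suc n" for i j
      using differences_in_roots[OF R, of "Suc n" e i j] that refl base_in_roots[OF b(2)] by (simp add: diff)
    show "\<alpha> \<in> R"
    proof (cases "i < j")
      case False
      then have "e j - e i \<in> R" using dR[of j i] ij by simp
      then show ?thesis using root_system_uminus[OF R] ij(1) by fastforce
    qed (use dR ij in simp)
  qed
  ultimately have "R = A_roots e (Suc n)" by blast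
  then show thesis using that[OF c(1) coord] by blast
qed

definition D_roots :: "(nat \<Rightarrow> 'a::euclidean_space) \<Rightarrow> nat \<Rightarrow> 'a set" where
  "D_roots e n = {s *\<^sub>R e i + t *\<^sub>R e j | s t i j. i < n \<and> j < n \<and> i \<noteq> j \<and> s \<in> {1, -1} \<and> t \<in> {1, -1}}"

text \<open>
  The parameter \<open>m\<close> is 1 in type B and 2 in type C.
\<close>

definition axis_roots :: "real \<Rightarrow> (nat \<Rightarrow> 'a::euclidean_space) \<Rightarrow> nat \<Rightarrow> 'a set" where
  "axis_roots m e n = {s *\<^sub>R e i | s i. i < n \<and> s \<in> {m, -m}}"

text \<open>
  The simple reflections of types B, C and D act like this on the coordinate vectors, which makes
  the closure of the root sets under them evident.
\<close>

definition signed_permutation :: "('a::euclidean_space \<Rightarrow> 'a) \<Rightarrow> (nat \<Rightarrow> 'a) \<Rightarrow> nat \<Rightarrow> bool" where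
  "signed_permutation w e n \<longleftrightarrow> linear w \<and>
     (\<exists>\<pi> \<epsilon>. inj_on \<pi> {..<n} \<and> (\<forall>i<n. \<pi> i < n \<and> \<epsilon> i \<in> {1, -1::real} \<and> w (e i) = \<epsilon> i *\<^sub>R e (\<pi> i)))"

lemma signed_permutation_D_roots:
  assumes w: "signed_permutation w e n" and "\<beta> \<in> D_roots e n"
  shows "w \<beta> \<in> D_roots e n"
proof -
  obtain s t i j where \<beta>: "\<beta> = s *\<^sub>R e i + t *\<^sub>R e j" "i < n" "j < n" "i \<noteq> j" "s \<in> {1, -1}" "t \<in> {1, -1}"
    using assms(2) unfolding D_roots_def by blast
  obtain \<pi> \<epsilon> where \<pi>: "inj_on \<pi> {..<n}" "\<And>i. i < n \<Longrightarrow> \<pi> i < n"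
    and \<epsilon>: "\<And>i. i < n \<Longrightarrow> \<epsilon> i \<in> {1, -1}" "\<And>i. i < n \<Longrightarrow> w (e i) = \<epsilon> i *\<^sub>R e (\<pi> i)"
    using w unfolding signed_permutation_def by metis
  have lin: "linear w" using w by (simp add: signed_permutation_def)
  have "w \<beta> = (s * \<epsilon> i) *\<^sub>R e (\<pi> i) + (t * \<epsilon> j) *\<^sub>R e (\<pi> j)"
    using \<beta> \<epsilon>(2) by (simp add: linear_add[OF lin] linear_scale[OF lin])
  moreover have "\<pi> i \<noteq> \<pi> j" using \<pi>(1) \<beta> by (auto simp: inj_on_def)
  moreover have "s * \<epsilon> i \<in> {1, -1}" "t * \<epsilon> j \<in> {1, -1}" using \<beta> \<epsilon>(1)[of i] \<epsilon>(1)[of j] by auto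
  ultimately show ?thesis unfolding D_roots_def using \<pi>(2) \<beta>(2,3) by blast
qed

lemma signed_permutation_axis_roots:
  assumes w: "signed_permutation w e n" and "\<beta> \<in> axis_roots m e n"
  shows "w \<beta> \<in> axis_roots m e n"
proof -
  obtain s i where \<beta>: "\<beta> = s *\<^sub>R e i" "i < n" "s \<in> {m, -m}"
    using assms(2) unfolding axis_roots_def by blast
  obtain \<pi> \<epsilon> where \<pi>: "\<pi> i < n" and \<epsilon>: "\<epsilon> \<in> {1, -1}" "w (e i) = \<epsilon> *\<^sub>R e (\<pi> i)"
    using w \<beta>(2) unfolding signed_permutation_def by metis
  have lin: "linear w" using w by (simp add: signed_permutation_def)
  have "w \<beta> = (s * \<epsilon>) *\<^sub>R e (\<pi> i)"
    using \<beta> \<epsilon>(2) by (simp add: linear_scale[OF lin])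
  moreover have "s * \<epsilon> \<in> {m, -m}" using \<beta> \<epsilon>(1) by auto
  ultimately show ?thesis unfolding axis_roots_def using \<pi> by blast
qed

lemma uminus_D_roots: "\<beta> \<in> D_roots e n \<Longrightarrow> - \<beta> \<in> D_roots e n"
  by (rule signed_permutation_D_roots[of uminus])
    (auto simp: signed_permutation_def module_hom_uminus intro!: exI[of _ id] exI[of _ "\<lambda>_. -1"] linear_compose_neg linear_id)

lemma uminus_axis_roots: "\<beta> \<in> axis_roots m e n \<Longrightarrow> - \<beta> \<in> axis_roots m e n"
  unfolding axis_roots_def by force

text \<open>
  The dual functionals \<open>c\<^sub>v\<close> are the form in which the independence of the \<open>e\<^sub>i\<close> is used.
\<close>

locale coordinates =
  fixes e :: "nat \<Rightarrow> 'a::euclidean_space" and c :: "nat \<Rightarrow> 'a \<Rightarrow> real" and n :: nat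
  assumes linear_c: "linear (c v)"
    and c_e: "v < n \<Longrightarrow> i < n \<Longrightarrow> c v (e i) = (if v = i then 1 else 0)"


text \<open>
  The part common to the Dynkin diagrams of types B, C and D: the first \<open>n - 1\<close> base roots form a
  chain, and \<open>x\<close> is the last coordinate vector, namely \<open>b\<^sub>n\<^sub>-\<^sub>1\<close> in type B, \<open>b\<^sub>n\<^sub>-\<^sub>1 / 2\<close> in type C, and
  \<open>(b\<^sub>n\<^sub>-\<^sub>1 - b\<^sub>n\<^sub>-\<^sub>2) / 2\<close> in type D.
\<close>

locale difference_chain =
  fixes R :: "'a::euclidean_space set" and b :: "nat \<Rightarrow> 'a" and n :: nat and x :: 'a
  assumes roots: "root_system R" and b_inj: "inj_on b {..<n}" and b_base: "root_base R (b ` {..<n})"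
    and n: "n \<ge> 2"
    and cartan_b: "\<And>i j. Suc i < n \<Longrightarrow> Suc j < n \<Longrightarrow> cartan_number (b i) (b j) =
        (if i = j then 2 else if i = Suc j \<or> j = Suc i then -1 else 0)"
    and cartan_x: "\<And>j. Suc j < n \<Longrightarrow> cartan_number x (b j) = (if Suc (Suc j) = n then -1 else 0)"
begin

lemma last_less: "n - 1 < n"
  using n by simp

definition e :: "nat \<Rightarrow> 'a" where
  "e j = x + (\<Sum>k\<in>{j..<n-1}. b k)"

lemma e_last: "e (n - 1) = x"
  by (simp add: e_def)

lemma e_diff: "Suc j < n \<Longrightarrow> e j - e (Suc j) = b j"
  by (simp add: e_def sum.atLeast_Suc_lessThan)

lemma cartan_e:
  assumes k: "Suc k < n" and i: "i < n"
  shows "cartan_number (e i) (b k) = (if i = k then 1 else 0) - (if i = Suc k then 1 else 0)"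
proof -
  have "cartan_number (e i) (b k) - cartan_number (e (Suc i)) (b k) =
       ((if i = k then 1 else 0) - (if i = Suc k then 1 else 0)) -
       ((if Suc i = k then 1 else 0) - (if Suc i = Suc k then 1 else 0))" if "Suc i < n" for i
    using that cartan_b[of i k] k
    by (simp flip: linear_diff[OF cartan_number_linear] add: e_diff)
  from equal_differences[where f = "\<lambda>i. cartan_number (e i) (b k)" and
        g = "\<lambda>i. (if i = k then 1 else 0) - (if i = Suc k then 1 else 0)", OF this i last_less] show ?thesis
    using k n cartan_x[of k] unfolding e_last by (auto split: if_splits)
qed

lemma reflection_e: "Suc k < n \<Longrightarrow> i < n \<Longrightarrow> root_reflection (b k) (e i) = e (adjacent_swap k i)"
  using cartan_e[of k i] e_diff[of k, symmetric] by (auto simp: root_reflection_def adjacent_swap_def)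

lemma signed_permutation_chain:
  assumes "Suc k < n"
  shows "signed_permutation (root_reflection (b k)) e n"
  unfolding signed_permutation_def
proof (intro conjI exI[of _ "adjacent_swap k"] exI[of _ "\<lambda>_. 1"] allI impI)
  show "inj_on (adjacent_swap k) {..<n}" by (auto simp: inj_on_def adjacent_swap_eq_iff)
qed (use assms adjacent_swap_less reflection_e root_reflection_linear in auto)

lemma chain_in_D_roots:
  assumes k: "Suc k < n"
  shows "b k \<in> D_roots e n"
proof -
  have "b k = 1 *\<^sub>R e k + (-1) *\<^sub>R e (Suc k)" using e_diff[OF k] by simp
  moreover have "k < n" "k \<noteq> Suc k" using k by auto
  ultimately show ?thesis unfolding D_roots_def using k by blast
qed

lemma b_in_roots: "k < n \<Longrightarrow> b k \<in> R"
  using base_in_roots[OF b_base] .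

text \<open>
  Adjacent swaps carry \<open>e\<^sub>n\<^sub>-\<^sub>2 + e\<^sub>n\<^sub>-\<^sub>1\<close> to every \<open>e\<^sub>i + e\<^sub>j\<close> with \<open>i < j\<close>: first \<open>i\<close> is lowered, then \<open>j\<close>.
\<close>

lemma D_roots_subset:
  assumes last: "e (n - 2) + e (n - 1) \<in> R"
  shows "D_roots e n \<subseteq> R"
proof -
  have diff: "e i - e j \<in> R" if "i < j" "j < n" for i j
    using differences_in_roots[OF roots, of n e i j] that
    by (simp add: e_diff b_in_roots reflection_e linear_diff[OF root_reflection_linear])
  have move: "root_reflection (b k) (e i + e j) \<in> R" if "e i + e j \<in> R" "Suc k < n" for i j k
    using root_reflection_in_roots[OF roots b_in_roots that(1), of k] that(2) by simp
  have top: "e i + e (n - 1) \<in> R" if "i \<le> n - 2" for i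
    using that
  proof (induction rule: inc_induct)
    case (step i)
    have i: "Suc i < n" "i < n" "n - 1 < n" using step by auto
    have "adjacent_swap i (Suc i) = i" "adjacent_swap i (n - 1) = n - 1"
      using step by (auto simp: adjacent_swap_def)
    then show ?case using move[OF step.IH i(1)]
      unfolding linear_add[OF root_reflection_linear] reflection_e[OF i(1,1)] reflection_e[OF i(1,3)]
      by simp
  qed (fact last)
  have plus: "e i + e j \<in> R" if "i < j" "j < n" for i j
  proof -
    have "j \<le> n - 1" using that by simp
    then show ?thesis using that(1)
    proof (induction rule: inc_induct)
      case base
      then show ?case using top[of i] n by simp
    next
      case (step k)
      then have "e i + e (Suc k) \<in> R" by simp
      from move[OF this, of k] step show ?case
        by (simp add: linear_add[OF root_reflection_linear] reflection_e adjacent_swap_def)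
    qed
  qed
  show ?thesis
  proof
    fix \<beta> assume "\<beta> \<in> D_roots e n"
    then obtain s t i j where \<beta>: "\<beta> = s *\<^sub>R e i + t *\<^sub>R e j" "i < n" "j < n" "i \<noteq> j" "s \<in> {1, -1}" "t \<in> {1, -1}"
      unfolding D_roots_def by blast
    have "e i + e j \<in> R" using plus[of i j] plus[of j i] \<beta> by (cases "i < j") (auto simp: add.commute)
    moreover have "e i - e j \<in> R"
      using diff[of i j] root_system_uminus[OF roots diff[of j i]] \<beta> by (cases "i < j") auto
    moreover note root_system_uminus[OF roots this] root_system_uminus[OF roots calculation(1)]
    ultimately show "\<beta> \<in> R" using \<beta>(1,5,6) by (auto simp: algebra_simps)
  qed
qed

lemma axis_roots_subset:
  assumes last: "m *\<^sub>R e (n - 1) \<in> R"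
  shows "axis_roots m e n \<subseteq> R"
proof -
  have "m *\<^sub>R e i \<in> R" if "i \<le> n - 1" for i
    using that
  proof (induction rule: inc_induct)
    case (step i)
    have "root_reflection (b i) (m *\<^sub>R e (Suc i)) \<in> R"
      using root_reflection_in_roots[OF roots b_in_roots step.IH] step by simp
    then show ?case using step
      by (simp add: linear_scale[OF root_reflection_linear] reflection_e adjacent_swap_def)
  qed (fact last)
  then have "s *\<^sub>R e i \<in> R" if "i < n" "s \<in> {m, -m}" for s i
    using that root_system_uminus[OF roots, of "m *\<^sub>R e i"] by auto
  then show ?thesis unfolding axis_roots_def by blast
qed

lemma coordinates_exist:
  assumes "\<And>v. v < n \<Longrightarrow> \<exists>g. linear g \<and> g x = (if v = n - 1 then 1 else (0::real)) \<and>
    (\<forall>k. Suc k < n \<longrightarrow> g (b k) = (if v = k then 1 else 0) - (if v = Suc k then 1 else 0))"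
  shows "\<exists>c. coordinates e c n"
proof -
  have "\<exists>g. linear g \<and> (v < n \<longrightarrow> g x = (if v = n - 1 then 1 else (0::real)) \<and>
    (\<forall>k. Suc k < n \<longrightarrow> g (b k) = (if v = k then 1 else 0) - (if v = Suc k then 1 else 0)))" for v
  proof (cases "v < n")
    case False
    then show ?thesis using linear_zero by blast
  qed (use assms in blast)
  then obtain c :: "nat \<Rightarrow> 'a \<Rightarrow> real" where
    "\<forall>v. linear (c v) \<and> (v < n \<longrightarrow> c v x = (if v = n - 1 then 1 else 0) \<and>
      (\<forall>k. Suc k < n \<longrightarrow> c v (b k) = (if v = k then 1 else 0) - (if v = Suc k then 1 else 0)))"
    by (atomize_elim, intro choice allI)
  then have c: "linear (c v)" "v < n \<Longrightarrow> c v x = (if v = n - 1 then 1 else 0)"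
    "v < n \<Longrightarrow> Suc k < n \<Longrightarrow> c v (b k) = (if v = k then 1 else 0) - (if v = Suc k then 1 else 0)" for v k
    by blast+
  have "coordinates e c n"
  proof (rule coordinates.intro)
    show "linear (c v)" for v by (fact c(1))
    show "c v (e i) = (if v = i then 1 else 0)" if "v < n" "i < n" for v i
    proof -
      have "c v (e j) - c v (e (Suc j)) = (if v = j then 1 else 0) - (if v = Suc j then 1 else 0)"
        if "Suc j < n" for j
        using that c(3)[OF \<open>v < n\<close>] by (simp flip: linear_diff[OF c(1)] add: e_diff)
      from equal_differences[where f = "\<lambda>k. c v (e k)" and g = "\<lambda>k. if v = k then 1 else 0", OF this that(2) last_less] show ?thesis
        using c(2)[OF that(1)] unfolding e_last by (simp split: if_splits)
    qed
  qed
  then show ?thesis by blast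
qed

end

text \<open>
  The last base root is \<open>m\<close> times the last coordinate vector. Its reflection negates that vector and
  fixes the other ones.
\<close>

lemma type_BC_coordinates:
  fixes R :: "'a::euclidean_space set"
  assumes "difference_chain R b n ((1 / m) *\<^sub>R b (n - 1))" and m: "m \<noteq> 0"
    and last: "\<And>i. Suc i < n \<Longrightarrow> cartan_number (b i) (b (n - 1)) = (if Suc (Suc i) = n then - 2 / m else 0)"
      "cartan_number (b (n - 1)) (b (n - 1)) = 2"
  shows "\<exists>e c. coordinates e c n \<and> R = D_roots e n \<union> axis_roots m e n"
proof -
  define x where "x = (1 / m) *\<^sub>R b (n - 1)"
  interpret difference_chain R b n x using assms(1) by (simp add: x_def)
  have bx: "b (n - 1) = m *\<^sub>R x" using m by (simp add: x_def)
  have cartan_x: "cartan_number x (b (n - 1)) = 2 / m"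
    using last(2) by (simp add: x_def linear_scale[OF cartan_number_linear])
  have cartan_last: "cartan_number (e i) (b (n - 1)) = (if i = n - 1 then 2 / m else 0)" if "i < n" for i
  proof -
    have "cartan_number (e i) (b (n - 1)) - cartan_number (e (Suc i)) (b (n - 1)) =
       (if i = n - 1 then 2 / m else 0) - (if Suc i = n - 1 then 2 / m else 0)" if "Suc i < n" for i
      using that last(1)[of i]
      by (auto simp flip: linear_diff[OF cartan_number_linear] simp add: e_diff)
    from equal_differences[where f = "\<lambda>i. cartan_number (e i) (b (n - 1))" and g = "\<lambda>i. if i = n - 1 then 2 / m else 0", OF this that last_less] show ?thesis
      unfolding e_last cartan_x by (simp split: if_splits)
  qed
  have refl: "root_reflection (b (n - 1)) (e i) = (if i = n - 1 then -1 else 1) *\<^sub>R e i" if "i < n" for i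
  proof (cases "i = n - 1")
    case True
    have "root_reflection (b (n - 1)) (e i) = e i - (2 / m) *\<^sub>R (m *\<^sub>R x)"
      unfolding root_reflection_def cartan_last[OF that] using True bx by simp
    also have "\<dots> = - e i" using True m e_last by (simp add: scaleR_2)
    finally show ?thesis using True by simp
  next
    case False
    then show ?thesis unfolding root_reflection_def cartan_last[OF that] by simp
  qed
  have sp_last: "signed_permutation (root_reflection (b (n - 1))) e n"
    unfolding signed_permutation_def
  proof (intro conjI exI[of _ id] exI[of _ "\<lambda>i. if i = n - 1 then -1 else 1"] allI impI)
    show "root_reflection (b (n - 1)) (e i) = (if i = n - 1 then -1 else 1) *\<^sub>R e (id i)" if "i < n" for i
      unfolding id_apply by (rule refl[OF that])
  qed (simp_all add: root_reflection_linear)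
  have sp: "signed_permutation (root_reflection (b k)) e n" if "k < n" for k
  proof (cases "Suc k < n")
    case False
    then have "k = n - 1" using that by simp
    then show ?thesis using sp_last by simp
  qed (rule signed_permutation_chain)
  have "R \<subseteq> D_roots e n \<union> axis_roots m e n"
  proof (rule roots_subset_closed[OF roots b_base])
    show "b ` {..<n} \<subseteq> D_roots e n \<union> axis_roots m e n"
    proof
      fix y assume "y \<in> b ` {..<n}"
      then obtain k where k: "k < n" "y = b k" by auto
      show "y \<in> D_roots e n \<union> axis_roots m e n"
      proof (cases "Suc k < n")
        case True
        then show ?thesis using chain_in_D_roots k by simp
      next
        case False
        then have "k = n - 1" using k by simp
        then have "y = m *\<^sub>R e (n - 1)" using k bx e_last by simp
        moreover have "n - 1 < n" using n by simp
        ultimately show ?thesis unfolding axis_roots_def by blast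
      qed
    qed
  qed (use sp signed_permutation_D_roots signed_permutation_axis_roots uminus_D_roots uminus_axis_roots in blast)+
  moreover have "axis_roots m e n \<subseteq> R"
    using b_in_roots[OF last_less] by (intro axis_roots_subset) (simp only: bx e_last)
  moreover have "e (n - 2) + e (n - 1) \<in> R"
  proof -
    have "e (n - 2) - e (n - 1) = b (n - 2)" using e_diff[of "n - 2"] n by (simp add: Suc_diff_Suc numeral_2_eq_2)
    then have "root_reflection (b (n - 1)) (e (n - 2) - e (n - 1)) \<in> R"
      using root_reflection_in_roots[OF roots] b_in_roots n by simp
    moreover have "root_reflection (b (n - 1)) (e (n - 2)) = e (n - 2)"
      "root_reflection (b (n - 1)) (e (n - 1)) = - e (n - 1)"
      using n refl[of "n - 2"] refl[of "n - 1"] by (simp_all split: if_splits)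
    ultimately show ?thesis by (simp add: linear_diff[OF root_reflection_linear])
  qed
  moreover note D_roots_subset[OF this]
  moreover have "\<exists>c. coordinates e c n"
  proof (rule coordinates_exist)
    fix v assume v: "v < n"
    obtain g :: "'a \<Rightarrow> real" where g: "linear g"
      "\<forall>k<n. g (b k) = (if k = n - 1 then (if v = n - 1 then m else 0)
         else (if v = k then 1 else 0) - (if v = Suc k then 1 else 0))"
      using base_functional[OF b_inj b_base, of "\<lambda>k. if k = n - 1 then (if v = n - 1 then m else 0)
         else (if v = k then 1 else 0) - (if v = Suc k then 1 else 0)"] by blast
    show "\<exists>g. linear g \<and> g x = (if v = n - 1 then 1 else (0::real)) \<and>
      (\<forall>k. Suc k < n \<longrightarrow> g (b k) = (if v = k then 1 else 0) - (if v = Suc k then 1 else 0))"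
      using g m n by (intro exI[of _ g]) (auto simp: x_def linear_scale[OF g(1)])
  qed
  ultimately show ?thesis by blast
qed

lemma type_B_coordinates:
  fixes R :: "'a::euclidean_space set"
  assumes R: "root_system R" and B: "has_dynkin_type R (Type_B n)"
  shows "\<exists>e c. coordinates e c n \<and> R = D_roots e n \<union> axis_roots 1 e n"
proof -
  obtain b where b: "inj_on b {..<n}" "root_base R (b ` {..<n})"
    "\<forall>i<n. \<forall>j<n. cartan_number (b i) (b j) = of_int (cartan_matrix (Type_B n) (Suc i) (Suc j))"
    using dynkin_base_from_0[OF B dynkin_rank.simps(2)] by blast
  have n: "n \<ge> 2" using B by (simp add: has_dynkin_type_def)
  show ?thesis
  proof (rule type_BC_coordinates)
    show "difference_chain R b n ((1 / 1) *\<^sub>R b (n - 1))"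
      by unfold_locales (use R b(1,2) n in \<open>auto simp: b(3) cartan_matrix_def\<close>)
  qed (use n in \<open>auto simp: b(3) cartan_matrix_def\<close>)
qed

lemma type_C_coordinates:
  fixes R :: "'a::euclidean_space set"
  assumes R: "root_system R" and C: "has_dynkin_type R (Type_C n)"
  shows "\<exists>e c. coordinates e c n \<and> R = D_roots e n \<union> axis_roots 2 e n"
proof -
  obtain b where b: "inj_on b {..<n}" "root_base R (b ` {..<n})"
    "\<forall>i<n. \<forall>j<n. cartan_number (b i) (b j) = of_int (cartan_matrix (Type_C n) (Suc i) (Suc j))"
    using dynkin_base_from_0[OF C dynkin_rank.simps(3)] by blast
  have n: "n \<ge> 2" using C by (simp add: has_dynkin_type_def)
  show ?thesis
  proof (rule type_BC_coordinates)
    show "difference_chain R b n ((1 / 2) *\<^sub>R b (n - 1))"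
      by unfold_locales (use R b(1,2) n in \<open>auto simp: b(3) cartan_matrix_def linear_scale[OF cartan_number_linear]\<close>)
  qed (use n in \<open>auto simp: b(3) cartan_matrix_def\<close>)
qed

text \<open>
  Here \<open>b\<^sub>n\<^sub>-\<^sub>1 = e\<^sub>n\<^sub>-\<^sub>2 + e\<^sub>n\<^sub>-\<^sub>1\<close>, and its reflection swaps \<open>e\<^sub>n\<^sub>-\<^sub>2\<close> and \<open>e\<^sub>n\<^sub>-\<^sub>1\<close> and negates both.
\<close>

lemma type_D_coordinates:
  fixes R :: "'a::euclidean_space set"
  assumes R: "root_system R" and D: "has_dynkin_type R (Type_D n)"
  shows "\<exists>e c. coordinates e c n \<and> R = D_roots e n"
proof -
  obtain b where b: "inj_on b {..<n}" "root_base R (b ` {..<n})"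
    "\<forall>i<n. \<forall>j<n. cartan_number (b i) (b j) = of_int (cartan_matrix (Type_D n) (Suc i) (Suc j))"
    using dynkin_base_from_0[OF D dynkin_rank.simps(4)] by blast
  have n3: "n \<ge> 3" using D by (simp add: has_dynkin_type_def)
  define x where "x = (1 / 2) *\<^sub>R (b (n - 1) - b (n - 2))"
  interpret difference_chain R b n x
    by unfold_locales (use R b(1,2) n3 in \<open>auto simp: b(3) cartan_matrix_def x_def
      linear_scale[OF cartan_number_linear] linear_diff[OF cartan_number_linear]\<close>)
  have e2: "e (n - 2) = x + b (n - 2)"
    using e_diff[of "n - 2"] n3 e_last by (simp add: Suc_diff_Suc numeral_2_eq_2 algebra_simps)
  have "e (n - 2) + e (n - 1) = 2 *\<^sub>R x + b (n - 2)"
    unfolding e_last e2 by (simp add: scaleR_2)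
  also have "\<dots> = b (n - 1)" by (simp add: x_def)
  finally have bx: "b (n - 1) = e (n - 2) + e (n - 1)" by simp
  have "cartan_number (b (n - 2)) (b (n - 1)) = 0"
  proof -
    have "Suc (n - 2) \<noteq> n" "Suc (n - 1) = n" "Suc (Suc (Suc (n - 2))) \<noteq> n" "n - 2 \<noteq> n - 1" using n3 by auto
    then show ?thesis using n3 by (simp add: b(3) cartan_matrix_def)
  qed
  then have cartan_x_last: "cartan_number x (b (n - 1)) = 1"
    using n3 by (simp add: x_def b(3) cartan_matrix_def
        linear_scale[OF cartan_number_linear] linear_diff[OF cartan_number_linear])
  have cartan_last: "cartan_number (e i) (b (n - 1)) =
      (if i = n - 1 then 1 else 0) + (if i = n - 2 then 1 else 0)" if "i < n" for i
  proof -
    have "cartan_number (e i) (b (n - 1)) - cartan_number (e (Suc i)) (b (n - 1)) =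
       ((if i = n - 1 then 1 else 0) + (if i = n - 2 then 1 else 0)) -
       ((if Suc i = n - 1 then 1 else 0) + (if Suc i = n - 2 then 1 else 0))" if "Suc i < n" for i
      using that n3
      by (auto simp flip: linear_diff[OF cartan_number_linear] simp add: e_diff b(3) cartan_matrix_def)
    from equal_differences[where f = "\<lambda>i. cartan_number (e i) (b (n - 1))" and
        g = "\<lambda>i. (if i = n - 1 then 1 else 0) + (if i = n - 2 then 1 else 0)", OF this that last_less] show ?thesis
      using n3 unfolding e_last cartan_x_last by (auto split: if_splits)
  qed
  have refl: "root_reflection (b (n - 1)) (e i) = (if n - 2 \<le> i then -1 else 1) *\<^sub>R e (adjacent_swap (n - 2) i)"
    if i: "i < n" for i
  proof -
    have n12: "n - 1 = Suc (n - 2)" "n - 2 \<noteq> n - 1" "n - 2 \<le> n - 1" using n3 by auto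
    have r: "root_reflection (b (n - 1)) (e i) = e i -
        ((if i = n - 1 then 1 else 0) + (if i = n - 2 then 1 else 0)) *\<^sub>R (e (n - 2) + e (n - 1))"
      unfolding root_reflection_def cartan_last[OF i] bx[symmetric] ..
    consider "i = n - 1" | "i = n - 2" | "i < n - 2" using i by linarith
    then show ?thesis
    proof cases
      case 1
      then show ?thesis unfolding r adjacent_swap_def n12(1)[symmetric] using n12(2,3) by simp
    next
      case 2
      then show ?thesis unfolding r adjacent_swap_def n12(1)[symmetric] using n12(2,3) by simp
    next
      case 3
      then show ?thesis unfolding r adjacent_swap_def n12(1)[symmetric] using n12(2,3) by simp
    qed
  qed
  have sp_last: "signed_permutation (root_reflection (b (n - 1))) e n"
    unfolding signed_permutation_def
  proof (intro conjI exI[of _ "adjacent_swap (n - 2)"] exI[of _ "\<lambda>i. if n - 2 \<le> i then -1 else 1"] allI impI)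
    show "inj_on (adjacent_swap (n - 2)) {..<n}" by (auto simp: inj_on_def adjacent_swap_eq_iff)
    show "root_reflection (b (n - 1)) (e i) = (if n - 2 \<le> i then -1 else 1) *\<^sub>R e (adjacent_swap (n - 2) i)"
      if "i < n" for i using that by (rule refl)
    show "adjacent_swap (n - 2) i < n" if "i < n" for i
      using adjacent_swap_less[OF that, of "n - 2"] n3 by simp
  qed (simp_all add: root_reflection_linear)
  have sp: "signed_permutation (root_reflection (b k)) e n" if "k < n" for k
  proof (cases "Suc k < n")
    case False
    then have "k = n - 1" using that by simp
    then show ?thesis using sp_last by simp
  qed (rule signed_permutation_chain)
  have "b k \<in> D_roots e n" if "k < n" for k
  proof (cases "Suc k < n")
    case False
    then have "k = n - 1" using that by simp
    then have "b k = 1 *\<^sub>R e (n - 2) + 1 *\<^sub>R e (n - 1)" using bx by simp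
    moreover have "n - 2 < n" "n - 1 < n" "n - 2 \<noteq> n - 1" using n3 by auto
    ultimately show ?thesis unfolding D_roots_def by blast
  qed (rule chain_in_D_roots)
  then have "R \<subseteq> D_roots e n"
    by (intro roots_subset_closed[OF roots b_base]) (use sp signed_permutation_D_roots uminus_D_roots in blast)+
  moreover have "D_roots e n \<subseteq> R"
    using b_in_roots[OF last_less] unfolding bx by (rule D_roots_subset)
  moreover have "\<exists>c. coordinates e c n"
  proof (rule coordinates_exist)
    fix v assume v: "v < n"
    define f :: "nat \<Rightarrow> real" where "f k = (if k = n - 1 then (if v = n - 1 then 1 else 0) + (if v = n - 2 then 1 else 0)
         else (if v = k then 1 else 0) - (if v = Suc k then 1 else 0))" for k
    obtain g :: "'a \<Rightarrow> real" where g: "linear g" "\<forall>k<n. g (b k) = f k"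
      using base_functional[OF b_inj b_base, of f] by blast
    show "\<exists>g. linear g \<and> g x = (if v = n - 1 then 1 else (0::real)) \<and>
      (\<forall>k. Suc k < n \<longrightarrow> g (b k) = (if v = k then 1 else 0) - (if v = Suc k then 1 else 0))"
      using g n3 by (intro exI[of _ g]) (auto simp: x_def f_def linear_scale[OF g(1)] linear_diff[OF g(1)])
  qed
  ultimately show ?thesis by blast
qed

section \<open>Type A\<close>

lemma sum_alternating: "(\<Sum>i<j. (-1) ^ i) = (if odd j then 1 else (0::real))"
  by (induction j) auto

text \<open>
  With the sign \<open>(-1)\<^bsup>i + j\<^esup>\<close> on \<open>e\<^sub>i - e\<^sub>j\<close>, everything cancels for odd \<open>N\<close>. For even \<open>N\<close> the remainder is
  the contribution of the pairs \<open>(0, 1), (2, 3), \<dots>\<close>, which will be omitted.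
\<close>

lemma sum_signed_differences:
  fixes e :: "nat \<Rightarrow> 'a::real_vector"
  shows "(\<Sum>j<N. \<Sum>i<j. (-1) ^ (i + j) *\<^sub>R (e i - e j)) =
    (if even N then - (\<Sum>i<N. (-1) ^ i *\<^sub>R e i) else 0)"
proof (induction N)
  case (Suc N)
  have "(\<Sum>i<N. (-1) ^ (i + N) *\<^sub>R (e i - e N)) =
      (-1) ^ N *\<^sub>R ((\<Sum>i<N. (-1) ^ i *\<^sub>R e i) - (\<Sum>i<N. (-1) ^ i) *\<^sub>R e N)"
    by (simp add: power_add scaleR_diff_right sum_subtractf scaleR_sum_right scaleR_sum_left mult.commute)
  then show ?case using Suc by (auto simp: sum_alternating)
qed simp

lemma sum_consecutive:
  fixes f :: "nat \<Rightarrow> 'a::ab_group_add"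
  assumes "even N"
  shows "(\<Sum>j<N. if odd j then f (j - 1) + f j else 0) = (\<Sum>i<N. f i)"
proof -
  have "(\<Sum>j<2 * m. if odd j then f (j - 1) + f j else 0) = (\<Sum>i<2 * m. f i)" for m
    by (induction m) auto
  moreover obtain m where "N = 2 * m" using assms by (elim evenE)
  ultimately show ?thesis by blast
qed

lemma sum_last_term:
  fixes f :: "nat \<Rightarrow> 'a::comm_monoid_add"
  shows "(\<Sum>i<j. if Suc i = j then f i else 0) = (if j = 0 then 0 else f (j - 1))"
  by (cases j) simp_all

lemma card_odd_less: "card {j. j < N \<and> odd j} = N div 2"
proof (induction N)
  case (Suc N)
  have "{j. j < Suc N \<and> odd j} = (if odd N then insert N {j. j < N \<and> odd j} else {j. j < N \<and> odd j})"
    by (auto simp: less_Suc_eq)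
  then show ?case using Suc by auto
qed simp

text \<open>
  The larger index comes first, so that sums over pairs are iterated sums with the larger index
  outside.
\<close>

definition pairs :: "nat \<Rightarrow> (nat \<times> nat) set" where
  "pairs N = (SIGMA j:{..<N}. {..<j})"

lemma finite_pairs: "finite (pairs N)"
  by (simp add: pairs_def)

lemma sum_pairs_eq: "(\<Sum>p\<in>pairs N. f p) = (\<Sum>j<N. \<Sum>i<j. f (j, i))"
  by (simp add: pairs_def sum.Sigma)

text \<open>
  Roots \<open>e\<^sub>i - e\<^sub>j\<close> and \<open>e\<^sub>k - e\<^sub>l\<close> that share an index have a root as sum or difference, so \<open>T\<close> is a
  matching on \<open>n + 1\<close> points. Coordinate \<open>i\<close> of the sum of all positive roots is \<open>n - 2i\<close>, which for even
  \<open>n\<close> differs in parity from the coordinate \<open>1\<close> that a root \<open>e\<^sub>i - e\<^sub>j\<close> in \<open>T\<close> would produce.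
\<close>

lemma type_A_max:
  fixes R P :: "'a::euclidean_space set"
  assumes R: "root_system R" and P: "half_of R P" and A: "has_dynkin_type R (Type_A n)"
  shows "is_max_cocardinality R P (if odd n then Suc n div 2 else 0)"
proof -
  define N where "N = Suc n"
  obtain e :: "nat \<Rightarrow> 'a" and c :: "nat \<Rightarrow> 'a \<Rightarrow> real" where c: "\<And>v. linear (c v)"
    and ce': "\<And>v i j. v < Suc n \<Longrightarrow> i < Suc n \<Longrightarrow> j < Suc n \<Longrightarrow>
       c v (e i - e j) = (if v = i then 1 else 0) - (if v = j then 1 else 0)"
    and RA': "R = A_roots e (Suc n)"
    by (rule type_A_coordinates[OF R A]) (rule that; assumption)
  note ce = ce'[folded N_def] and RA = RA'[folded N_def]
  define r where "r p = e (snd p) - e (fst p)" for p :: "nat \<times> nat"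
  define Q where "Q = r ` pairs N"
  have cr: "c v (r (j, i)) = (if v = i then 1 else 0) - (if v = j then 1 else 0)"
    if "v < N" "i < j" "j < N" for v i j using ce[of v i j] that by (simp add: r_def)
  have inj: "inj_on r (pairs N)"
  proof (rule inj_onI)
    fix p q assume pq: "p \<in> pairs N" "q \<in> pairs N" "r p = r q"
    obtain j i l k where eq: "p = (j, i)" "q = (l, k)" by (cases p, cases q)
    have lt: "i < j" "j < N" "k < l" "l < N" using pq eq by (auto simp: pairs_def)
    have "r (j, i) = r (l, k)" using pq eq by simp
    then have "c i (r (l, k)) = 1" "c j (r (l, k)) = -1"
      using cr[of i i j] cr[of j i j] lt by simp_all
    then have "i = k" "j = l"
      using cr[of i k l] cr[of j k l] lt by (simp_all split: if_splits)
    then show "p = q" by (simp add: eq)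
  qed
  have half: "half_of R Q"
  proof (rule half_of_functional)
    define g where "g x = (\<Sum>v<N. - real (Suc v) * c v x)" for x
    show "linear g" unfolding g_def
      by (intro linearI) (simp_all add: linear_add[OF c] linear_scale[OF c] sum.distrib[symmetric] sum_distrib_left algebra_simps)
    show "Q \<subseteq> R"
    proof
      fix x assume "x \<in> Q"
      then obtain i j where "x = e i - e j" "i < j" "j < N" by (auto simp: Q_def r_def pairs_def)
      then show "x \<in> R" unfolding RA A_roots_def by fastforce
    qed
    show "R \<subseteq> Q \<union> uminus ` Q"
    proof
      fix x assume "x \<in> R"
      then obtain i j where x: "x = e i - e j" "i < N" "j < N" "i \<noteq> j"
        unfolding RA A_roots_def by blast
      show "x \<in> Q \<union> uminus ` Q"
      proof (cases "i < j")
        case True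
        then have "(j, i) \<in> pairs N" using x by (simp add: pairs_def)
        then show ?thesis using x unfolding Q_def r_def by force
      next
        case False
        then have "(i, j) \<in> pairs N" using x by (simp add: pairs_def)
        then have "r (i, j) \<in> Q" unfolding Q_def by blast
        moreover have "x = - r (i, j)" using x by (simp add: r_def)
        ultimately show ?thesis by blast
      qed
    qed
    show "0 < g x" if "x \<in> Q" for x
    proof -
      obtain i j where x: "x = r (j, i)" "i < j" "j < N" using \<open>x \<in> Q\<close> by (auto simp: Q_def pairs_def)
      have "g x = (\<Sum>v<N. (if v = j then real (Suc v) else 0) - (if v = i then real (Suc v) else 0))"
        unfolding g_def using x by (intro sum.cong) (auto simp: cr)
      also have "\<dots> = real (Suc j) - real (Suc i)" using x by (simp add: sum_subtractf)
      finally show ?thesis using x by simp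
    qed
  qed
  have finQ: "finite Q" by (simp add: Q_def finite_pairs)
  show ?thesis
  proof (rule is_max_cocardinalityI[OF R P half])
    \<comment> \<open>The matching \<open>{0, 1}, {2, 3}, \<dots>\<close> if the number of points is even, and no pairs otherwise.\<close>
    define M where "M = {(j, i). j < N \<and> even N \<and> odd j \<and> Suc i = j}"
    have MK: "M \<subseteq> pairs N" by (auto simp: M_def pairs_def)
    have S: "Q - r ` (pairs N - M) = r ` M"
      unfolding Q_def using inj MK by (auto simp: inj_on_def)
    have "well_balanced R Q (r ` (pairs N - M))"
      unfolding well_balanced_def S
    proof (intro conjI)
      show "r ` (pairs N - M) \<subseteq> Q" by (auto simp: Q_def)
      show "balanced (r ` (pairs N - M))"
      proof (rule balanced_imageI)
        show "finite (pairs N - M)" by (simp add: finite_pairs)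
        show "inj_on r (pairs N - M)" using inj by (rule inj_on_subset) auto
        show "(case p of (j, i) \<Rightarrow> (-1) ^ (i + j)) \<in> {1, -1::real}" for p :: "nat \<times> nat"
          by (cases p) (simp add: minus_one_power_iff)
        have fin: "finite (pairs N)" by (rule finite_pairs)
        have "(\<Sum>p\<in>M. (case p of (j, i) \<Rightarrow> (-1) ^ (i + j)) *\<^sub>R r p) =
            (\<Sum>p\<in>pairs N. if p \<in> M then (case p of (j, i) \<Rightarrow> (-1) ^ (i + j)) *\<^sub>R r p else 0)"
          using MK fin by (simp add: sum.inter_restrict[symmetric] Int_absorb1)
        also have "\<dots> = (\<Sum>j<N. \<Sum>i<j. if Suc i = j then (if even N \<and> odd j then - (e i - e j) else 0) else 0)"
          unfolding sum_pairs_eq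
          by (intro sum.cong refl) (auto simp: M_def r_def)
        also have "\<dots> = (\<Sum>j<N. if even N \<and> odd j then - (e (j - 1) - e j) else 0)"
          unfolding sum_last_term by (intro sum.cong refl) auto
        also have "\<dots> = (if even N then - (\<Sum>i<N. (-1) ^ i *\<^sub>R e i) else 0)"
        proof (cases "even N")
          case True
          have "(\<Sum>i<N. (-1) ^ i *\<^sub>R e i) =
              (\<Sum>j<N. if odd j then (-1) ^ (j - 1) *\<^sub>R e (j - 1) + (-1) ^ j *\<^sub>R e j else 0)"
            using sum_consecutive[OF True, of "\<lambda>i. (-1) ^ i *\<^sub>R e i"] by simp
          also have "\<dots> = - (\<Sum>j<N. if odd j then - (e (j - 1) - e j) else 0)"
            unfolding sum_negf[symmetric] by (intro sum.cong refl) auto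
          finally show ?thesis using True by simp
        qed simp
        finally have "(\<Sum>p\<in>M. (case p of (j, i) \<Rightarrow> (-1) ^ (i + j)) *\<^sub>R r p) =
            (\<Sum>p\<in>pairs N. (case p of (j, i) \<Rightarrow> (-1) ^ (i + j)) *\<^sub>R r p)"
          unfolding sum_pairs_eq using sum_signed_differences[of e N] by (simp add: r_def)
        then show "(\<Sum>p\<in>pairs N - M. (case p of (j, i) \<Rightarrow> (-1) ^ (i + j)) *\<^sub>R r p) = 0"
          using sum.subset_diff[OF MK fin] by (metis (no_types, lifting) add_cancel_left_left)
      qed
      show "strongly_orthogonal R (r ` M)"
        unfolding strongly_orthogonal_def
      proof (intro ballI)
        fix \<alpha> \<beta> assume "\<alpha> \<in> r ` M" "\<beta> \<in> r ` M"
        moreover have "\<exists>j. x = r (j, j - 1) \<and> j < N \<and> odd j" if "x \<in> r ` M" for x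
          using that unfolding M_def by force
        ultimately obtain j l where \<alpha>: "\<alpha> = r (j, j - 1)" "j < N" "odd j" and \<beta>: "\<beta> = r (l, l - 1)" "l < N" "odd l"
          by meson
        have lt: "j - 1 < j" "l - 1 < l" "j - 1 < N" "l - 1 < N" using \<alpha> \<beta> by (auto elim: oddE)
        have R_coord: "\<exists>a b. \<forall>v<N. c v x = (if v = a then 1 else 0) - (if v = b then 1 else 0)" if xR: "x \<in> R" for x
        proof -
          obtain a b where "x = e a - e b" "a < N" "b < N" using xR unfolding RA A_roots_def by blast
          then show ?thesis using ce by blast
        qed
        have coord: "c v (\<alpha> + t *\<^sub>R \<beta>) = ((if v = j - 1 then 1 else 0) - (if v = j then 1 else 0)) +
            t * ((if v = l - 1 then 1 else 0) - (if v = l then 1 else 0))" if "v < N" for v t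
          using \<alpha> \<beta> lt that by (simp add: linear_add[OF c] linear_scale[OF c] cr)
        have "\<alpha> + t *\<^sub>R \<beta> \<notin> R" if t: "t \<in> {1, -1}" for t :: real
        proof
          assume "\<alpha> + t *\<^sub>R \<beta> \<in> R"
          then obtain a b where ab: "\<forall>v<N. c v (\<alpha> + t *\<^sub>R \<beta>) = (if v = a then 1 else 0) - (if v = b then 1 else 0)"
            using R_coord by blast
          show False
          proof (cases "j = l")
            case True
            show False
            proof (cases "t = 1")
              case True
              then show False using \<open>j = l\<close> ab coord[of j t] \<alpha> lt by (auto split: if_splits)
            next
              case False
              then have "\<alpha> + t *\<^sub>R \<beta> = 0" using t \<alpha> \<beta> \<open>j = l\<close> by auto
              then show False using \<open>\<alpha> + t *\<^sub>R \<beta> \<in> R\<close> R by (auto simp: root_system_def)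
            qed
          next
            case False
            have ne: "j - 1 \<noteq> l" "l - 1 \<noteq> j" "j - 1 \<noteq> l - 1"
              using False \<alpha>(3) \<beta>(3) by (auto elim!: oddE)
            have "c (j - 1) (\<alpha> + t *\<^sub>R \<beta>) \<noteq> 0" "c j (\<alpha> + t *\<^sub>R \<beta>) \<noteq> 0" "c l (\<alpha> + t *\<^sub>R \<beta>) \<noteq> 0"
              using coord[of "j - 1" t] coord[of j t] coord[of l t] \<alpha> \<beta> lt ne False t by auto
            then have "{j - 1, j, l} \<subseteq> {a, b}" using ab \<alpha> \<beta> lt by (auto split: if_splits)
            then show False using ne False lt by auto
          qed
        qed
        from this[of 1] this[of "-1"] show "\<alpha> + \<beta> \<notin> R \<and> \<alpha> - \<beta> \<notin> R" by simp
      qed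
    qed
    moreover have "card (r ` M) = (if odd n then Suc n div 2 else 0)"
    proof -
      have "card (r ` M) = card M" using inj MK by (meson card_image inj_on_subset)
      also have "card M = card ((\<lambda>j. (j, j - 1)) ` {j. j < N \<and> odd j \<and> even N})"
        by (rule arg_cong[where f = card]) (auto simp: M_def image_iff)
      also have "\<dots> = card {j. j < N \<and> odd j \<and> even N}" by (intro card_image) (auto simp: inj_on_def)
      finally show ?thesis using card_odd_less[of N] by (auto simp: N_def)
    qed
    ultimately show "\<exists>S. well_balanced R Q S \<and> card (Q - S) = (if odd n then Suc n div 2 else 0)"
      using S by metis
  next
    fix S assume wb: "well_balanced R Q S"
    define T where "T = Q - S"
    define supp where "supp x = {v. v < N \<and> c v x \<noteq> 0}" for x
    have so: "\<alpha> + \<beta> \<notin> R" "\<alpha> - \<beta> \<notin> R" if "\<alpha> \<in> T" "\<beta> \<in> T" for \<alpha> \<beta>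
      using wb that unfolding well_balanced_def strongly_orthogonal_def T_def by blast+
    have diffR: "e i - e j \<in> R" if "i < N" "j < N" "i \<noteq> j" for i j
      unfolding RA A_roots_def using that by blast
    have finT: "finite T" using finQ by (simp add: T_def)
    have disj: "supp \<alpha> \<inter> supp \<beta> = {}" if \<alpha>\<beta>: "\<alpha> \<in> T" "\<beta> \<in> T" "\<alpha> \<noteq> \<beta>" for \<alpha> \<beta>
    proof (rule ccontr)
      assume "supp \<alpha> \<inter> supp \<beta> \<noteq> {}"
      then obtain v where v: "v < N" "c v \<alpha> \<noteq> 0" "c v \<beta> \<noteq> 0" by (auto simp: supp_def)
      obtain i j where \<alpha>: "\<alpha> = e i - e j" "i < j" "j < N"
        using \<alpha>\<beta>(1) by (auto simp: T_def Q_def r_def pairs_def)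
      obtain k l where \<beta>: "\<beta> = e k - e l" "k < l" "l < N"
        using \<alpha>\<beta>(2) by (auto simp: T_def Q_def r_def pairs_def)
      have "v = i \<or> v = j" "v = k \<or> v = l" using v \<alpha> \<beta> by (auto simp: ce split: if_splits)
      then consider "i = k" | "j = l" | "i = l" | "j = k" by blast
      then show False
      proof cases
        case 1
        then have "j \<noteq> l" using \<alpha> \<beta> \<alpha>\<beta>(3) by auto
        then show False using so(2)[OF \<alpha>\<beta>(1,2)] diffR[of l j] \<alpha> \<beta> 1 by simp
      next
        case 2
        then have "i \<noteq> k" using \<alpha> \<beta> \<alpha>\<beta>(3) by auto
        then show False using so(2)[OF \<alpha>\<beta>(1,2)] diffR[of i k] \<alpha> \<beta> 2 by simp
      next
        case 3
        then show False using so(1)[OF \<alpha>\<beta>(1,2)] diffR[of k j] \<alpha> \<beta> by simp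
      next
        case 4
        then show False using so(1)[OF \<alpha>\<beta>(1,2)] diffR[of i l] \<alpha> \<beta> by simp
      qed
    qed
    have card_supp: "card (supp \<alpha>) = 2" if \<alpha>T: "\<alpha> \<in> T" for \<alpha>
    proof -
      obtain i j where \<alpha>: "\<alpha> = e i - e j" "i < j" "j < N"
        using \<alpha>T by (auto simp: T_def Q_def r_def pairs_def)
      then have "supp \<alpha> = {i, j}" by (auto simp: supp_def ce split: if_splits)
      then show ?thesis using \<alpha> by simp
    qed
    have "2 * card T = (\<Sum>\<alpha>\<in>T. card (supp \<alpha>))" by (simp add: card_supp)
    also have "\<dots> = card (\<Union>\<alpha>\<in>T. supp \<alpha>)"
      using finT disj by (intro card_UN_disjoint[symmetric]) (auto simp: supp_def)
    also have "\<dots> \<le> card {..<N}" by (intro card_mono) (auto simp: supp_def)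
    finally have le: "2 * card T \<le> N" by simp
    show "card (Q - S) \<le> (if odd n then Suc n div 2 else 0)"
    proof (cases "odd n")
      case True
      then show ?thesis using le unfolding T_def N_def by simp
    next
      case False
      have "T = {}"
      proof (rule ccontr)
        assume "T \<noteq> {}"
        then obtain \<alpha> where \<alpha>T: "\<alpha> \<in> T" by blast
        obtain i j where \<alpha>: "\<alpha> = e i - e j" "i < j" "j < N"
          using \<alpha>T by (auto simp: T_def Q_def r_def pairs_def)
        have i: "i < N" using \<alpha> by simp
        have "c i \<beta> = (if \<beta> = \<alpha> then 1 else 0)" if "\<beta> \<in> T" for \<beta>
        proof (cases "\<beta> = \<alpha>")
          case True
          then show ?thesis using \<alpha> by (simp add: ce)
        next
          case False
          have "i \<in> supp \<alpha>" using \<alpha> by (simp add: supp_def ce)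
          then have "i \<notin> supp \<beta>" using disj[OF \<alpha>T that] False by blast
          then show ?thesis using False i by (simp add: supp_def)
        qed
        then have cT: "c i (\<Sum>T) = 1"
          using finT \<alpha>T by (simp add: linear_sum[OF c])
        have "c i (\<Sum>Q) = (\<Sum>j<N. \<Sum>k<j. (if i = k then 1 else 0) - (if i = j then 1 else 0))"
          unfolding Q_def using inj i
          by (auto simp: linear_sum[OF c] sum.reindex sum_pairs_eq cr intro!: sum.cong)
        also have "\<dots> = (\<Sum>j<N. (if i < j then 1 else 0) - (if i = j then real j else 0))"
          by (intro sum.cong refl) (auto simp: sum_subtractf)
        also have "\<dots> = real (N - 1 - i) - real i"
        proof -
          have "{..<N} \<inter> {j. i < j} = {i<..<N}" by auto
          then show ?thesis using i by (simp add: sum_subtractf sum.If_cases)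
        qed
        also have "\<dots> = of_int (int n - 2 * int i)" using i by (simp add: N_def of_nat_diff)
        finally have cQ: "c i (\<Sum>Q) = of_int (int n - 2 * int i)" .
        have "c i \<beta> \<in> \<int>" if "\<beta> \<in> Q" for \<beta>
          using that i by (auto simp: Q_def pairs_def cr)
        then obtain m :: int where "c i (\<Sum>Q) = c i (\<Sum>T) + 2 * of_int m"
          using balanced_parity[OF finQ _ _ c] wb unfolding well_balanced_def T_def by blast
        then have "int n - 2 * int i = 1 + 2 * m" unfolding cQ cT by linarith
        then show False using False by presburger
      qed
      then have "card (Q - S) = 0" unfolding T_def by (simp only: card.empty)
      then show ?thesis by simp
    qed
  qed
qed

section \<open>Coordinates in types B, C and D\<close>

lemma sum_Diff_if:
  fixes f :: "'b \<Rightarrow> 'a::ab_group_add"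
  assumes "finite K"
  shows "(\<Sum>p\<in>K - M. f p) = (\<Sum>p\<in>K. if p \<in> M then 0 else f p)"
  using assms by (simp add: sum.If_cases Diff_eq)

text \<open>
  The index \<open>((j, i), t)\<close> stands for \<open>e\<^sub>j + t e\<^sub>i\<close>.
\<close>

definition signed_pairs :: "nat \<Rightarrow> ((nat \<times> nat) \<times> real) set" where
  "signed_pairs n = pairs n \<times> {1, -1}"

lemma finite_signed_pairs: "finite (signed_pairs n)"
  by (simp add: signed_pairs_def finite_pairs)

lemma sum_signed_pairs:
  "(\<Sum>p\<in>signed_pairs n. f p) = (\<Sum>j<n. \<Sum>i<j. f ((j, i), 1) + f ((j, i), -1))"
proof -
  have "(\<Sum>p\<in>signed_pairs n. f p) = (\<Sum>q\<in>pairs n. \<Sum>t\<in>{1, -1}. f (q, t))"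
    unfolding signed_pairs_def by (rule sum.cartesian_product')
  also have "\<dots> = (\<Sum>q\<in>pairs n. f (q, 1) + f (q, -1))" by simp
  finally show ?thesis by (simp add: sum_pairs_eq)
qed

lemma mem_signed_pairs: "((j, i), t) \<in> signed_pairs n \<longleftrightarrow> i < j \<and> j < n \<and> t \<in> {1, -1}"
  by (auto simp: signed_pairs_def pairs_def)

context coordinates
begin

lemmas c_simps = linear_add[OF linear_c] linear_diff[OF linear_c] linear_scale[OF linear_c] c_e

definition pair_root :: "(nat \<times> nat) \<times> real \<Rightarrow> 'a" where
  "pair_root p = e (fst (fst p)) + snd p *\<^sub>R e (snd (fst p))"

lemma pair_root_eq: "pair_root ((j, i), t) = e j + t *\<^sub>R e i"
  by (simp add: pair_root_def)

definition D_pos :: "'a set" where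
  "D_pos = pair_root ` signed_pairs n"

lemma finite_D_pos: "finite D_pos"
  by (simp add: D_pos_def finite_signed_pairs)

lemma D_posE:
  assumes "x \<in> D_pos"
  obtains j i t where "x = e j + t *\<^sub>R e i" "i < j" "j < n" "t \<in> {1, -1}"
proof -
  obtain p where p: "p \<in> signed_pairs n" "x = pair_root p" using assms unfolding D_pos_def by blast
  obtain j i t where "p = ((j, i), t)" by (metis surj_pair)
  then show thesis using p that[of j t i] by (auto simp: mem_signed_pairs pair_root_eq)
qed

lemma D_posI: "i < j \<Longrightarrow> j < n \<Longrightarrow> t \<in> {1, -1} \<Longrightarrow> e j + t *\<^sub>R e i \<in> D_pos"
  unfolding D_pos_def pair_root_eq[symmetric] by (rule imageI) (simp add: mem_signed_pairs)

lemma c_combination: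
  "v < n \<Longrightarrow> i < n \<Longrightarrow> j < n \<Longrightarrow>
    c v (s *\<^sub>R e i + t *\<^sub>R e j) = s * (if v = i then 1 else 0) + t * (if v = j then 1 else 0)"
  by (simp add: c_simps)

lemma c_pair_root:
  "v < n \<Longrightarrow> i < n \<Longrightarrow> j < n \<Longrightarrow>
    c v (e j + t *\<^sub>R e i) = (if v = j then 1 else 0) + t * (if v = i then 1 else 0)"
  using c_combination[of v j i 1 t] by simp

lemma inj_pair_root: "inj_on pair_root (signed_pairs n)"
proof (rule inj_onI)
  fix p q assume pq: "p \<in> signed_pairs n" "q \<in> signed_pairs n" "pair_root p = pair_root q"
  obtain j i t l k u where eq: "p = ((j, i), t)" "q = ((l, k), u)" by (metis surj_pair)
  have lt: "i < j" "j < n" "k < l" "l < n" "t \<in> {1, -1}" "u \<in> {1, -1}"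
    using pq eq by (auto simp: mem_signed_pairs)
  have same: "e j + t *\<^sub>R e i = e l + u *\<^sub>R e k" using pq(3) eq by (simp add: pair_root_eq)
  have "c v (e l + u *\<^sub>R e k) = (if v = j then 1 else 0) + t * (if v = i then 1 else 0)" if "v < n" for v
    unfolding same[symmetric] using that lt by (simp add: c_pair_root)
  then have coord: "(if v = l then 1 else 0) + u * (if v = k then 1 else 0) =
      (if v = j then 1 else 0) + t * (if v = i then 1 else 0)" if "v < n" for v
    using that lt by (simp add: c_pair_root)
  have "j = l"
  proof (rule ccontr)
    assume "j \<noteq> l"
    then consider "j < l" | "l < j" by linarith
    then show False
    proof cases
      case 1
      then show False using coord[of l] lt by (auto split: if_splits)
    next
      case 2
      then show False using coord[of j] lt by (auto split: if_splits)
    qed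
  qed
  then have "i = k" using coord[of i] lt by (auto split: if_splits)
  then show "p = q" using \<open>j = l\<close> coord[of i] lt eq by (auto split: if_splits)
qed

lemma D_pos_subset: "D_pos \<subseteq> D_roots e n"
proof
  fix x assume "x \<in> D_pos"
  then obtain j i t where x: "x = e j + t *\<^sub>R e i" "i < j" "j < n" "t \<in> {1, -1}" by (rule D_posE)
  then have "x = 1 *\<^sub>R e j + t *\<^sub>R e i" "i < n" "j \<noteq> i" by auto
  then show "x \<in> D_roots e n" unfolding D_roots_def using x by blast
qed

lemma D_roots_covered: "D_roots e n \<subseteq> D_pos \<union> uminus ` D_pos"
proof
  fix x assume "x \<in> D_roots e n"
  then obtain s t i j where x: "x = s *\<^sub>R e i + t *\<^sub>R e j" "i < n" "j < n" "i \<noteq> j" "s \<in> {1, -1}" "t \<in> {1, -1}"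
    unfolding D_roots_def by blast
  have main: "s *\<^sub>R e i + t *\<^sub>R e j \<in> D_pos \<union> uminus ` D_pos"
    if st: "i < j" "j < n" "s \<in> {1, -1}" "t \<in> {1, -1}" for s t :: real and i j
  proof -
    have "s * t \<in> {1, -1}" using st by auto
    then have mem: "e j + (s * t) *\<^sub>R e i \<in> D_pos" using st D_posI by blast
    have "s *\<^sub>R e i + t *\<^sub>R e j = e j + (s * t) *\<^sub>R e i \<or>
        s *\<^sub>R e i + t *\<^sub>R e j = - (e j + (s * t) *\<^sub>R e i)"
      using st(4) by (auto simp: algebra_simps)
    then show ?thesis using mem by (metis UnI1 UnI2 imageI)
  qed
  show "x \<in> D_pos \<union> uminus ` D_pos"
  proof (cases "i < j")
    case True
    then show ?thesis using main x by blast
  next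
    case False
    then have "j < i" using x by simp
    then show ?thesis using main[of j i t s] x by (simp add: add.commute)
  qed
qed

text \<open>
  The weights increase with the index, so the value at \<open>e\<^sub>j \<plusminus> e\<^sub>i\<close> with \<open>i < j\<close> is positive.
\<close>

definition height :: "'a \<Rightarrow> real" where
  "height x = (\<Sum>v<n. real (Suc v) * c v x)"

lemma linear_height: "linear height"
  unfolding height_def
  by (intro linearI)
    (simp_all add: linear_add[OF linear_c] linear_scale[OF linear_c] sum.distrib[symmetric]
      sum_distrib_left algebra_simps)

lemma height_e: "i < n \<Longrightarrow> height (e i) = real (Suc i)"
  by (simp add: height_def c_e if_distrib sum.delta cong: if_cong)

lemma height_D_pos:
  assumes "x \<in> D_pos" shows "height x > 0"
  using assms
proof (rule D_posE)
  fix j i t assume x: "x = e j + t *\<^sub>R e i" "i < j" "j < n" "t \<in> {1, -1}"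
  then have "height x = real (Suc j) + t * real (Suc i)"
    by (simp add: linear_add[OF linear_height] linear_scale[OF linear_height] height_e)
  then show ?thesis using x by auto
qed

lemma half_of_D: "half_of (D_roots e n) D_pos"
  using linear_height D_pos_subset D_roots_covered height_D_pos by (rule half_of_functional)

definition axis_pos :: "real \<Rightarrow> 'a set" where
  "axis_pos m = (\<lambda>i. m *\<^sub>R e i) ` {..<n}"

lemma half_of_BC:
  assumes m: "m > 0"
  shows "half_of (D_roots e n \<union> axis_roots m e n) (D_pos \<union> axis_pos m)"
proof (rule half_of_functional[OF linear_height])
  show "D_pos \<union> axis_pos m \<subseteq> D_roots e n \<union> axis_roots m e n"
    using D_pos_subset by (auto simp: axis_pos_def axis_roots_def)
  show "D_roots e n \<union> axis_roots m e n \<subseteq> D_pos \<union> axis_pos m \<union> uminus ` (D_pos \<union> axis_pos m)"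
    using D_roots_covered by (auto simp: axis_pos_def axis_roots_def)
  show "height x > 0" if "x \<in> D_pos \<union> axis_pos m" for x
    using that height_D_pos m by (auto simp: axis_pos_def height_e linear_scale[OF linear_height])
qed

lemma D_axis_disjoint: "D_pos \<inter> axis_pos m = {}"
proof -
  have "x \<notin> axis_pos m" if "x \<in> D_pos" for x
    using that
  proof (rule D_posE)
    fix j i t assume x: "x = e j + t *\<^sub>R e i" "i < j" "j < n" "t \<in> {1, -1}"
    show "x \<notin> axis_pos m"
    proof
      assume "x \<in> axis_pos m"
      then obtain k where k: "k < n" "x = m *\<^sub>R e k" by (auto simp: axis_pos_def)
      have "c i x \<noteq> 0" "c j x \<noteq> 0" using x by (auto simp: c_pair_root)
      then show False using k x by (auto simp: c_simps split: if_splits)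
    qed
  qed
  then show ?thesis by blast
qed

lemma inj_axis: "m \<noteq> 0 \<Longrightarrow> inj_on (\<lambda>i. m *\<^sub>R e i) {..<n}"
proof (rule inj_onI)
  fix i j assume m: "m \<noteq> 0" and ij: "i \<in> {..<n}" "j \<in> {..<n}" "m *\<^sub>R e i = m *\<^sub>R e j"
  then have "e i = e j" by simp
  then have "c i (e i) = c i (e j)" by simp
  then show "i = j" using ij by (simp add: c_e split: if_splits)
qed

definition supp :: "'a \<Rightarrow> nat set" where
  "supp x = {v. v < n \<and> c v x \<noteq> 0}"

lemma finite_supp: "finite (supp x)"
  by (simp add: supp_def)

lemma supp_combination:
  "i < n \<Longrightarrow> j < n \<Longrightarrow> i \<noteq> j \<Longrightarrow> s \<noteq> 0 \<Longrightarrow> t \<noteq> 0 \<Longrightarrow> supp (s *\<^sub>R e i + t *\<^sub>R e j) = {i, j}"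
  by (auto simp: supp_def c_combination split: if_splits)

lemma supp_pair_root: "i < j \<Longrightarrow> j < n \<Longrightarrow> t \<in> {1, -1} \<Longrightarrow> supp (e j + t *\<^sub>R e i) = {i, j}"
  using supp_combination[of j i 1 t] by auto

lemma supp_axis: "i < n \<Longrightarrow> s \<noteq> 0 \<Longrightarrow> supp (s *\<^sub>R e i) = {i}"
  by (auto simp: supp_def c_simps split: if_splits)

lemma D_root_at:
  assumes "x \<in> D_roots e n" "v \<in> supp x"
  obtains s t j where "x = s *\<^sub>R e v + t *\<^sub>R e j" "v < n" "j < n" "j \<noteq> v" "s \<in> {1, -1}" "t \<in> {1, -1}"
proof -
  obtain s t i j where x: "x = s *\<^sub>R e i + t *\<^sub>R e j" "i < n" "j < n" "i \<noteq> j" "s \<in> {1, -1}" "t \<in> {1, -1}"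
    using assms(1) unfolding D_roots_def by blast
  have "v = i \<or> v = j" using assms(2) x supp_combination[of i j s t] by auto
  then show thesis
  proof
    assume "v = i"
    then show thesis using x that[of s t j] by blast
  next
    assume "v = j"
    then show thesis using x that[of t s i] by (simp add: add.commute)
  qed
qed

lemma D_rootI: "i < n \<Longrightarrow> j < n \<Longrightarrow> i \<noteq> j \<Longrightarrow> s \<in> {1, -1} \<Longrightarrow> t \<in> {1, -1} \<Longrightarrow> s *\<^sub>R e i + t *\<^sub>R e j \<in> D_roots e n"
  unfolding D_roots_def by blast

text \<open>
  If \<open>\<alpha> = s e\<^sub>v + t e\<^sub>j\<close> and \<open>\<beta> = u e\<^sub>v + w e\<^sub>k\<close> with \<open>j \<noteq> k\<close>, then one of \<open>\<alpha> \<plusminus> \<beta>\<close> has no \<open>e\<^sub>v\<close> left and is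
  a root \<open>\<plusminus>e\<^sub>j \<plusminus> e\<^sub>k\<close>.
\<close>

lemma D_roots_clash:
  assumes "\<alpha> \<in> D_roots e n" "\<beta> \<in> D_roots e n" "\<alpha> + \<beta> \<notin> D_roots e n" "\<alpha> - \<beta> \<notin> D_roots e n"
    "supp \<alpha> \<inter> supp \<beta> \<noteq> {}"
  shows "supp \<alpha> = supp \<beta>"
proof -
  obtain v where v: "v \<in> supp \<alpha>" "v \<in> supp \<beta>" using assms(5) by blast
  obtain s t j where \<alpha>: "\<alpha> = s *\<^sub>R e v + t *\<^sub>R e j" "v < n" "j < n" "j \<noteq> v" "s \<in> {1, -1}" "t \<in> {1, -1}"
    using assms(1) v(1) by (rule D_root_at)
  obtain u w k where \<beta>: "\<beta> = u *\<^sub>R e v + w *\<^sub>R e k" "v < n" "k < n" "k \<noteq> v" "u \<in> {1, -1}" "w \<in> {1, -1}"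
    using assms(2) v(2) by (rule D_root_at)
  have "j = k"
  proof (rule ccontr)
    assume jk: "j \<noteq> k"
    show False
    proof (cases "s = u")
      case True
      then have "\<alpha> - \<beta> = t *\<^sub>R e j + (- w) *\<^sub>R e k" using \<alpha> \<beta> by simp
      moreover have "\<dots> \<in> D_roots e n" using \<alpha> \<beta> jk by (intro D_rootI) auto
      ultimately show False using assms(4) by simp
    next
      case False
      then have "s = - u" using \<alpha> \<beta> by auto
      then have "\<alpha> + \<beta> = t *\<^sub>R e j + w *\<^sub>R e k" using \<alpha> \<beta> by simp
      moreover have "\<dots> \<in> D_roots e n" using \<alpha> \<beta> jk by (intro D_rootI) auto
      ultimately show False using assms(3) by simp
    qed
  qed
  then show ?thesis using \<alpha> \<beta> supp_combination[of v j s t] supp_combination[of v j u w] by auto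
qed

section \<open>Type D\<close>

lemma card_supp_D_pos: "x \<in> D_pos \<Longrightarrow> card (supp x) = 2"
  by (erule D_posE) (simp add: supp_pair_root)

lemma D_pos_by_supp:
  assumes "x \<in> D_pos"
  shows "\<exists>t\<in>{1, -1}. x = e (Max (supp x)) + t *\<^sub>R e (Min (supp x))"
  using assms by (elim D_posE) (auto simp: supp_pair_root max_def min_def)

text \<open>
  The supports of the roots in \<open>T\<close> are index pairs that are equal or disjoint, so there are at most
  \<open>n div 2\<close> of them. Each support \<open>{i, j}\<close> with \<open>i < j\<close> belongs to just two positive roots, \<open>e\<^sub>j \<plusminus> e\<^sub>i\<close>.
\<close>

lemma card_D_le:
  assumes T: "T \<subseteq> D_pos" "strongly_orthogonal (D_roots e n) T"
  shows "card T \<le> 2 * (n div 2)"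
proof -
  define F where "F = supp ` T"
  have finT: "finite T" using finite_subset[OF T(1) finite_D_pos] .
  have "2 * card F = (\<Sum>A\<in>F. card A)"
  proof -
    have "(\<Sum>A\<in>F. card A) = (\<Sum>A\<in>F. 2)"
      using T(1) card_supp_D_pos unfolding F_def by (intro sum.cong) auto
    then show ?thesis by simp
  qed
  also have "\<dots> = card (\<Union>F)"
  proof (rule card_Union_disjoint[symmetric])
    have "supp \<alpha> \<inter> supp \<beta> = {}" if "\<alpha> \<in> T" "\<beta> \<in> T" "supp \<alpha> \<noteq> supp \<beta>" for \<alpha> \<beta>
      using D_roots_clash[of \<alpha> \<beta>] that T D_pos_subset unfolding strongly_orthogonal_def by blast
    then show "pairwise disjnt F" unfolding F_def pairwise_def disjnt_def by blast
  qed (auto simp: F_def finite_supp)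
  also have "\<dots> \<le> card {..<n}" by (intro card_mono) (auto simp: F_def supp_def)
  finally have le: "2 * card F \<le> n" by simp
  have "T \<subseteq> (\<lambda>(A, t). e (Max A) + t *\<^sub>R e (Min A)) ` (F \<times> {1, -1})"
  proof
    fix x assume x: "x \<in> T"
    then obtain t where "t \<in> {1, -1}" "x = e (Max (supp x)) + t *\<^sub>R e (Min (supp x))"
      using T(1) D_pos_by_supp[of x] by blast
    then show "x \<in> (\<lambda>(A, t). e (Max A) + t *\<^sub>R e (Min A)) ` (F \<times> {1, -1})"
      using x by (intro image_eqI[of _ _ "(supp x, t)"]) (auto simp: F_def)
  qed
  then have "card T \<le> card (F \<times> {1, -1::real})"
    by (rule surj_card_le[rotated]) (simp add: F_def finT)
  also have "\<dots> = 2 * card F" by (simp add: card_cartesian_product)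
  finally show ?thesis using le by presburger
qed

lemma R_two_coordinates:
  assumes "x \<in> D_roots e n \<union> axis_roots m e n"
  shows "\<exists>a b. supp x \<subseteq> {a, b}"
  using assms
proof
  assume "x \<in> D_roots e n"
  then obtain s t i j where "x = s *\<^sub>R e i + t *\<^sub>R e j" "i < n" "j < n" unfolding D_roots_def by blast
  then have "supp x \<subseteq> {i, j}" by (auto simp: supp_def c_combination split: if_splits)
  then show ?thesis by blast
next
  assume "x \<in> axis_roots m e n"
  then obtain s i where "x = s *\<^sub>R e i" "i < n" unfolding axis_roots_def by blast
  then have "supp x \<subseteq> {i, i}" by (auto simp: supp_def c_simps split: if_splits)
  then show ?thesis by blast
qed

text \<open>
  Together with \<open>not_root_large\<close> this is how sums and differences of omitted roots are seen not to be
  roots.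
\<close>

lemma not_root_three:
  assumes "c i x \<noteq> 0" "c j x \<noteq> 0" "c k x \<noteq> 0" "i < n" "j < n" "k < n" "i \<noteq> j" "i \<noteq> k" "j \<noteq> k"
  shows "x \<notin> D_roots e n \<union> axis_roots m e n"
proof
  assume "x \<in> D_roots e n \<union> axis_roots m e n"
  then obtain a b where "supp x \<subseteq> {a, b}" using R_two_coordinates by blast
  moreover have "{i, j, k} \<subseteq> supp x" using assms by (auto simp: supp_def)
  ultimately have "{i, j, k} \<subseteq> {a, b}" by blast
  then show False using assms(7-9) by auto
qed

lemma large_coordinate:
  assumes x: "x \<in> D_roots e n \<union> axis_roots m e n" and v: "c v x \<notin> {0, 1, -1}" "v < n"
  shows "c v x \<in> {m, -m} \<and> supp x = {v}"
  using x
proof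
  assume "x \<in> D_roots e n"
  then obtain s t i j where x: "x = s *\<^sub>R e i + t *\<^sub>R e j" "i < n" "j < n" "i \<noteq> j" "s \<in> {1, -1}" "t \<in> {1, -1}"
    unfolding D_roots_def by blast
  then have "c v x = s * (if v = i then 1 else 0) + t * (if v = j then 1 else 0)"
    using c_combination v(2) by blast
  then show ?thesis using v(1) x(4-6) by (auto split: if_splits)
next
  assume "x \<in> axis_roots m e n"
  then obtain s i where x: "x = s *\<^sub>R e i" "i < n" "s \<in> {m, -m}" unfolding axis_roots_def by blast
  then have cx: "c v x = (if v = i then s else 0)" using v(2) by (simp add: c_simps)
  then have "v = i" "s \<noteq> 0" using v(1) by (auto split: if_splits)
  then show ?thesis using cx x supp_axis by simp
qed

lemma not_root_large:
  assumes "c v x \<notin> {0, 1, -1}" "v < n"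
  shows "x \<notin> D_roots e n \<union> axis_roots 1 e n"
  using large_coordinate[OF _ assms, of 1] assms(1) by auto

lemma block_not_root:
  assumes j: "odd j" "j < n" and l: "odd l" "l < n" "j \<noteq> l" and st: "s \<in> {1, -1}" "t \<in> {1, -1}" "u \<in> {1, -1::real}"
  shows "(e j + s *\<^sub>R e (j - 1)) + u *\<^sub>R (e l + t *\<^sub>R e (l - 1)) \<notin> D_roots e n \<union> axis_roots m e n"
proof -
  define x where "x = (e j + s *\<^sub>R e (j - 1)) + u *\<^sub>R (e l + t *\<^sub>R e (l - 1))"
  have lt: "j - 1 < j" "l - 1 < l" "j - 1 < n" "l - 1 < n" using j l by (auto elim: oddE)
  have ne: "j - 1 \<noteq> l" "l - 1 \<noteq> j" "j - 1 \<noteq> l - 1" using j l by (auto elim!: oddE)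
  have coord: "c v x = ((if v = j then 1 else 0) + s * (if v = j - 1 then 1 else 0)) +
     u * ((if v = l then 1 else 0) + t * (if v = l - 1 then 1 else 0))" if "v < n" for v
    unfolding x_def using that j l lt
    by (simp add: c_simps)
  have "x \<notin> D_roots e n \<union> axis_roots m e n"
    by (rule not_root_three[of "j - 1" _ j l]) (use coord[of "j - 1"] coord[of j] coord[of l] j l lt ne st in auto)
  then show ?thesis by (simp add: x_def)
qed

lemma same_block_not_root:
  assumes j: "odd j" "j < n" and st: "s \<in> {1, -1}" "t \<in> {1, -1}"
    and z: "0 \<notin> D_roots e n \<union> axis_roots 1 e n"
  shows "(e j + s *\<^sub>R e (j - 1)) + (e j + t *\<^sub>R e (j - 1)) \<notin> D_roots e n \<union> axis_roots 1 e n"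
    "(e j + s *\<^sub>R e (j - 1)) - (e j + t *\<^sub>R e (j - 1)) \<notin> D_roots e n \<union> axis_roots 1 e n"
proof -
  have lt: "j - 1 < j" "j - 1 < n" using j by (auto elim: oddE)
  show "(e j + s *\<^sub>R e (j - 1)) + (e j + t *\<^sub>R e (j - 1)) \<notin> D_roots e n \<union> axis_roots 1 e n"
    by (rule not_root_large[of j]) (use lt j in \<open>auto simp: c_simps\<close>)
  show "(e j + s *\<^sub>R e (j - 1)) - (e j + t *\<^sub>R e (j - 1)) \<notin> D_roots e n \<union> axis_roots 1 e n"
  proof (cases "s = t")
    case True
    then show ?thesis using z by simp
  next
    case False
    show ?thesis
      by (rule not_root_large[of "j - 1"])
       (use lt j st False in \<open>auto simp: c_simps\<close>)
  qed
qed

lemma zero_not_root: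
  assumes m: "m \<noteq> 0"
  shows "0 \<notin> D_roots e n \<union> axis_roots m e n"
proof
  have empty: "supp 0 = {}" by (simp add: supp_def linear_0[OF linear_c])
  assume "0 \<in> D_roots e n \<union> axis_roots m e n"
  then show False
  proof
    assume "0 \<in> D_roots e n"
    then obtain s t i j where x: "0 = s *\<^sub>R e i + t *\<^sub>R e j" "i < n" "j < n" "i \<noteq> j" "s \<in> {1, -1}" "t \<in> {1, -1}"
      unfolding D_roots_def by blast
    then show False using supp_combination[of i j s t] empty by auto
  next
    assume "0 \<in> axis_roots m e n"
    then obtain s i where x: "0 = s *\<^sub>R e i" "i < n" "s \<in> {m, -m}" unfolding axis_roots_def by blast
    then show False using supp_axis[of i s] empty m by auto
  qed
qed

lemma alternating_without_last:
  "(\<Sum>i<j. if odd j \<and> Suc i = j then 0 else (-1) ^ i) = (0::real)"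
  by (cases j) (auto simp: sum_alternating)

text \<open>
  The roots \<open>e\<^sub>j + t e\<^sub>j\<^sub>-\<^sub>1\<close> within the blocks \<open>{0, 1}, {2, 3}, \<dots>\<close> of indices. If \<open>n\<close> is odd, the last index
  belongs to no block.
\<close>

definition blocks :: "real set \<Rightarrow> ((nat \<times> nat) \<times> real) set" where
  "blocks U = {((j, i), t). j < n \<and> odd j \<and> Suc i = j \<and> t \<in> U}"

lemma mem_blocks: "((j, i), t) \<in> blocks U \<longleftrightarrow> j < n \<and> odd j \<and> Suc i = j \<and> t \<in> U"
  by (simp add: blocks_def)

lemma blocks_subset: "U \<subseteq> {1, -1} \<Longrightarrow> blocks U \<subseteq> signed_pairs n"
  unfolding blocks_def by (auto simp: mem_signed_pairs)

lemma pair_root_blocksE: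
  assumes "x \<in> pair_root ` blocks U"
  obtains j t where "x = e j + t *\<^sub>R e (j - 1)" "odd j" "j < n" "t \<in> U"
proof -
  obtain p where p: "p \<in> blocks U" "x = pair_root p" using assms by blast
  obtain j i t where ji: "p = ((j, i), t)" by (metis surj_pair)
  have "i = j - 1" "odd j" "j < n" "t \<in> U" using p(1) unfolding ji blocks_def by auto
  then show thesis using p(2) that[of j t] by (simp add: ji pair_root_eq)
qed

lemma card_blocks: "card (blocks U) = (n div 2) * card U"
proof -
  have "card (blocks U) = card ((\<lambda>(j, t). ((j, j - 1), t)) ` ({j. j < n \<and> odd j} \<times> U))"
  proof (intro arg_cong[where f = card] equalityI subsetI)
    fix p assume p: "p \<in> blocks U"
    obtain j i t where ji: "p = ((j, i), t)" by (metis surj_pair)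
    have "i = j - 1" "odd j" "j < n" "t \<in> U" using p unfolding ji blocks_def by auto
    then show "p \<in> (\<lambda>(j, t). ((j, j - 1), t)) ` ({j. j < n \<and> odd j} \<times> U)"
      unfolding ji by (intro image_eqI[of _ _ "(j, t)"]) auto
  qed (auto simp: blocks_def)
  also have "\<dots> = card ({j. j < n \<and> odd j} \<times> U)" by (intro card_image) (auto simp: inj_on_def)
  finally show ?thesis by (simp add: card_cartesian_product card_odd_less)
qed

lemma blocks_strongly_orthogonal:
  assumes ab: "\<alpha> \<in> pair_root ` blocks U" "\<beta> \<in> pair_root ` blocks U" and U: "U \<subseteq> {1, -1}"
  shows "\<alpha> + \<beta> \<notin> D_roots e n \<union> axis_roots 1 e n \<and> \<alpha> - \<beta> \<notin> D_roots e n \<union> axis_roots 1 e n"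
proof -
  obtain j s where \<alpha>: "\<alpha> = e j + s *\<^sub>R e (j - 1)" "odd j" "j < n" "s \<in> U" using ab(1) by (rule pair_root_blocksE)
  obtain l t where \<beta>: "\<beta> = e l + t *\<^sub>R e (l - 1)" "odd l" "l < n" "t \<in> U" using ab(2) by (rule pair_root_blocksE)
  have st: "s \<in> {1, -1}" "t \<in> {1, -1}" using \<alpha>(4) \<beta>(4) U by auto
  show ?thesis
  proof (cases "j = l")
    case True
    then show ?thesis using same_block_not_root[of l s t] zero_not_root[of 1] \<alpha> \<beta> st by simp
  next
    case False
    have "\<alpha> + u *\<^sub>R \<beta> \<notin> D_roots e n \<union> axis_roots 1 e n" if "u \<in> {1, -1}" for u
      unfolding \<alpha>(1) \<beta>(1) using \<alpha>(2,3) \<beta>(2,3) False st that by (rule block_not_root)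
    from this[of 1] this[of "-1"] show ?thesis by simp
  qed
qed

text \<open>
  Both \<open>e\<^sub>j + e\<^sub>i\<close> and \<open>e\<^sub>j - e\<^sub>i\<close> get the sign \<open>(-1)\<^sup>i\<close> and so contribute \<open>\<plusminus>2e\<^sub>j\<close> together. For fixed even
  \<open>j\<close> these contributions cancel; for odd \<open>j\<close> they cancel once \<open>i = j - 1\<close> is left out, that is, once
  both roots of every block are omitted.
\<close>

lemma type_D_max:
  assumes R: "root_system (D_roots e n)" and P: "half_of (D_roots e n) P"
  shows "is_max_cocardinality (D_roots e n) P (2 * (n div 2))"
proof (rule is_max_cocardinalityI[OF R P half_of_D])
  define M where "M = blocks {1, -1}"
  have MK: "M \<subseteq> signed_pairs n" unfolding M_def by (rule blocks_subset) simp
  have diff: "D_pos - pair_root ` (signed_pairs n - M) = pair_root ` M"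
    unfolding D_pos_def using inj_pair_root MK by (auto simp: inj_on_def)
  have "well_balanced (D_roots e n) D_pos (pair_root ` (signed_pairs n - M))"
    unfolding well_balanced_def diff
  proof (intro conjI)
    show "pair_root ` (signed_pairs n - M) \<subseteq> D_pos" by (auto simp: D_pos_def)
    show "balanced (pair_root ` (signed_pairs n - M))"
    proof (rule balanced_imageI)
      show "finite (signed_pairs n - M)" by (simp add: finite_signed_pairs)
      show "inj_on pair_root (signed_pairs n - M)" using inj_pair_root by (rule inj_on_subset) auto
      show "(-1) ^ snd (fst p) \<in> {1, -1::real}" for p :: "(nat \<times> nat) \<times> real"
        by (simp add: minus_one_power_iff)
      have "(\<Sum>p\<in>signed_pairs n - M. (-1) ^ snd (fst p) *\<^sub>R pair_root p) =
          (\<Sum>j<n. \<Sum>i<j. (if odd j \<and> Suc i = j then 0 else (-1) ^ i) *\<^sub>R (2 *\<^sub>R e j))"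
        unfolding sum_Diff_if[OF finite_signed_pairs] sum_signed_pairs
      proof (intro sum.cong refl)
        fix j i assume "j \<in> {..<n}" "i \<in> {..<j}"
        then have "((j, i), t) \<in> M \<longleftrightarrow> odd j \<and> Suc i = j" if "t \<in> {1, -1}" for t
          using that unfolding M_def mem_blocks by blast
        then show "(if ((j, i), 1) \<in> M then 0 else (-1) ^ snd (fst ((j, i), 1::real)) *\<^sub>R pair_root ((j, i), 1)) +
            (if ((j, i), -1) \<in> M then 0 else (-1) ^ snd (fst ((j, i), -1::real)) *\<^sub>R pair_root ((j, i), -1)) =
            (if odd j \<and> Suc i = j then 0 else (-1) ^ i) *\<^sub>R (2 *\<^sub>R e j)"
          by (simp add: pair_root_eq scaleR_2 flip: scaleR_add_right)
      qed
      also have "\<dots> = 0"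
        unfolding scaleR_sum_left[symmetric] alternating_without_last by simp
      finally show "(\<Sum>p\<in>signed_pairs n - M. (-1) ^ snd (fst p) *\<^sub>R pair_root p) = 0" .
    qed
    show "strongly_orthogonal (D_roots e n) (pair_root ` M)"
      unfolding strongly_orthogonal_def M_def using blocks_strongly_orthogonal[of _ "{1, -1}"] by blast
  qed
  moreover have "card (pair_root ` M) = 2 * (n div 2)"
    using card_image[OF inj_on_subset[OF inj_pair_root MK]] by (simp add: M_def card_blocks)
  ultimately show "\<exists>S. well_balanced (D_roots e n) D_pos S \<and> card (D_pos - S) = 2 * (n div 2)"
    using diff by (intro exI[of _ "pair_root ` (signed_pairs n - M)"]) simp
next
  fix S assume "well_balanced (D_roots e n) D_pos S"
  then show "card (D_pos - S) \<le> 2 * (n div 2)"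
    by (intro card_D_le) (auto simp: well_balanced_def)
qed

section \<open>Positive roots in types B and C\<close>

lemma well_balanced_BC:
  assumes m: "m \<noteq> 0" and M: "M \<subseteq> signed_pairs n" and L: "L \<subseteq> {..<n}"
    and sign: "\<And>p. \<sigma> p \<in> {1, -1}" "\<And>l. \<tau> l \<in> {1, -1}"
    and zero: "(\<Sum>p\<in>signed_pairs n - M. \<sigma> p *\<^sub>R pair_root p) + (\<Sum>l\<in>{..<n} - L. \<tau> l *\<^sub>R m *\<^sub>R e l) = 0"
    and so: "strongly_orthogonal R (pair_root ` M \<union> (\<lambda>i. m *\<^sub>R e i) ` L)"
  shows "\<exists>S. well_balanced R (D_pos \<union> axis_pos m) S \<and> card (D_pos \<union> axis_pos m - S) = card M + card L"
proof -
  define ax where "ax = (\<lambda>l. m *\<^sub>R e l)"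
  have inj_ax: "inj_on ax {..<n}" using inj_axis[OF m] by (simp add: ax_def)
  have axis: "axis_pos m = ax ` {..<n}" by (simp add: axis_pos_def ax_def)
  define S where "S = pair_root ` (signed_pairs n - M) \<union> ax ` ({..<n} - L)"
  have 1: "D_pos - pair_root ` (signed_pairs n - M) = pair_root ` M"
    unfolding D_pos_def using inj_pair_root M by (auto simp: inj_on_def)
  have 2: "axis_pos m - ax ` ({..<n} - L) = ax ` L"
    unfolding axis using inj_ax L by (auto simp: inj_on_def)
  have sub: "pair_root ` (signed_pairs n - M) \<subseteq> D_pos" "ax ` ({..<n} - L) \<subseteq> axis_pos m"
    by (auto simp: D_pos_def axis)
  have diff: "D_pos \<union> axis_pos m - S = pair_root ` M \<union> ax ` L"
    unfolding S_def 1[symmetric] 2[symmetric] using sub D_axis_disjoint[of m] by blast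
  have "balanced S"
    unfolding S_def
  proof (rule balancedI[where \<sigma> = \<sigma> and \<tau> = \<tau>])
    show "inj_on pair_root (signed_pairs n - M)" using inj_pair_root by (rule inj_on_subset) auto
    show "inj_on ax ({..<n} - L)" using inj_ax by (rule inj_on_subset) auto
    show "pair_root ` (signed_pairs n - M) \<inter> ax ` ({..<n} - L) = {}" using sub D_axis_disjoint[of m] by blast
  qed (use finite_signed_pairs sign zero in \<open>simp_all add: ax_def\<close>)
  then have "well_balanced R (D_pos \<union> axis_pos m) S"
    unfolding well_balanced_def diff using so sub by (auto simp: S_def ax_def)
  moreover have "card (pair_root ` M \<union> ax ` L) = card M + card L"
  proof -
    have "finite M" "finite L" using finite_subset[OF M finite_signed_pairs] finite_subset[OF L] by auto
    moreover have "pair_root ` M \<inter> ax ` L = {}"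
      using D_axis_disjoint[of m] M L unfolding D_pos_def axis by blast
    ultimately have "card (pair_root ` M \<union> ax ` L) = card (pair_root ` M) + card (ax ` L)"
      by (intro card_Un_disjoint) auto
    then show ?thesis
      using card_image[OF inj_on_subset[OF inj_pair_root M]] card_image[OF inj_on_subset[OF inj_ax L]] by simp
  qed
  ultimately show ?thesis using diff by metis
qed

lemma sum_pos:
  assumes "m \<noteq> 0"
  shows "\<Sum>(D_pos \<union> axis_pos m) = (\<Sum>j<n. (2 * real j + m) *\<^sub>R e j)"
proof -
  have "\<Sum>(D_pos \<union> axis_pos m) = \<Sum>D_pos + \<Sum>(axis_pos m)"
    using D_axis_disjoint by (intro sum.union_disjoint) (auto simp: finite_D_pos axis_pos_def)
  also have "\<Sum>D_pos = (\<Sum>j<n. \<Sum>i<j. 2 *\<^sub>R e j)"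
    unfolding D_pos_def using inj_pair_root by (simp add: sum.reindex sum_signed_pairs pair_root_eq scaleR_2)
  also have "\<dots> = (\<Sum>j<n. (2 * real j) *\<^sub>R e j)"
    by (intro sum.cong refl) (simp add: sum_constant_scaleR mult.commute)
  also have "\<Sum>(axis_pos m) = (\<Sum>j<n. m *\<^sub>R e j)"
    unfolding axis_pos_def using inj_axis[OF assms] by (simp add: sum.reindex)
  finally show ?thesis by (simp add: sum.distrib[symmetric] scaleR_add_left)
qed

text \<open>
  In terms of Lie theory these are the coordinates of \<open>2\<rho>\<close>.
\<close>

lemma c_sum_pos:
  assumes "m \<noteq> 0" "v < n"
  shows "c v (\<Sum>(D_pos \<union> axis_pos m)) = 2 * real v + m"
proof -
  have "c v (\<Sum>(D_pos \<union> axis_pos m)) = (\<Sum>j<n. (2 * real j + m) * (if v = j then 1 else 0))"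
    unfolding sum_pos[OF assms(1)] using assms(2)
    by (simp add: linear_sum[OF linear_c] c_simps)
  also have "\<dots> = 2 * real v + m" using assms(2) by (simp add: if_distrib sum.delta' cong: if_cong)
  finally show ?thesis .
qed

lemma c_pos_Ints: "m \<in> \<int> \<Longrightarrow> v < n \<Longrightarrow> x \<in> D_pos \<union> axis_pos m \<Longrightarrow> c v x \<in> \<int>"
  by (auto elim!: D_posE simp: axis_pos_def c_pair_root c_simps)

lemma finite_pos: "finite (D_pos \<union> axis_pos m)"
  by (simp add: finite_D_pos axis_pos_def)

lemma D_pos_same_supp:
  assumes "\<alpha> \<in> D_pos" "\<beta> \<in> D_pos" "supp \<alpha> = supp \<beta>" "\<alpha> \<noteq> \<beta>"
  obtains i j t where "\<alpha> = e j + t *\<^sub>R e i" "\<beta> = e j - t *\<^sub>R e i" "i < j" "j < n" "t \<in> {1, -1}"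
proof -
  obtain j i t where \<alpha>: "\<alpha> = e j + t *\<^sub>R e i" "i < j" "j < n" "t \<in> {1, -1}" using assms(1) by (rule D_posE)
  obtain l k u where \<beta>: "\<beta> = e l + u *\<^sub>R e k" "k < l" "l < n" "u \<in> {1, -1}" using assms(2) by (rule D_posE)
  have "{i, j} = {k, l}" using assms(3) \<alpha> \<beta> supp_pair_root by auto
  then have "i = k" "j = l" using \<alpha>(2) \<beta>(2) by (auto simp: doubleton_eq_iff)
  moreover have "u = - t" using assms(4) \<alpha> \<beta> calculation by auto
  ultimately show thesis using that[of j t i] \<alpha> \<beta> by simp
qed

lemma axis_rootI: "i < n \<Longrightarrow> s \<in> {m, -m} \<Longrightarrow> s *\<^sub>R e i \<in> axis_roots m e n"
  unfolding axis_roots_def by blast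

lemma B_axis_clash:
  assumes "\<alpha> \<in> D_roots e n" "i \<in> supp \<alpha>"
  shows "\<alpha> + e i \<in> axis_roots 1 e n \<or> \<alpha> - e i \<in> axis_roots 1 e n"
  using assms
proof (rule D_root_at)
  fix s t j assume \<alpha>: "\<alpha> = s *\<^sub>R e i + t *\<^sub>R e j" "j < n" "s \<in> {1, -1}" "t \<in> {1, -1}"
  then have "t *\<^sub>R e j \<in> axis_roots 1 e n" by (intro axis_rootI)
  then show ?thesis using \<alpha> by auto
qed

lemma C_axis_clash:
  assumes "\<alpha> \<in> D_roots e n" "i \<in> supp \<alpha>"
  shows "\<alpha> + 2 *\<^sub>R e i \<in> D_roots e n \<or> \<alpha> - 2 *\<^sub>R e i \<in> D_roots e n"
  using assms
proof (rule D_root_at)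
  fix s t j assume \<alpha>: "\<alpha> = s *\<^sub>R e i + t *\<^sub>R e j" "i < n" "j < n" "j \<noteq> i" "s \<in> {1, -1}" "t \<in> {1, -1}"
  then have "(- s) *\<^sub>R e i + t *\<^sub>R e j \<in> D_roots e n" by (intro D_rootI) auto
  moreover have "(- s) *\<^sub>R e i + t *\<^sub>R e j = \<alpha> - (2 * s) *\<^sub>R e i"
    using \<alpha>(1) by (simp add: algebra_simps flip: scaleR_add_left)
  ultimately show ?thesis using \<alpha>(5) by auto
qed

end

section \<open>Type B\<close>

lemma sum_odd_terms:
  fixes f :: "nat \<Rightarrow> 'a::ab_group_add"
  shows "(\<Sum>j<n. if odd j then f j else 0) = (\<Sum>q<n div 2. f (2 * q + 1))"
proof (induction n)
  case (Suc n)
  then show ?case by (cases "even n") (auto elim!: evenE oddE)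
qed simp

lemma sum_even_odd:
  fixes f :: "nat \<Rightarrow> 'a::ab_group_add"
  shows "(\<Sum>l<2 * k. f l) = (\<Sum>q<k. f (2 * q) + f (2 * q + 1))"
  by (induction k) (simp_all add: algebra_simps)

context coordinates
begin

text \<open>
  The signs of \<open>e\<^sub>j \<plusminus> e\<^sub>i\<close> are those of type D, but of each block only \<open>e\<^sub>j + e\<^sub>j\<^sub>-\<^sub>1\<close> is omitted. The
  remaining \<open>e\<^sub>j - e\<^sub>j\<^sub>-\<^sub>1\<close> cancels against \<open>e\<^sub>j\<^sub>-\<^sub>1 - e\<^sub>j\<close>, composed of roots on the axes. If \<open>n\<close> is odd, the
  root \<open>e\<^sub>n\<^sub>-\<^sub>1\<close> outside the blocks is omitted too.

  For the upper bound, all coordinates of the sum of the positive roots are odd. If the supports of two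
  roots of \<open>T\<close> meet, then these roots are \<open>e\<^sub>j \<plusminus> e\<^sub>i\<close> and no other root of \<open>T\<close> involves \<open>j\<close>, so that
  coordinate \<open>j\<close> of the sum of \<open>T\<close> is 2, which has the wrong parity. So the supports are disjoint. At
  most one of them is a single index, because \<open>e\<^sub>i + e\<^sub>k\<close> is a root.
\<close>

lemma type_B_max:
  defines "B \<equiv> D_roots e n \<union> axis_roots 1 e n"
  assumes R: "root_system B" and P: "half_of B P"
  shows "is_max_cocardinality B P ((n + 1) div 2)"
proof (rule is_max_cocardinalityI[OF R P])
  show "half_of B (D_pos \<union> axis_pos 1)" unfolding B_def by (rule half_of_BC) simp
  define M where "M = blocks {1}"
  define L where "L = {2 * (n div 2)..<n}"
  have MK: "M \<subseteq> signed_pairs n" unfolding M_def by (rule blocks_subset) simp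
  have L: "L \<subseteq> {..<n}" by (auto simp: L_def)
  have Lc: "{..<n} - L = {..<2 * (n div 2)}" by (auto simp: L_def)
  have card: "card M + card L = (n + 1) div 2"
    unfolding M_def card_blocks L_def by simp
  have "(\<Sum>p\<in>signed_pairs n - M. (-1) ^ snd (fst p) *\<^sub>R pair_root p) =
      (\<Sum>j<n. \<Sum>i<j. (if odd j \<and> Suc i = j then 0 else (-1) ^ i) *\<^sub>R (2 *\<^sub>R e j) +
        (if Suc i = j then (if odd j then e j - e i else 0) else 0))"
    unfolding sum_Diff_if[OF finite_signed_pairs] sum_signed_pairs
  proof (intro sum.cong refl)
    fix j i assume "j \<in> {..<n}" "i \<in> {..<j}"
    then have "((j, i), t) \<in> M \<longleftrightarrow> odd j \<and> Suc i = j \<and> t = 1" for t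
      unfolding M_def mem_blocks by blast
    then show "(if ((j, i), 1) \<in> M then 0 else (-1) ^ snd (fst ((j, i), 1::real)) *\<^sub>R pair_root ((j, i), 1)) +
        (if ((j, i), -1) \<in> M then 0 else (-1) ^ snd (fst ((j, i), -1::real)) *\<^sub>R pair_root ((j, i), -1)) =
        (if odd j \<and> Suc i = j then 0 else (-1) ^ i) *\<^sub>R (2 *\<^sub>R e j) +
        (if Suc i = j then (if odd j then e j - e i else 0) else 0)"
      by (auto simp: pair_root_eq scaleR_2 simp flip: scaleR_add_right)
  qed
  also have "\<dots> = (\<Sum>j<n. if odd j then e j - e (j - 1) else 0)"
    unfolding sum.distrib scaleR_sum_left[symmetric] alternating_without_last sum_last_term
    by (auto intro!: sum.cong)
  also have "\<dots> = (\<Sum>q<n div 2. e (2 * q + 1) - e (2 * q))"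
    unfolding sum_odd_terms by simp
  also have "\<dots> = - (\<Sum>l<2 * (n div 2). (-1) ^ l *\<^sub>R 1 *\<^sub>R e l)"
    unfolding sum_even_odd sum_negf[symmetric] by simp
  finally have zero: "(\<Sum>p\<in>signed_pairs n - M. (-1) ^ snd (fst p) *\<^sub>R pair_root p) +
      (\<Sum>l\<in>{..<n} - L. (-1) ^ l *\<^sub>R 1 *\<^sub>R e l) = 0"
    unfolding Lc by simp
  have so: "strongly_orthogonal B (pair_root ` M \<union> (\<lambda>i. 1 *\<^sub>R e i) ` L)"
    unfolding strongly_orthogonal_def
  proof (intro ballI)
    fix \<alpha> \<beta> assume \<alpha>: "\<alpha> \<in> pair_root ` M \<union> (\<lambda>i. 1 *\<^sub>R e i) ` L" and \<beta>: "\<beta> \<in> pair_root ` M \<union> (\<lambda>i. 1 *\<^sub>R e i) ` L"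
    have mixed: "s *\<^sub>R x + t *\<^sub>R y \<notin> B" if x: "x \<in> pair_root ` M" and y: "y \<in> (\<lambda>i. 1 *\<^sub>R e i) ` L"
      and st: "s \<in> {1, -1}" "t \<in> {1, -1}" for x y s t
    proof -
      obtain j u where xj: "x = e j + u *\<^sub>R e (j - 1)" "odd j" "j < n" "u \<in> {1}"
        using x unfolding M_def by (rule pair_root_blocksE)
      obtain l where yl: "y = e l" "2 * (n div 2) \<le> l" "l < n" using y by (auto simp: L_def)
      have lt: "j - 1 < j" "j - 1 < n" "j < l" using xj yl by (auto elim: oddE) presburger
      have "c v (s *\<^sub>R x + t *\<^sub>R y) =
          s * ((if v = j then 1 else 0) + (if v = j - 1 then 1 else 0)) + t * (if v = l then 1 else 0)"
        if "v < n" for v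
        using that xj yl lt by (simp add: c_simps)
      from this[of "j - 1"] this[of j] this[of l]
      show ?thesis unfolding B_def
        by (intro not_root_three[of "j - 1" _ j l]) (use xj yl lt st in auto)
    qed
    show "\<alpha> + \<beta> \<notin> B \<and> \<alpha> - \<beta> \<notin> B"
      using \<alpha> \<beta>
    proof (elim UnE)
      assume "\<alpha> \<in> pair_root ` M" "\<beta> \<in> pair_root ` M"
      then show ?thesis unfolding M_def B_def by (rule blocks_strongly_orthogonal) simp
    next
      assume "\<alpha> \<in> pair_root ` M" "\<beta> \<in> (\<lambda>i. 1 *\<^sub>R e i) ` L"
      then show ?thesis using mixed[of \<alpha> \<beta> 1 1] mixed[of \<alpha> \<beta> 1 "-1"] by simp
    next
      assume "\<alpha> \<in> (\<lambda>i. 1 *\<^sub>R e i) ` L" "\<beta> \<in> pair_root ` M"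
      then show ?thesis using mixed[of \<beta> \<alpha> 1 1] mixed[of \<beta> \<alpha> "-1" 1] by (simp add: add.commute)
    next
      assume "\<alpha> \<in> (\<lambda>i. 1 *\<^sub>R e i) ` L" "\<beta> \<in> (\<lambda>i. 1 *\<^sub>R e i) ` L"
      then obtain k l where kl: "\<alpha> = e k" "\<beta> = e l" "k \<in> L" "l \<in> L" by auto
      then have "k = l" "l < n" by (auto simp: L_def)
      moreover from this have "c l (\<alpha> + \<beta>) = 2" using kl by (simp add: linear_add[OF linear_c] c_e)
      ultimately show ?thesis
        using kl zero_not_root[of 1] not_root_large[of l "\<alpha> + \<beta>"] by (simp add: B_def)
    qed
  qed
  show "\<exists>S. well_balanced B (D_pos \<union> axis_pos 1) S \<and> card (D_pos \<union> axis_pos 1 - S) = (n + 1) div 2"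
    unfolding card[symmetric]
    by (rule well_balanced_BC[OF _ MK L _ _ zero so]) (simp_all add: minus_one_power_iff)
next
  fix S assume wb: "well_balanced B (D_pos \<union> axis_pos 1) S"
  define T where "T = D_pos \<union> axis_pos 1 - S"
  have so: "\<alpha> + \<beta> \<notin> B" "\<alpha> - \<beta> \<notin> B" if "\<alpha> \<in> T" "\<beta> \<in> T" for \<alpha> \<beta>
    using wb that unfolding well_balanced_def strongly_orthogonal_def T_def by blast+
  have finT: "finite T" unfolding T_def using finite_pos by (rule finite_Diff)
  have TQ: "\<alpha> \<in> D_pos \<or> (\<exists>i<n. \<alpha> = e i)" if "\<alpha> \<in> T" for \<alpha>
    using that by (auto simp: T_def axis_pos_def)
  have axis_D: "i \<notin> supp \<alpha>" if "\<alpha> \<in> T" "\<alpha> \<in> D_pos" "e i \<in> T" for \<alpha> i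
    using B_axis_clash[of \<alpha> i] so[OF that(1,3)] that(2) D_pos_subset unfolding B_def by blast
  have D_D: "supp \<alpha> = supp \<beta>" if "\<alpha> \<in> T" "\<beta> \<in> T" "\<alpha> \<in> D_pos" "\<beta> \<in> D_pos" "supp \<alpha> \<inter> supp \<beta> \<noteq> {}" for \<alpha> \<beta>
    using D_roots_clash[of \<alpha> \<beta>] so[OF that(1,2)] that(3-5) D_pos_subset unfolding B_def by blast
  have parity: "\<exists>m::int. 2 * real v + 1 = c v (\<Sum>T) + 2 * of_int m" if "v < n" for v
    using balanced_parity[OF finite_pos[of 1] _ _ linear_c[of v], of S] wb c_sum_pos[of 1 v] c_pos_Ints[of 1 v] that
    unfolding well_balanced_def T_def by simp
  have disj: "supp \<alpha> \<inter> supp \<beta> = {}" if \<alpha>\<beta>: "\<alpha> \<in> T" "\<beta> \<in> T" "\<alpha> \<noteq> \<beta>" for \<alpha> \<beta>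
  proof (rule ccontr)
    assume meet: "supp \<alpha> \<inter> supp \<beta> \<noteq> {}"
    have "\<alpha> \<in> D_pos"
    proof (rule ccontr)
      assume "\<alpha> \<notin> D_pos"
      then obtain i where i: "i < n" "\<alpha> = e i" using TQ[OF \<alpha>\<beta>(1)] by blast
      then have "supp \<alpha> = {i}" using supp_axis[of i 1] by simp
      then have ib: "i \<in> supp \<beta>" using meet by auto
      show False using TQ[OF \<alpha>\<beta>(2)]
      proof
        assume "\<beta> \<in> D_pos"
        then show False using axis_D[OF \<alpha>\<beta>(2), of i] \<alpha>\<beta>(1) i ib by blast
      next
        assume "\<exists>k<n. \<beta> = e k"
        then obtain k where "k < n" "\<beta> = e k" by blast
        then show False using ib supp_axis[of k 1] i \<alpha>\<beta>(3) by simp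
      qed
    qed
    have "\<beta> \<in> D_pos"
    proof (rule ccontr)
      assume "\<beta> \<notin> D_pos"
      then obtain i where i: "i < n" "\<beta> = e i" using TQ[OF \<alpha>\<beta>(2)] by blast
      then have "supp \<beta> = {i}" using supp_axis[of i 1] by simp
      then show False using axis_D[OF \<alpha>\<beta>(1) \<open>\<alpha> \<in> D_pos\<close>, of i] \<alpha>\<beta>(2) i meet by auto
    qed
    have same: "supp \<alpha> = supp \<beta>" using D_D \<alpha>\<beta> \<open>\<alpha> \<in> D_pos\<close> \<open>\<beta> \<in> D_pos\<close> meet by blast
    obtain i j t where ij: "\<alpha> = e j + t *\<^sub>R e i" "\<beta> = e j - t *\<^sub>R e i" "i < j" "j < n" "t \<in> {1, -1}"
      using \<open>\<alpha> \<in> D_pos\<close> \<open>\<beta> \<in> D_pos\<close> same \<alpha>\<beta>(3) by (rule D_pos_same_supp)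
    have supp_\<alpha>: "supp \<alpha> = {i, j}" using ij supp_pair_root by simp
    have other: "c j \<gamma> = 0" if \<gamma>: "\<gamma> \<in> T - {\<alpha>, \<beta>}" for \<gamma>
    proof (rule ccontr)
      assume "c j \<gamma> \<noteq> 0"
      then have j\<gamma>: "j \<in> supp \<gamma>" using ij by (simp add: supp_def)
      have "\<gamma> \<in> D_pos"
      proof (rule ccontr)
        assume "\<gamma> \<notin> D_pos"
        then obtain k where k: "k < n" "\<gamma> = e k" using TQ \<gamma> by blast
        then have "k = j" using j\<gamma> supp_axis[of k 1] by simp
        then show False using axis_D[OF \<alpha>\<beta>(1) \<open>\<alpha> \<in> D_pos\<close>, of j] \<gamma> k supp_\<alpha> by blast
      qed
      then have "supp \<gamma> = supp \<alpha>" using D_D[of \<gamma> \<alpha>] \<gamma> \<alpha>\<beta>(1) \<open>\<alpha> \<in> D_pos\<close> j\<gamma> supp_\<alpha> by blast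
      then obtain i' j' t' where \<gamma>': "\<alpha> = e j' + t' *\<^sub>R e i'" "\<gamma> = e j' - t' *\<^sub>R e i'" "i' < j'" "j' < n" "t' \<in> {1, -1}"
        using D_pos_same_supp[OF \<open>\<alpha> \<in> D_pos\<close> \<open>\<gamma> \<in> D_pos\<close>] \<gamma> by (metis Diff_iff insertI1)
      have "{i, j} = {i', j'}" using supp_\<alpha> \<gamma>' supp_pair_root by simp
      then have "i = i'" "j = j'" using ij(3) \<gamma>'(3) by (auto simp: doubleton_eq_iff)
      moreover from this have "t *\<^sub>R e i = t' *\<^sub>R e i" using ij(1) \<gamma>'(1) by (metis add_left_cancel)
      ultimately have "\<gamma> = \<beta>" using ij(2) \<gamma>'(2) by auto
      then show False using \<gamma> by simp
    qed
    have "c j (\<Sum>T) = (\<Sum>\<gamma>\<in>T. c j \<gamma>)" by (rule linear_sum[OF linear_c])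
    also have "\<dots> = (\<Sum>\<gamma>\<in>{\<alpha>, \<beta>}. c j \<gamma>)"
      using finT \<alpha>\<beta> other by (intro sum.mono_neutral_right) auto
    also have "\<dots> = 2" using \<alpha>\<beta>(3) ij by (simp add: c_simps)
    finally obtain m :: int where "2 * real j + 1 = 2 + 2 * of_int m" using parity[OF ij(4)] by auto
    then have "2 * int j + 1 = 2 + 2 * m" by linarith
    then show False by presburger
  qed
  have "2 * card T = (\<Sum>\<alpha>\<in>T. card (supp \<alpha>)) + card (T - D_pos)"
  proof -
    have "card (supp \<alpha>) = (if \<alpha> \<in> D_pos then 2 else 1)" if "\<alpha> \<in> T" for \<alpha>
      using TQ[OF that] card_supp_D_pos supp_axis[of _ 1] D_axis_disjoint[of 1]
      by (auto simp: axis_pos_def)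
    then have "(\<Sum>\<alpha>\<in>T. card (supp \<alpha>)) + card (T - D_pos) =
        (\<Sum>\<alpha>\<in>T. if \<alpha> \<in> D_pos then 2 else 1) + (\<Sum>\<alpha>\<in>T. if \<alpha> \<in> D_pos then 0 else 1)"
      using finT by (simp add: sum.If_cases Diff_eq)
    also have "\<dots> = (\<Sum>\<alpha>\<in>T. 2)" unfolding sum.distrib[symmetric] by (intro sum.cong) auto
    finally show ?thesis by simp
  qed
  also have "(\<Sum>\<alpha>\<in>T. card (supp \<alpha>)) = card (\<Union>\<alpha>\<in>T. supp \<alpha>)"
    using finT disj finite_supp by (intro card_UN_disjoint[symmetric]) auto
  also have "\<dots> \<le> card {..<n}" by (intro card_mono) (auto simp: supp_def)
  also have "card (T - D_pos) \<le> 1"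
  proof (rule ccontr)
    assume "\<not> card (T - D_pos) \<le> 1"
    then obtain \<alpha> \<beta> where ab: "\<alpha> \<in> T - D_pos" "\<beta> \<in> T - D_pos" "\<alpha> \<noteq> \<beta>"
      by (metis One_nat_def card_le_Suc0_iff_eq finT finite_Diff)
    then obtain i k where ik: "\<alpha> = e i" "\<beta> = e k" "i < n" "k < n" using TQ by blast
    then have "1 *\<^sub>R e i + 1 *\<^sub>R e k \<in> D_roots e n" using ab by (intro D_rootI) auto
    then show False using so(1)[of \<alpha> \<beta>] ab ik by (simp add: B_def)
  qed
  finally have "2 * card T \<le> n + 1" by simp
  then show "card (D_pos \<union> axis_pos 1 - S) \<le> (n + 1) div 2" unfolding T_def by linarith
qed

end

section \<open>Type C\<close>

text \<open>
  The joint contribution of \<open>e\<^sub>j \<plusminus> e\<^sub>i\<close> to the signed sum. With the signs \<open>(-1)\<^sup>i\<close> of type D, a surplus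
  \<open>2e\<^sub>j\<close> would remain for every odd \<open>j\<close>. For \<open>j\<close> congruent to 3 modulo 4, opposite signs on
  \<open>e\<^sub>j \<plusminus> e\<^sub>j\<^sub>-\<^sub>2\<close> produce \<open>-2e\<^sub>j\<^sub>-\<^sub>2\<close>, which cancels the surplus of index \<open>j - 2\<close>, and the changed sign at
  \<open>i = j - 1\<close> restores the cancellation for \<open>j\<close> itself.
\<close>

definition C_term :: "(nat \<Rightarrow> 'a::real_vector) \<Rightarrow> nat \<Rightarrow> nat \<Rightarrow> 'a" where
  "C_term e j i = (if j mod 4 = 3 \<and> Suc (Suc i) = j then - 2 *\<^sub>R e i
     else if j mod 4 = 3 \<and> Suc i = j then - 2 *\<^sub>R e j else (-1) ^ i *\<^sub>R 2 *\<^sub>R e j)"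

lemma sum_C_term_row:
  "(\<Sum>i<j. C_term e j i) = (if j mod 4 = 3 then - 2 *\<^sub>R e (j - 2) else if odd j then 2 *\<^sub>R e j else 0)"
proof (cases "j mod 4 = 3")
  case False
  then have "(\<Sum>i<j. C_term e j i) = (\<Sum>i<j. (-1) ^ i) *\<^sub>R 2 *\<^sub>R e j"
    unfolding scaleR_sum_left by (intro sum.cong) (auto simp: C_term_def)
  then show ?thesis using False by (simp add: sum_alternating)
next
  case True
  then have "odd j" "j \<ge> 2" by presburger+
  then obtain k where k: "j = Suc (Suc k)" "odd k" by (metis add_2_eq_Suc even_Suc le_Suc_ex)
  have "(\<Sum>i<k. C_term e j i) = (\<Sum>i<k. (-1) ^ i) *\<^sub>R 2 *\<^sub>R e j"
    unfolding scaleR_sum_left by (intro sum.cong) (auto simp: C_term_def k)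
  also have "\<dots> = 2 *\<^sub>R e j" using k by (simp add: sum_alternating)
  finally show ?thesis using True by (simp add: k C_term_def)
qed

text \<open>
  A surplus survives only if the last odd index is congruent to 1 modulo 4.
\<close>

lemma sum_C_term:
  "(\<Sum>j<n. \<Sum>i<j. C_term e j i) = (if n mod 4 \<in> {2, 3} then 2 *\<^sub>R e (4 * (n div 4) + 1) else 0)"
proof -
  define row where "row j = (\<Sum>i<j. C_term e j i)" for j
  have row: "row (4 * k) = 0" "row (Suc (4 * k)) = 2 *\<^sub>R e (Suc (4 * k))" "row (Suc (Suc (4 * k))) = 0"
    "row (Suc (Suc (Suc (4 * k)))) = - 2 *\<^sub>R e (Suc (4 * k))" for k
  proof -
    have "Suc (Suc (Suc (4 * k))) mod 4 = 3" "Suc (Suc (4 * k)) mod 4 = 2" "Suc (4 * k) mod 4 = 1" by presburger+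
    then show "row (4 * k) = 0" "row (Suc (4 * k)) = 2 *\<^sub>R e (Suc (4 * k))" "row (Suc (Suc (4 * k))) = 0"
      "row (Suc (Suc (Suc (4 * k)))) = - 2 *\<^sub>R e (Suc (4 * k))"
      unfolding row_def sum_C_term_row by simp_all
  qed
  have four: "(\<Sum>j<4 * k. row j) = 0" for k
  proof (induction k)
    case (Suc k)
    have "4 * Suc k = Suc (Suc (Suc (Suc (4 * k))))" by simp
    then show ?case using Suc by (simp only: sum.lessThan_Suc row) simp
  qed simp
  define k where "k = n div 4"
  have "n = 4 * k \<or> n = Suc (4 * k) \<or> n = Suc (Suc (4 * k)) \<or> n = Suc (Suc (Suc (4 * k)))"
    unfolding k_def by presburger
  moreover have "n mod 4 = n - 4 * k" unfolding k_def by presburger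
  ultimately show ?thesis unfolding k_def[symmetric] row_def[symmetric]
    using four[of k] by (elim disjE) (simp_all add: row)
qed

context coordinates
begin

text \<open>
  All \<open>e\<^sub>j \<plusminus> e\<^sub>i\<close> belong to \<open>S\<close>. Their signed sum is 0 or \<open>2e\<^sub>j\<close> for a single \<open>j\<close>, in which case the root
  \<open>2e\<^sub>j\<close> joins \<open>S\<close> with sign \<open>-1\<close>.

  For the upper bound, a root \<open>e\<^sub>j \<plusminus> e\<^sub>i\<close> in \<open>T\<close> would be the only root of \<open>T\<close> involving \<open>j\<close>, whereas the
  coordinates of the sum of the positive roots are even. So \<open>T\<close> consists of roots \<open>2e\<^sub>i\<close>. If \<open>T\<close> contains
  all of them, half the sum of the coordinates is \<open>n\<close> for \<open>T\<close> and \<open>n(n + 1)/2\<close> for all positive roots,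
  and these have different parity when \<open>n\<close> is 2 or 3 modulo 4.
\<close>

lemma type_C_max:
  defines "C \<equiv> D_roots e n \<union> axis_roots 2 e n"
  assumes R: "root_system C" and P: "half_of C P"
  shows "is_max_cocardinality C P (if n mod 4 \<in> {2, 3} then n - 1 else n)"
proof (rule is_max_cocardinalityI[OF R P])
  show "half_of C (D_pos \<union> axis_pos 2)" unfolding C_def by (rule half_of_BC) simp
  define J where "J = (if n mod 4 \<in> {2, 3} then {4 * (n div 4) + 1} else {})"
  define L where "L = {..<n} - J"
  have Jn: "J \<subseteq> {..<n}" unfolding J_def by auto presburger+
  have L: "L \<subseteq> {..<n}" and Lc: "{..<n} - L = J" using Jn by (auto simp: L_def)
  have card: "card ({} :: ((nat \<times> nat) \<times> real) set) + card L = (if n mod 4 \<in> {2, 3} then n - 1 else n)"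
    using Jn by (simp add: L_def J_def card_Diff_subset)
  define \<sigma> :: "(nat \<times> nat) \<times> real \<Rightarrow> real" where
    "\<sigma> p = (case p of ((j, i), t) \<Rightarrow> if j mod 4 = 3 \<and> Suc (Suc i) = j then (if t = 1 then -1 else 1)
       else if j mod 4 = 3 \<and> Suc i = j then -1 else (-1) ^ i)" for p
  have "(\<Sum>p\<in>signed_pairs n - {}. \<sigma> p *\<^sub>R pair_root p) = (\<Sum>j<n. \<Sum>i<j. C_term e j i)"
    unfolding Diff_empty sum_signed_pairs
    by (intro sum.cong refl) (auto simp: \<sigma>_def C_term_def pair_root_eq scaleR_2 simp flip: scaleR_add_right)
  also have "\<dots> = - (\<Sum>l\<in>{..<n} - L. (-1) *\<^sub>R 2 *\<^sub>R e l)"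
    unfolding sum_C_term Lc J_def by auto
  finally have zero: "(\<Sum>p\<in>signed_pairs n - {}. \<sigma> p *\<^sub>R pair_root p) + (\<Sum>l\<in>{..<n} - L. (-1) *\<^sub>R 2 *\<^sub>R e l) = 0"
    by simp
  have so: "strongly_orthogonal C (pair_root ` {} \<union> (\<lambda>i. 2 *\<^sub>R e i) ` L)"
    unfolding strongly_orthogonal_def
  proof (intro ballI)
    fix \<alpha> \<beta> assume "\<alpha> \<in> pair_root ` {} \<union> (\<lambda>i. 2 *\<^sub>R e i) ` L" "\<beta> \<in> pair_root ` {} \<union> (\<lambda>i. 2 *\<^sub>R e i) ` L"
    then obtain i k where ik: "\<alpha> = 2 *\<^sub>R e i" "\<beta> = 2 *\<^sub>R e k" "i < n" "k < n" using L by auto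
    have "\<alpha> + t *\<^sub>R \<beta> \<notin> C" if t: "t \<in> {1, -1}" for t :: real
    proof
      assume root: "\<alpha> + t *\<^sub>R \<beta> \<in> C"
      have coord: "c v (\<alpha> + t *\<^sub>R \<beta>) = 2 * (if v = i then 1 else 0) + t * 2 * (if v = k then 1 else 0)" if "v < n" for v
        using that ik by (simp add: c_simps)
      show False
      proof (cases "i = k")
        case True
        show False
        proof (cases "t = 1")
          case True
          have "c i (\<alpha> + t *\<^sub>R \<beta>) = 4" using coord[of i] ik \<open>i = k\<close> True by simp
          then show False using large_coordinate[OF root[unfolded C_def], of i] ik by simp
        next
          case False
          then have "\<alpha> + t *\<^sub>R \<beta> = 0" using t ik \<open>i = k\<close> by auto
          then show False using root zero_not_root[of 2] by (simp add: C_def)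
        qed
      next
        case False
        have "c i (\<alpha> + t *\<^sub>R \<beta>) = 2" using coord[of i] ik False by simp
        then have "supp (\<alpha> + t *\<^sub>R \<beta>) = {i}" using large_coordinate[OF root[unfolded C_def], of i] ik by simp
        moreover have "k \<in> supp (\<alpha> + t *\<^sub>R \<beta>)" using coord[of k] ik False t by (auto simp: supp_def)
        ultimately show False using False by simp
      qed
    qed
    from this[of 1] this[of "-1"] show "\<alpha> + \<beta> \<notin> C \<and> \<alpha> - \<beta> \<notin> C" by simp
  qed
  show "\<exists>S. well_balanced C (D_pos \<union> axis_pos 2) S \<and>
      card (D_pos \<union> axis_pos 2 - S) = (if n mod 4 \<in> {2, 3} then n - 1 else n)"
    unfolding card[symmetric]
    by (rule well_balanced_BC[OF _ _ L _ _ zero so]) (auto simp: \<sigma>_def minus_one_power_iff split: prod.split)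
next
  fix S assume wb: "well_balanced C (D_pos \<union> axis_pos 2) S"
  define T where "T = D_pos \<union> axis_pos 2 - S"
  have so: "\<alpha> + \<beta> \<notin> C" "\<alpha> - \<beta> \<notin> C" if "\<alpha> \<in> T" "\<beta> \<in> T" for \<alpha> \<beta>
    using wb that unfolding well_balanced_def strongly_orthogonal_def T_def by blast+
  have finT: "finite T" unfolding T_def using finite_pos by (rule finite_Diff)
  have parity: "\<exists>m::int. f (\<Sum>(D_pos \<union> axis_pos 2)) = f (\<Sum>T) + 2 * of_int m"
    if "linear f" "\<And>x. x \<in> D_pos \<union> axis_pos 2 \<Longrightarrow> f x \<in> \<int>" for f :: "'a \<Rightarrow> real"
    using balanced_parity[OF finite_pos[of 2] _ _ that(1), of S] wb that(2)
    unfolding well_balanced_def T_def by simp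
  have no_D: "T \<subseteq> axis_pos 2"
  proof (rule ccontr)
    assume "\<not> T \<subseteq> axis_pos 2"
    then obtain \<alpha> where \<alpha>: "\<alpha> \<in> T" "\<alpha> \<in> D_pos" by (auto simp: T_def)
    obtain j i t where ij: "\<alpha> = e j + t *\<^sub>R e i" "i < j" "j < n" "t \<in> {1, -1}" using \<alpha>(2) by (rule D_posE)
    have supp_\<alpha>: "supp \<alpha> = {i, j}" using ij supp_pair_root by simp
    have other: "c j \<gamma> = 0" if \<gamma>: "\<gamma> \<in> T - {\<alpha>}" for \<gamma>
    proof (rule ccontr)
      assume "c j \<gamma> \<noteq> 0"
      then have j\<gamma>: "j \<in> supp \<gamma>" using ij by (simp add: supp_def)
      show False
      proof (cases "\<gamma> \<in> D_pos")
        case True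
        have "supp \<alpha> = supp \<gamma>"
          using D_roots_clash[of \<alpha> \<gamma>] so[of \<alpha> \<gamma>] \<alpha> \<gamma> True D_pos_subset j\<gamma> supp_\<alpha> unfolding C_def by blast
        then obtain i' j' t' where "\<alpha> = e j' + t' *\<^sub>R e i'" "\<gamma> = e j' - t' *\<^sub>R e i'" "j' < n"
          using D_pos_same_supp[OF \<alpha>(2) True] \<gamma> by (metis Diff_iff singletonI)
        then have "\<alpha> + \<gamma> = 2 *\<^sub>R e j'" "j' < n" by (simp_all add: scaleR_2)
        then have "\<alpha> + \<gamma> \<in> C" unfolding C_def using axis_rootI[of j' 2 2] by simp
        then show False using so(1)[of \<alpha> \<gamma>] \<alpha> \<gamma> by blast
      next
        case False
        then obtain k where k: "k < n" "\<gamma> = 2 *\<^sub>R e k" using \<gamma> by (auto simp: T_def axis_pos_def)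
        then have "k = j" using j\<gamma> supp_axis[of k 2] by simp
        then show False
          using C_axis_clash[of \<alpha> j] so[of \<alpha> \<gamma>] \<alpha> \<gamma> k supp_\<alpha> D_pos_subset unfolding C_def by blast
      qed
    qed
    have "c j (\<Sum>T) = (\<Sum>\<gamma>\<in>T. c j \<gamma>)" by (rule linear_sum[OF linear_c])
    also have "\<dots> = (\<Sum>\<gamma>\<in>{\<alpha>}. c j \<gamma>)"
      using finT \<alpha> other by (intro sum.mono_neutral_right) auto
    also have "\<dots> = 1" using ij by (simp add: c_simps)
    finally have cT: "c j (\<Sum>T) = 1" .
    obtain m :: int where "c j (\<Sum>(D_pos \<union> axis_pos 2)) = c j (\<Sum>T) + 2 * of_int m"
      using parity[OF linear_c c_pos_Ints[of 2 j]] ij(3) by auto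
    then have "2 * int j + 2 = 1 + 2 * m" using c_sum_pos[of 2 j] ij(3) cT by linarith
    then show False by presburger
  qed
  have card_axis: "card (axis_pos 2) = n"
    unfolding axis_pos_def using card_image[OF inj_axis[of 2]] by simp
  have le: "card T \<le> n"
    using card_mono[OF _ no_D] card_axis by (simp add: axis_pos_def)
  have "card T \<noteq> n" if n: "n mod 4 \<in> {2, 3}"
  proof
    assume "card T = n"
    then have T: "T = axis_pos 2"
      using card_subset_eq[OF _ no_D] card_axis by (simp add: axis_pos_def)
    define h where "h x = (\<Sum>v<n. c v x / 2)" for x
    have lin: "linear h" unfolding h_def
      by (intro linearI) (simp_all add: linear_add[OF linear_c] linear_scale[OF linear_c] sum.distrib add_divide_distrib sum_distrib_left)
    have he: "h (e i) = 1 / 2" if "i < n" for i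
      using that by (simp add: h_def c_e flip: sum_divide_distrib)
    have "h x \<in> \<int>" if "x \<in> D_pos \<union> axis_pos 2" for x
      using that
    proof
      assume "x \<in> D_pos"
      then show ?thesis
        by (elim D_posE) (auto simp: linear_add[OF lin] linear_diff[OF lin] linear_scale[OF lin] he)
    next
      assume "x \<in> axis_pos 2"
      then show ?thesis by (auto simp: axis_pos_def linear_scale[OF lin] he)
    qed
    then obtain m :: int where m: "h (\<Sum>(D_pos \<union> axis_pos 2)) = h (\<Sum>T) + 2 * of_int m"
      using parity[OF lin] by blast
    have "h (\<Sum>(D_pos \<union> axis_pos 2)) = (\<Sum>j<n. real j + 1)"
      by (simp add: sum_pos linear_sum[OF lin] linear_scale[OF lin] he add_divide_distrib)
    moreover have "h (\<Sum>T) = (\<Sum>j<n. 1)"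
      unfolding T axis_pos_def using inj_axis[of 2]
      by (simp add: sum.reindex linear_sum[OF lin] linear_scale[OF lin] he)
    ultimately have "(\<Sum>j<n. real j) = 2 * of_int m" using m by (simp add: sum.distrib)
    then have "real_of_int (2 * (\<Sum>j<n. int j)) = of_int (4 * m)" by simp
    then have "2 * (\<Sum>j<n. int j) = 4 * m" by linarith
    moreover have "2 * (\<Sum>j<n. int j) = int n * (int n - 1)"
      by (induction n) (simp_all add: algebra_simps)
    ultimately have eq: "int n * (int n - 1) = 4 * m" by simp
    define k where "k = int (n div 4)"
    have "int n = 4 * k + 2 \<or> int n = 4 * k + 3" using n unfolding k_def by auto presburger+
    then have "int n * (int n - 1) = 4 * (4 * k * k + 3 * k) + 2 \<or> int n * (int n - 1) = 4 * (4 * k * k + 5 * k + 1) + 2"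
      by (elim disjE) (simp_all add: algebra_simps)
    then show False using eq by presburger
  qed
  then show "card (D_pos \<union> axis_pos 2 - S) \<le> (if n mod 4 \<in> {2, 3} then n - 1 else n)"
    using le unfolding T_def[symmetric] by auto
qed

end

section \<open>The exceptional types\<close>

definition dot :: "int list \<Rightarrow> int list \<Rightarrow> int" where
  "dot c d = sum_list (map2 (*) c d)"

lemma dot_eq_sum: "length c = n \<Longrightarrow> length d = n \<Longrightarrow> dot c d = (\<Sum>k<n. c ! k * d ! k)"
  by (simp add: dot_def sum_list_sum_nth lessThan_atLeast0)

definition unit_list :: "nat \<Rightarrow> nat \<Rightarrow> int list" where
  "unit_list n i = (replicate n 0)[i := 1]"

definition cartan_columns :: "dynkin_type \<Rightarrow> int list list" where
  "cartan_columns X = map (\<lambda>j. map (\<lambda>i. cartan_matrix X (Suc i) (Suc j)) [0..<dynkin_rank X]) [0..<dynkin_rank X]"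

text \<open>
  A simple reflection changes a single coefficient with respect to the base, by the Cartan number,
  which is the product with a column of the Cartan matrix.
\<close>

definition simple_reflection :: "int list list \<Rightarrow> nat \<Rightarrow> int list \<Rightarrow> int list" where
  "simple_reflection cols j c = c[j := c ! j - dot c (cols ! j)]"

text \<open>
  Closure under simple reflections, apart from the sign change of a simple root under its own
  reflection, forces all positive roots into \<open>L\<close>. The existence of a reflection that lowers the height
  of each other member forces all members to be roots.
\<close>

definition positive_root_list :: "dynkin_type \<Rightarrow> int list list \<Rightarrow> bool" where
  "positive_root_list X L \<longleftrightarrow> (\<forall>j<dynkin_rank X. unit_list (dynkin_rank X) j \<in> set L) \<and>
     (\<forall>c\<in>set L. length c = dynkin_rank X \<and> sum_list c > 0 \<and>
       (\<forall>j<dynkin_rank X. dot c (cartan_columns X ! j) = 0 \<or> c = unit_list (dynkin_rank X) j \<or>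
         simple_reflection (cartan_columns X) j c \<in> set L) \<and>
       (\<exists>j<dynkin_rank X. c = unit_list (dynkin_rank X) j \<or> dot c (cartan_columns X ! j) > 0))"

definition strongly_orthogonal_lists :: "int list list \<Rightarrow> int list \<Rightarrow> int list \<Rightarrow> bool" where
  "strongly_orthogonal_lists L c d \<longleftrightarrow>
     map2 (+) c d \<notin> set L \<and> map2 (-) c d \<notin> set L \<and> map2 (-) d c \<notin> set L"

text \<open>
  Such a table assigns to each height the positive roots of that height as coefficient lists, each
  paired with its sign in the balanced set, or with 0 if it is omitted.
\<close>

type_synonym sign_table = "int \<Rightarrow> (int \<times> int list) list"

definition entries :: "sign_table \<Rightarrow> nat \<Rightarrow> (int \<times> int list) list" where
  "entries table H = concat (map (\<lambda>h. table (int h)) [1..<Suc H])"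

definition omitted :: "(int \<times> int list) list \<Rightarrow> int list list" where
  "omitted E = map snd (filter (\<lambda>p. fst p = 0) E)"

text \<open>
  The members of \<open>entries table H\<close> are found through their height. The bounds on the height are needed
  because a table may list anything at heights beyond \<open>H\<close>.
\<close>

definition occurs :: "sign_table \<Rightarrow> nat \<Rightarrow> int list \<Rightarrow> bool" where
  "occurs table H c \<longleftrightarrow> 1 \<le> sum_list c \<and> sum_list c \<le> int H \<and> list_ex (\<lambda>p. snd p = c) (table (sum_list c))"

text \<open>
  An executable form of \<open>positive_root_list\<close> for the entries of a table. Listing by height also reduces
  distinctness to the single heights.
\<close>

definition is_root_table :: "dynkin_type \<Rightarrow> sign_table \<Rightarrow> nat \<Rightarrow> bool" where
  "is_root_table X table H \<longleftrightarrow>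
     (let n = dynkin_rank X; cols = cartan_columns X in
     list_all (\<lambda>j. occurs table H (unit_list n j)) [0..<n] \<and>
     list_all (\<lambda>h. distinct (map snd (table (int h))) \<and>
       list_all (\<lambda>(s, c). length c = n \<and> sum_list c = int h \<and>
         list_all (\<lambda>j. let p = dot c (cols ! j) in p = 0 \<or> c = unit_list n j \<or>
           occurs table H (c[j := c ! j - p])) [0..<n] \<and>
         list_ex (\<lambda>j. dot c (cols ! j) > 0 \<or> c = unit_list n j) [0..<n]) (table (int h))) [1..<Suc H])"

text \<open>
  An executable form of \<open>strongly_orthogonal_lists\<close>.
\<close>

definition table_orthogonal :: "sign_table \<Rightarrow> nat \<Rightarrow> int list \<Rightarrow> int list \<Rightarrow> bool" where
  "table_orthogonal table H c d \<longleftrightarrow>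
     \<not> (occurs table H (map2 (+) c d) \<or> occurs table H (map2 (-) c d) \<or> occurs table H (map2 (-) d c))"

definition is_well_balanced_table :: "dynkin_type \<Rightarrow> sign_table \<Rightarrow> nat \<Rightarrow> nat \<Rightarrow> bool" where
  "is_well_balanced_table X table H m \<longleftrightarrow>
     is_root_table X table H \<and>
     (let E = entries table H; T = omitted E in
       length T = m \<and>
       list_all (\<lambda>c. list_all (table_orthogonal table H c) T) T \<and>
       list_all (\<lambda>p. fst p \<in> {-1, 0, 1}) E \<and>
       list_all (\<lambda>k. (\<Sum>p\<leftarrow>E. fst p * snd p ! k) = 0) [0..<dynkin_rank X])"

lemma entries_Suc: "entries table (Suc H) = entries table H @ table (int (Suc H))"
  by (simp add: entries_def)

lemma set_entries: "set (entries table H) = (\<Union>h\<in>{1..H}. set (table (int h)))"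
  by (simp add: entries_def atLeastLessThanSuc_atLeastAtMost del: upt_Suc)

lemma distinct_entries:
  assumes "\<And>h. 1 \<le> h \<Longrightarrow> h \<le> H \<Longrightarrow> distinct (map snd (table (int h)))"
    and "\<And>h p. 1 \<le> h \<Longrightarrow> h \<le> H \<Longrightarrow> p \<in> set (table (int h)) \<Longrightarrow> sum_list (snd p) = int h"
  shows "distinct (map snd (entries table H))"
  using assms
proof (induction H)
  case 0
  then show ?case by (simp add: entries_def)
next
  case (Suc H)
  have "snd ` set (entries table H) \<inter> snd ` set (table (int (Suc H))) = {}"
  proof (rule ccontr)
    assume "\<not> ?thesis"
    then obtain p q where pq: "p \<in> set (entries table H)" "q \<in> set (table (int (Suc H)))" "snd p = snd q"
      by blast
    then obtain h where "1 \<le> h" "h \<le> H" "p \<in> set (table (int h))" by (auto simp: set_entries)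
    then have "sum_list (snd p) = int h" using Suc.prems(2)[of h p] by simp
    moreover have "sum_list (snd q) = int (Suc H)" using Suc.prems(2)[of "Suc H" q] pq(2) by simp
    ultimately show False using pq(3) \<open>h \<le> H\<close> by simp
  qed
  moreover have "distinct (map snd (entries table H))" using Suc.prems by (intro Suc.IH) auto
  moreover have "distinct (map snd (table (int (Suc H))))" using Suc.prems(1)[of "Suc H"] by simp
  ultimately show ?case by (simp add: entries_Suc)
qed

context
  fixes X :: dynkin_type and table :: sign_table and H :: nat
  assumes tab: "is_root_table X table H"
begin

lemma root_table_entry:
  assumes "1 \<le> h" "h \<le> H" "p \<in> set (table (int h))"
  shows "length (snd p) = dynkin_rank X" "sum_list (snd p) = int h"
    "j < dynkin_rank X \<Longrightarrow> dot (snd p) (cartan_columns X ! j) = 0 \<or> snd p = unit_list (dynkin_rank X) j \<or>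
       occurs table H (simple_reflection (cartan_columns X) j (snd p))"
    "\<exists>j<dynkin_rank X. snd p = unit_list (dynkin_rank X) j \<or> dot (snd p) (cartan_columns X ! j) > 0"
proof -
  obtain s c where p: "p = (s, c)" by (cases p)
  have "h \<in> set [1..<Suc H]" using assms by auto
  then have "case p of (s, c) \<Rightarrow> length c = dynkin_rank X \<and> sum_list c = int h \<and>
      list_all (\<lambda>j. let p = dot c (cartan_columns X ! j) in p = 0 \<or> c = unit_list (dynkin_rank X) j \<or>
        occurs table H (c[j := c ! j - p])) [0..<dynkin_rank X] \<and>
      list_ex (\<lambda>j. dot c (cartan_columns X ! j) > 0 \<or> c = unit_list (dynkin_rank X) j) [0..<dynkin_rank X]"
    using tab assms(3) unfolding is_root_table_def Let_def list_all_iff[of _ "[1..<Suc H]"]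
      list_all_iff[of _ "table _"] by blast
  then show "length (snd p) = dynkin_rank X" "sum_list (snd p) = int h"
    "j < dynkin_rank X \<Longrightarrow> dot (snd p) (cartan_columns X ! j) = 0 \<or> snd p = unit_list (dynkin_rank X) j \<or>
       occurs table H (simple_reflection (cartan_columns X) j (snd p))"
    "\<exists>j<dynkin_rank X. snd p = unit_list (dynkin_rank X) j \<or> dot (snd p) (cartan_columns X ! j) > 0"
    unfolding p simple_reflection_def Let_def list_all_iff list_ex_iff by auto
qed

lemma occurs_iff: "occurs table H c \<longleftrightarrow> c \<in> set (map snd (entries table H))"
proof
  assume "occurs table H c"
  then have c: "1 \<le> nat (sum_list c)" "nat (sum_list c) \<le> H" "c \<in> snd ` set (table (int (nat (sum_list c))))"
    unfolding occurs_def list_ex_iff by auto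
  then show "c \<in> set (map snd (entries table H))" unfolding set_map set_entries by fastforce
next
  assume "c \<in> set (map snd (entries table H))"
  then obtain h p where "1 \<le> h" "h \<le> H" "p \<in> set (table (int h))" "c = snd p"
    unfolding set_map set_entries by auto
  then show "occurs table H c" using root_table_entry(2)[of h p] unfolding occurs_def list_ex_iff by auto
qed

lemma table_orthogonal_iff:
  "table_orthogonal table H c d \<longleftrightarrow> strongly_orthogonal_lists (map snd (entries table H)) c d"
  unfolding table_orthogonal_def strongly_orthogonal_lists_def occurs_iff by blast

lemma positive_root_list_entries: "positive_root_list X (map snd (entries table H))"
  unfolding positive_root_list_def occurs_iff[symmetric]
proof (intro conjI ballI allI impI)
  show "occurs table H (unit_list (dynkin_rank X) j)" if "j < dynkin_rank X" for j
    using tab that unfolding is_root_table_def Let_def list_all_iff by auto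
  fix c assume "c \<in> set (map snd (entries table H))"
  then obtain h p where p: "1 \<le> h" "h \<le> H" "p \<in> set (table (int h))" "c = snd p"
    unfolding set_map set_entries by auto
  note D = root_table_entry[OF p(1-3), folded p(4)]
  show "length c = dynkin_rank X" "sum_list c > 0" using D p(1) by auto
  show "dot c (cartan_columns X ! j) = 0 \<or> c = unit_list (dynkin_rank X) j \<or>
      occurs table H (simple_reflection (cartan_columns X) j c)" if "j < dynkin_rank X" for j
    using D(3)[OF that] .
  show "\<exists>j<dynkin_rank X. c = unit_list (dynkin_rank X) j \<or> dot c (cartan_columns X ! j) > 0"
    using D(4) .
qed

lemma distinct_entries_table: "distinct (map snd (entries table H))"
proof (rule distinct_entries)
  show "distinct (map snd (table (int h)))" if "1 \<le> h" "h \<le> H" for h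
  proof -
    have "h \<in> set [1..<Suc H]" using that by auto
    then show ?thesis using tab unfolding is_root_table_def Let_def list_all_iff[of _ "[1..<Suc H]"] by blast
  qed
qed (rule root_table_entry(2))

end

fun has_clique :: "('b \<Rightarrow> 'b \<Rightarrow> bool) \<Rightarrow> nat \<Rightarrow> 'b list \<Rightarrow> bool" where
  "has_clique E 0 cs = True"
| "has_clique E (Suc k) [] = False"
| "has_clique E (Suc k) (c # cs) = (has_clique E k (filter (E c) cs) \<or> has_clique E (Suc k) cs)"


lemma has_clique_subset:
  assumes sym: "\<And>x y. E x y \<Longrightarrow> E y x"
  shows "T \<subseteq> set cs \<Longrightarrow> finite T \<Longrightarrow> card T = k \<Longrightarrow> (\<And>x y. x \<in> T \<Longrightarrow> y \<in> T \<Longrightarrow> x \<noteq> y \<Longrightarrow> E x y) \<Longrightarrow> has_clique E k cs"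
proof (induction E k cs arbitrary: T rule: has_clique.induct)
  case (3 E k c cs)
  show ?case
  proof (cases "c \<in> T")
    case True
    have "has_clique E k (filter (E c) cs)"
    proof (rule "3.IH"(1))
      show "T - {c} \<subseteq> set (filter (E c) cs)" using "3.prems" True by auto
      show "card (T - {c}) = k" using "3.prems" True by simp
    qed (use "3.prems" in auto)
    then show ?thesis by simp
  next
    case False
    then have "has_clique E (Suc k) cs" using "3.prems" by (intro "3.IH"(2)) auto
    then show ?thesis by simp
  qed
qed auto

definition combination :: "(nat \<Rightarrow> 'a::euclidean_space) \<Rightarrow> int list \<Rightarrow> 'a" where
  "combination b c = (\<Sum>k<length c. of_int (c ! k) *\<^sub>R b k)"

lemma combination_add:
  "length c = length d \<Longrightarrow> combination b (map2 (+) c d) = combination b c + combination b d"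
  by (simp add: combination_def sum.distrib[symmetric] scaleR_add_left)

lemma combination_diff:
  "length c = length d \<Longrightarrow> combination b (map2 (-) c d) = combination b c - combination b d"
  by (simp add: combination_def sum_subtractf[symmetric] scaleR_diff_left)

lemma combination_unit:
  assumes "j < n" shows "combination b (unit_list n j) = b j"
proof -
  have "combination b (unit_list n j) = (\<Sum>k<n. if k = j then b k else 0)"
    unfolding combination_def unit_list_def by (intro sum.cong) (auto simp: nth_list_update)
  then show ?thesis using assms by simp
qed

lemma linear_combination: "linear f \<Longrightarrow> f (combination b c) = (\<Sum>k<length c. of_int (c ! k) *\<^sub>R f (b k))"
  by (simp add: combination_def linear_sum linear_scale)

lemma combination_update:
  assumes "j < length c"
  shows "combination b (c[j := c ! j - p]) = combination b c - of_int p *\<^sub>R b j"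
proof -
  have "combination b c - combination b (c[j := c ! j - p]) =
      (\<Sum>k<length c. if k = j then of_int p *\<^sub>R b k else 0)"
    unfolding combination_def length_list_update sum_subtractf[symmetric]
    by (intro sum.cong) (auto simp: nth_list_update scaleR_diff_left)
  also have "\<dots> = of_int p *\<^sub>R b j" using assms by simp
  finally show ?thesis by (simp add: algebra_simps)
qed

lemma sum_list_decrease:
  fixes p :: int
  shows "j < length c \<Longrightarrow> sum_list (c[j := c ! j - p]) = sum_list c - p"
  by (induction c arbitrary: j) (auto split: nat.split)

locale base_of_type =
  fixes R :: "'a::euclidean_space set" and X :: dynkin_type and b :: "nat \<Rightarrow> 'a" and n :: nat
  assumes roots: "root_system R" and n: "n = dynkin_rank X"
    and b_inj: "inj_on b {..<n}" and b_base: "root_base R (b ` {..<n})"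
    and cartan: "\<forall>i<n. \<forall>j<n. cartan_number (b i) (b j) = of_int (cartan_matrix X (Suc i) (Suc j))"
begin

abbreviation "cols \<equiv> cartan_columns X"

lemma cols_nth: "i < n \<Longrightarrow> j < n \<Longrightarrow> cols ! j ! i = cartan_matrix X (Suc i) (Suc j)"
  by (simp add: cartan_columns_def n)

lemma length_cols_nth: "j < n \<Longrightarrow> length (cols ! j) = n"
  by (simp add: cartan_columns_def n)

lemma reflection_combination:
  assumes c: "length c = n" and j: "j < n"
  shows "root_reflection (b j) (combination b c) = combination b (simple_reflection cols j c)"
proof -
  have "cartan_number (combination b c) (b j) = (\<Sum>k<n. of_int (c ! k) * of_int (cols ! j ! k))"
    unfolding linear_combination[OF cartan_number_linear] c using j cartan
    by (intro sum.cong) (auto simp: cols_nth)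
  also have "\<dots> = of_int (dot c (cols ! j))"
    using dot_eq_sum[OF c length_cols_nth[OF j]] by simp
  finally show ?thesis
    unfolding root_reflection_def simple_reflection_def using combination_update[where b = b, of j c] c j by simp
qed

lemma inj_combination: "inj_on (combination b) {c. length c = n}"
proof (rule inj_onI)
  fix c d assume cd: "c \<in> {c. length c = n}" "d \<in> {c. length c = n}" "combination b c = combination b d"
  show "c = d"
  proof (rule nth_equalityI)
    show "length c = length d" using cd by simp
    fix j assume j: "j < length c"
    obtain g :: "'a \<Rightarrow> real" where g: "linear g" "\<forall>k<n. g (b k) = (if k = j then 1 else 0)"
      using base_functional[OF b_inj b_base, of "\<lambda>k. if k = j then 1 else 0"] by blast
    have coord: "g (combination b x) = of_int (x ! j)" if x: "length x = n" for x
    proof -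
      have "g (combination b x) = (\<Sum>k<n. if k = j then of_int (x ! k) else 0)"
        unfolding linear_combination[OF g(1)] x using g(2) by (intro sum.cong) auto
      then show ?thesis using j cd by simp
    qed
    show "c ! j = d ! j" using coord[of c] coord[of d] cd by simp
  qed
qed

lemma height_functional:
  "\<exists>g :: 'a \<Rightarrow> real. linear g \<and> (\<forall>c. length c = n \<longrightarrow> g (combination b c) = of_int (sum_list c))"
proof -
  obtain g :: "'a \<Rightarrow> real" where g: "linear g" "\<forall>k<n. g (b k) = 1"
    using base_functional[OF b_inj b_base, of "\<lambda>_. 1"] by blast
  have "g (combination b c) = of_int (sum_list c)" if c: "length c = n" for c
  proof -
    have "g (combination b c) = (\<Sum>k<n. of_int (c ! k))"
      unfolding linear_combination[OF g(1)] c using g(2) by (intro sum.cong) auto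
    also have "\<dots> = of_int (sum_list c)" by (simp add: sum_list_sum_nth c lessThan_atLeast0)
    finally show ?thesis .
  qed
  then show ?thesis using g(1) by blast
qed

lemma positive_root_listD:
  assumes "positive_root_list X L"
  shows "j < n \<Longrightarrow> unit_list n j \<in> set L"
    "c \<in> set L \<Longrightarrow> length c = n" "c \<in> set L \<Longrightarrow> sum_list c > 0"
    "c \<in> set L \<Longrightarrow> j < n \<Longrightarrow> dot c (cols ! j) = 0 \<or> c = unit_list n j \<or> simple_reflection cols j c \<in> set L"
    "c \<in> set L \<Longrightarrow> \<exists>j<n. c = unit_list n j \<or> dot c (cols ! j) > 0"
  using assms unfolding positive_root_list_def n[symmetric] by blast+

text \<open>
  Induction on the height: a lowering reflection leads to a listed root, and reflections preserve
  the root system.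
\<close>

lemma combination_in_roots:
  assumes L: "positive_root_list X L" and "c \<in> set L"
  shows "combination b c \<in> R"
  using assms(2)
proof (induction "nat (sum_list c)" arbitrary: c rule: less_induct)
  case less
  note L = positive_root_listD[OF L]
  have c: "length c = n" "sum_list c > 0" using L less.prems by auto
  obtain j where j: "j < n" "c = unit_list n j \<or> dot c (cols ! j) > 0" using L(5)[OF less.prems] by blast
  show ?case
  proof (cases "c = unit_list n j")
    case True
    then show ?thesis using combination_unit[OF j(1), of b] base_in_roots[OF b_base j(1)] by simp
  next
    case False
    define d where "d = simple_reflection cols j c"
    have pos: "dot c (cols ! j) > 0" using j False by simp
    then have d: "d \<in> set L" using L(4)[OF less.prems j(1)] False unfolding d_def by auto
    have "sum_list d = sum_list c - dot c (cols ! j)"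
      unfolding d_def simple_reflection_def using j(1) c(1) by (simp add: sum_list_decrease)
    then have "combination b d \<in> R" using pos c(2) d by (intro less.hyps) auto
    then have "root_reflection (b j) (combination b d) \<in> R"
      using root_reflection_in_roots[OF roots base_in_roots[OF b_base j(1)]] by blast
    moreover have "combination b d = root_reflection (b j) (combination b c)"
      unfolding d_def using reflection_combination[OF c(1) j(1)] by simp
    ultimately show ?thesis by (simp add: root_reflection_involution)
  qed
qed

text \<open>
  The inclusion of \<open>R\<close> is an instance of \<open>roots_subset_closed\<close>.
\<close>

lemma roots_eq:
  assumes L: "positive_root_list X L"
  shows "R = combination b ` set L \<union> uminus ` combination b ` set L" (is "R = ?E")
proof
  note LD = positive_root_listD[OF L]
  show "?E \<subseteq> R" using combination_in_roots[OF L] root_system_uminus[OF roots] by auto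
  show "R \<subseteq> ?E"
  proof (rule roots_subset_closed[OF roots b_base])
    show "b ` {..<n} \<subseteq> ?E"
    proof
      fix x assume "x \<in> b ` {..<n}"
      then obtain j where j: "j < n" "x = b j" by auto
      then have "x = combination b (unit_list n j)" by (simp add: combination_unit)
      then show "x \<in> ?E" using LD(1)[OF j(1)] by blast
    qed
    show "- \<beta> \<in> ?E" if "\<beta> \<in> ?E" for \<beta> using that by auto
    have step: "root_reflection (b j) (combination b c) \<in> ?E" if c: "c \<in> set L" and j: "j < n" for c j
    proof -
      have refl: "root_reflection (b j) (combination b c) = combination b (simple_reflection cols j c)"
        using reflection_combination LD(2)[OF c] j by simp
      consider "dot c (cols ! j) = 0" | "c = unit_list n j" | "simple_reflection cols j c \<in> set L"
        using LD(4)[OF c j] by blast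
      then show ?thesis
      proof cases
        case 1
        then have "simple_reflection cols j c = c" by (simp add: simple_reflection_def)
        then show ?thesis using refl c by simp
      next
        case 2
        have "b j \<noteq> 0" using base_in_roots[OF b_base j] roots by (auto simp: root_system_def)
        then have "root_reflection (b j) (b j) = - b j"
          by (simp add: root_reflection_def cartan_number_def scaleR_2)
        then show ?thesis using 2 c j by (auto simp: combination_unit intro!: image_eqI[of _ _ c])
      next
        case 3
        then show ?thesis using refl by simp
      qed
    qed
    fix \<alpha> \<beta> assume "\<alpha> \<in> b ` {..<n}" "\<beta> \<in> ?E"
    then obtain j c where j: "j < n" "\<alpha> = b j" and c: "c \<in> set L" "\<beta> = combination b c \<or> \<beta> = - combination b c"
      by blast
    then show "root_reflection \<alpha> \<beta> \<in> ?E"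
      using step[OF c(1) j(1)] linear_neg[OF root_reflection_linear[of "b j"], of "combination b c"] by auto
  qed
qed

lemma half_of_root_list:
  assumes L: "positive_root_list X L"
  shows "half_of R (combination b ` set L)"
proof -
  obtain g :: "'a \<Rightarrow> real" where g: "linear g"
    "\<forall>c. length c = n \<longrightarrow> g (combination b c) = of_int (sum_list c)"
    using height_functional by blast
  show ?thesis
  proof (rule half_of_functional[OF g(1)])
    show "combination b ` set L \<subseteq> R" "R \<subseteq> combination b ` set L \<union> uminus ` combination b ` set L"
      using roots_eq[OF L] by auto
    show "g \<alpha> > 0" if "\<alpha> \<in> combination b ` set L" for \<alpha>
      using that g(2) positive_root_listD(2,3)[OF L] by auto
  qed
qed

lemma combination_in_roots_iff:
  assumes L: "positive_root_list X L" and c: "length c = n" and "combination b c \<in> R"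
  shows "c \<in> set L \<or> map uminus c \<in> set L"
proof -
  have neg: "combination b (map uminus c) = - combination b c"
    by (simp add: combination_def sum_negf)
  have mem: "x \<in> set L" if "length x = n" "combination b x \<in> combination b ` set L" for x
  proof -
    obtain y where y: "y \<in> set L" "combination b x = combination b y" using \<open>combination b x \<in> _\<close> by blast
    then have "x = y" using inj_combination that(1) positive_root_listD(2)[OF L] by (auto simp: inj_on_def)
    then show ?thesis using y by simp
  qed
  have "combination b c \<in> combination b ` set L \<or> - combination b c \<in> combination b ` set L"
    using assms(3) roots_eq[OF L] by force
  then show ?thesis using mem[OF c] mem[of "map uminus c"] c by (auto simp: neg)
qed

lemma well_balanced_exists:
  fixes E :: "(int \<times> int list) list"
  defines "P \<equiv> combination b ` set (map snd E)"
  assumes L: "positive_root_list X (map snd E)" and dist: "distinct (map snd E)"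
    and sign: "\<And>p. p \<in> set E \<Longrightarrow> fst p \<in> {-1, 0, 1}"
    and zero: "\<And>k. k < n \<Longrightarrow> (\<Sum>p\<leftarrow>E. fst p * snd p ! k) = 0"
    and so: "\<And>c d. c \<in> set (omitted E) \<Longrightarrow> d \<in> set (omitted E) \<Longrightarrow>
      strongly_orthogonal_lists (map snd E) c d"
  shows "\<exists>S. well_balanced R P S \<and> card (P - S) = length (omitted E)"
proof -
  note L = L and LD = positive_root_listD[OF L]
  define r where "r p = combination b (snd p)" for p :: "int \<times> int list"
  have len: "length (snd p) = n" if "p \<in> set E" for p using LD(2)[of "snd p"] that by simp
  have inj_r: "inj_on r (set E)"
  proof (rule inj_onI)
    fix p q assume pq: "p \<in> set E" "q \<in> set E" "r p = r q"
    then have "snd p = snd q" using inj_combination len unfolding r_def inj_on_def by blast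
    then show "p = q" using dist pq unfolding distinct_map inj_on_def by blast
  qed
  define Z where "Z = {p \<in> set E. fst p = 0}"
  define S where "S = r ` (set E - Z)"
  have P: "P = r ` set E" by (auto simp: P_def r_def)
  have omitted: "combination b ` set (omitted E) = r ` Z" by (auto simp: omitted_def Z_def r_def)
  have diff: "P - S = r ` Z"
    unfolding P S_def Z_def using inj_r by (auto simp: inj_on_def)
  have distE: "distinct E" using dist by (simp add: distinct_map)
  have "balanced S" unfolding S_def
  proof (rule balanced_imageI)
    show "inj_on r (set E - Z)" using inj_r by (rule inj_on_subset) auto
    show "of_int (fst p) \<in> {1, -1::real}" if "p \<in> set E - Z" for p
      using sign[of p] that by (auto simp: Z_def)
    have "(\<Sum>p\<in>set E - Z. of_int (fst p) *\<^sub>R r p) = (\<Sum>p\<in>set E. of_int (fst p) *\<^sub>R r p)"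
      by (rule sum.mono_neutral_left) (auto simp: Z_def)
    also have "\<dots> = (\<Sum>p\<in>set E. \<Sum>k<n. of_int (fst p * snd p ! k) *\<^sub>R b k)"
      by (intro sum.cong refl) (simp add: r_def combination_def len scaleR_sum_right)
    also have "\<dots> = (\<Sum>k<n. \<Sum>p\<in>set E. of_int (fst p * snd p ! k) *\<^sub>R b k)" by (rule sum.swap)
    also have "\<dots> = (\<Sum>k<n. of_int (\<Sum>p\<leftarrow>E. fst p * snd p ! k) *\<^sub>R b k)"
      using distE by (simp add: sum_list_distinct_conv_sum_set scaleR_sum_left)
    also have "\<dots> = 0" using zero by simp
    finally show "(\<Sum>p\<in>set E - Z. of_int (fst p) *\<^sub>R r p) = 0" .
  qed simp
  moreover have "strongly_orthogonal R (P - S)"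
    unfolding strongly_orthogonal_def diff omitted[symmetric]
  proof (intro ballI)
    fix \<alpha> \<beta> assume "\<alpha> \<in> combination b ` set (omitted E)" "\<beta> \<in> combination b ` set (omitted E)"
    then obtain c d where cd: "\<alpha> = combination b c" "\<beta> = combination b d" "c \<in> set (omitted E)" "d \<in> set (omitted E)"
      by blast
    then have mem: "c \<in> set (map snd E)" "d \<in> set (map snd E)" by (auto simp: omitted_def)
    then have len: "length c = n" "length d = n" using LD(2) by auto
    note so = so[OF cd(3,4), unfolded strongly_orthogonal_lists_def]
    have neg: "map uminus (map2 (-) c d) = map2 (-) d c"
      using len by (intro nth_equalityI) auto
    have "map uminus (map2 (+) c d) \<notin> set (map snd E)"
    proof
      assume "map uminus (map2 (+) c d) \<in> set (map snd E)"
      then have "sum_list (map uminus (map2 (+) c d)) > 0" by (rule LD(3))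
      moreover have "sum_list (map uminus (map2 (+) c d)) = - (sum_list c + sum_list d)"
        using len by (simp add: sum_list_sum_nth sum_negf sum_subtractf)
      moreover have "sum_list c > 0" "sum_list d > 0" using mem LD(3) by auto
      ultimately show False by simp
    qed
    then have "\<alpha> + \<beta> \<notin> R"
      using combination_in_roots_iff[OF L, of "map2 (+) c d"] so len cd by (auto simp: combination_add)
    moreover have "\<alpha> - \<beta> \<notin> R"
      using combination_in_roots_iff[OF L, of "map2 (-) c d"] so len cd neg by (auto simp: combination_diff)
    ultimately show "\<alpha> + \<beta> \<notin> R \<and> \<alpha> - \<beta> \<notin> R" ..
  qed
  moreover have "card (P - S) = length (omitted E)"
  proof -
    have "card (r ` Z) = card Z" using inj_on_subset[OF inj_r, of Z] by (intro card_image) (auto simp: Z_def)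
    also have "card Z = card (set (filter (\<lambda>p. fst p = 0) E))" by (simp add: Z_def)
    also have "\<dots> = length (omitted E)"
      unfolding omitted_def length_map using distE by (intro distinct_card distinct_filter)
    finally show ?thesis by (simp add: diff)
  qed
  moreover have "S \<subseteq> P" by (auto simp: S_def P)
  ultimately show ?thesis unfolding well_balanced_def by blast
qed

lemma card_strongly_orthogonal_le_rank:
  assumes P: "half_of R P" and T: "T \<subseteq> P" "strongly_orthogonal R T"
  shows "card T \<le> n"
proof -
  have "R \<subseteq> span (b ` {..<n})"
  proof
    fix \<beta> assume "\<beta> \<in> R"
    then obtain c :: "'a \<Rightarrow> int" where \<beta>: "\<beta> = (\<Sum>\<alpha>\<in>b ` {..<n}. of_int (c \<alpha>) *\<^sub>R \<alpha>)"
      using b_base unfolding root_base_def by blast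
    show "\<beta> \<in> span (b ` {..<n})" unfolding \<beta> by (intro span_sum span_scale span_base)
  qed
  then have "T \<subseteq> span (b ` {..<n})" using T(1) P by (auto simp: half_of_def)
  then have "card T \<le> dim (b ` {..<n})" by (rule card_strongly_orthogonal_le_dim[OF roots P T])
  also have "\<dots> \<le> card (b ` {..<n})" by (rule dim_le_card') simp
  also have "\<dots> \<le> n" using card_image_le[of "{..<n}" b] by simp
  finally show ?thesis .
qed

lemma no_clique_bound:
  assumes L: "positive_root_list X L" and clique: "\<not> has_clique (strongly_orthogonal_lists L) (Suc k) L"
    and T: "T \<subseteq> combination b ` set L" "strongly_orthogonal R T"
  shows "card T \<le> k"
proof (rule ccontr)
  assume "\<not> card T \<le> k"
  then obtain T' where T': "T' \<subseteq> T" "card T' = Suc k" "finite T'"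
    by (metis not_less_eq_eq obtain_subset_with_card_n)
  note LD = positive_root_listD[OF L]
  define W where "W = {c \<in> set L. combination b c \<in> T'}"
  have inj: "inj_on (combination b) (set L)"
    using inj_combination by (rule inj_on_subset) (use LD(2) in auto)
  have img: "combination b ` W = T'" using T(1) T'(1) unfolding W_def by blast
  have "card W = Suc k"
    using card_image[OF inj_on_subset[OF inj, of W]] img T'(2) by (auto simp: W_def)
  have "has_clique (strongly_orthogonal_lists L) (Suc k) L"
  proof (rule has_clique_subset)
    show "strongly_orthogonal_lists L d c" if "strongly_orthogonal_lists L c d" for c d
    proof -
      have "map2 (+) c d = map2 (+) d c" by (rule nth_equalityI) (auto simp: add.commute)
      then show ?thesis using that unfolding strongly_orthogonal_lists_def by auto
    qed
    show "strongly_orthogonal_lists L c d" if cd: "c \<in> W" "d \<in> W" for c d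
    proof -
      have len: "length c = n" "length d = n" and mem: "combination b c \<in> T" "combination b d \<in> T"
        using cd LD(2) T'(1) by (auto simp: W_def)
      have "combination b c + combination b d \<notin> R" "combination b c - combination b d \<notin> R"
        "combination b d - combination b c \<notin> R"
        using T(2) mem unfolding strongly_orthogonal_def by blast+
      then show ?thesis
        using combination_in_roots[OF L] len
        unfolding strongly_orthogonal_lists_def
        by (metis combination_add combination_diff)
    qed
  qed (use \<open>card W = Suc k\<close> in \<open>auto simp: W_def\<close>)
  then show False using clique by simp
qed

end

lemma base_of_type_exists:
  assumes "root_system R" "has_dynkin_type R X"
  shows "\<exists>b. base_of_type R X b (dynkin_rank X)"
  using dynkin_base_from_0[OF assms(2) refl] assms(1) unfolding base_of_type_def by blast

text \<open>
  The rank is the bound in types E7, E8, F4 and G2. In type E6 the bound 4 comes from an exhaustive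
  search for five strongly orthogonal roots.
\<close>

lemma exceptional_max:
  assumes R: "root_system R" and P: "half_of R P" and X: "has_dynkin_type R X"
    and wb: "is_well_balanced_table X table H m"
    and upper: "m = dynkin_rank X \<or> \<not> has_clique (table_orthogonal table H) (Suc m) (map snd (entries table H))"
  shows "is_max_cocardinality R P m"
proof -
  obtain b where "base_of_type R X b (dynkin_rank X)" using base_of_type_exists[OF R X] by blast
  then interpret base_of_type R X b "dynkin_rank X" .
  define E where "E = entries table H"
  have tab: "is_root_table X table H" using wb by (simp add: is_well_balanced_table_def)
  have L: "positive_root_list X (map snd E)"
    unfolding E_def by (rule positive_root_list_entries[OF tab])
  have orth: "table_orthogonal table H = strongly_orthogonal_lists (map snd E)"
    unfolding E_def by (intro ext) (rule table_orthogonal_iff[OF tab])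
  have half: "half_of R (combination b ` set (map snd E))" by (rule half_of_root_list[OF L])
  have wbE: "length (omitted E) = m" "\<And>p. p \<in> set E \<Longrightarrow> fst p \<in> {-1, 0, 1}"
    "\<And>k. k < dynkin_rank X \<Longrightarrow> (\<Sum>p\<leftarrow>E. fst p * snd p ! k) = 0"
    "\<And>c d. c \<in> set (omitted E) \<Longrightarrow> d \<in> set (omitted E) \<Longrightarrow> strongly_orthogonal_lists (map snd E) c d"
    using wb unfolding is_well_balanced_table_def Let_def E_def[symmetric] list_all_iff orth
    by (blast, blast, simp, blast)
  show ?thesis
  proof (rule is_max_cocardinalityI[OF R P half])
    show "\<exists>S. well_balanced R (combination b ` set (map snd E)) S \<and>
        card (combination b ` set (map snd E) - S) = m"
      unfolding wbE(1)[symmetric]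
      using L _ wbE(2-4) by (rule well_balanced_exists) (simp add: E_def distinct_entries_table[OF tab])
    fix S assume "well_balanced R (combination b ` set (map snd E)) S"
    then have T: "combination b ` set (map snd E) - S \<subseteq> combination b ` set (map snd E)"
      "strongly_orthogonal R (combination b ` set (map snd E) - S)"
      by (auto simp: well_balanced_def)
    from upper show "card (combination b ` set (map snd E) - S) \<le> m"
    proof
      assume "m = dynkin_rank X"
      then show ?thesis using card_strongly_orthogonal_le_rank[OF half T] by simp
    next
      assume "\<not> has_clique (table_orthogonal table H) (Suc m) (map snd (entries table H))"
      then show ?thesis using no_clique_bound[OF L _ T] unfolding orth E_def by blast
    qed
  qed
qed

section \<open>Sign tables\<close>

text \<open>
  The omitted roots form a cascade: the highest root, the highest roots of the components of its
  orthogonal complement, and so on. The remaining signs are one of many solutions of the balancing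
  equation.
\<close>

definition table_G2 :: "int \<Rightarrow> (int \<times> int list) list" where
  "table_G2 h =
    (if h = 1 then
       [(0, [1,0]), (-1, [0,1])]
     else if h = 2 then
       [(1, [1,1])]
     else if h = 3 then
       [(1, [2,1])]
     else if h = 4 then
       [(-1, [3,1])]
     else if h = 5 then
       [(0, [3,2])]
     else [])"

definition table_F4 :: "int \<Rightarrow> (int \<times> int list) list" where
  "table_F4 h =
    (if h = 1 then
       [(-1, [1,0,0,0]), (0, [0,1,0,0]), (1, [0,0,1,0]), (-1, [0,0,0,1])]
     else if h = 2 then
       [(1, [1,1,0,0]), (-1, [0,1,1,0]), (1, [0,0,1,1])]
     else if h = 3 then
       [(1, [1,1,1,0]), (0, [0,1,2,0]), (-1, [0,1,1,1])]
     else if h = 4 then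
       [(-1, [1,1,2,0]), (1, [1,1,1,1]), (1, [0,1,2,1])]
     else if h = 5 then
       [(-1, [1,2,2,0]), (1, [1,1,2,1]), (0, [0,1,2,2])]
     else if h = 6 then
       [(-1, [1,2,2,1]), (-1, [1,1,2,2])]
     else if h = 7 then
       [(1, [1,2,3,1]), (1, [1,2,2,2])]
     else if h = 8 then
       [(-1, [1,2,3,2])]
     else if h = 9 then
       [(-1, [1,2,4,2])]
     else if h = 10 then
       [(1, [1,3,4,2])]
     else if h = 11 then
       [(0, [2,3,4,2])]
     else [])"

definition table_E6 :: "int \<Rightarrow> (int \<times> int list) list" where
  "table_E6 h =
    (if h = 1 then
       [(1, [1,0,0,0,0,0]), (1, [0,1,0,0,0,0]), (1, [0,0,1,0,0,0]), (0, [0,0,0,1,0,0]),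
        (-1, [0,0,0,0,1,0]), (1, [0,0,0,0,0,1])]
     else if h = 2 then
       [(1, [1,0,1,0,0,0]), (-1, [0,1,0,1,0,0]), (-1, [0,0,1,1,0,0]), (1, [0,0,0,1,1,0]),
        (-1, [0,0,0,0,1,1])]
     else if h = 3 then
       [(-1, [1,0,1,1,0,0]), (-1, [0,1,1,1,0,0]), (1, [0,1,0,1,1,0]), (0, [0,0,1,1,1,0]),
        (1, [0,0,0,1,1,1])]
     else if h = 4 then
       [(-1, [1,1,1,1,0,0]), (1, [1,0,1,1,1,0]), (1, [0,1,1,1,1,0]), (1, [0,1,0,1,1,1]),
        (-1, [0,0,1,1,1,1])]
     else if h = 5 then
       [(-1, [1,1,1,1,1,0]), (0, [1,0,1,1,1,1]), (-1, [0,1,1,2,1,0]), (1, [0,1,1,1,1,1])]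
     else if h = 6 then
       [(1, [1,1,1,2,1,0]), (-1, [1,1,1,1,1,1]), (1, [0,1,1,2,1,1])]
     else if h = 7 then
       [(1, [1,1,2,2,1,0]), (-1, [1,1,1,2,1,1]), (-1, [0,1,1,2,2,1])]
     else if h = 8 then
       [(1, [1,1,2,2,1,1]), (-1, [1,1,1,2,2,1])]
     else if h = 9 then
       [(-1, [1,1,2,2,2,1])]
     else if h = 10 then
       [(1, [1,1,2,3,2,1])]
     else if h = 11 then
       [(0, [1,2,2,3,2,1])]
     else [])"

definition table_E7 :: "int \<Rightarrow> (int \<times> int list) list" where
  "table_E7 h =
    (if h = 1 then
       [(1, [1,0,0,0,0,0,0]), (0, [0,1,0,0,0,0,0]), (0, [0,0,1,0,0,0,0]), (-1, [0,0,0,1,0,0,0]),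
        (0, [0,0,0,0,1,0,0]), (1, [0,0,0,0,0,1,0]), (0, [0,0,0,0,0,0,1])]
     else if h = 2 then
       [(-1, [1,0,1,0,0,0,0]), (1, [0,1,0,1,0,0,0]), (-1, [0,0,1,1,0,0,0]), (1, [0,0,0,1,1,0,0]),
        (1, [0,0,0,0,1,1,0]), (-1, [0,0,0,0,0,1,1])]
     else if h = 3 then
       [(1, [1,0,1,1,0,0,0]), (-1, [0,1,1,1,0,0,0]), (-1, [0,1,0,1,1,0,0]), (1, [0,0,1,1,1,0,0]),
        (-1, [0,0,0,1,1,1,0]), (-1, [0,0,0,0,1,1,1])]
     else if h = 4 then
       [(-1, [1,1,1,1,0,0,0]), (-1, [1,0,1,1,1,0,0]), (1, [0,1,1,1,1,0,0]), (1, [0,1,0,1,1,1,0]),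
        (1, [0,0,1,1,1,1,0]), (-1, [0,0,0,1,1,1,1])]
     else if h = 5 then
       [(-1, [1,1,1,1,1,0,0]), (-1, [1,0,1,1,1,1,0]), (0, [0,1,1,2,1,0,0]), (1, [0,1,1,1,1,1,0]),
        (1, [0,1,0,1,1,1,1]), (1, [0,0,1,1,1,1,1])]
     else if h = 6 then
       [(1, [1,1,1,2,1,0,0]), (-1, [1,1,1,1,1,1,0]), (1, [1,0,1,1,1,1,1]), (-1, [0,1,1,2,1,1,0]),
        (-1, [0,1,1,1,1,1,1])]
     else if h = 7 then
       [(1, [1,1,2,2,1,0,0]), (-1, [1,1,1,2,1,1,0]), (1, [1,1,1,1,1,1,1]), (-1, [0,1,1,2,2,1,0]),
        (1, [0,1,1,2,1,1,1])]
     else if h = 8 then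
       [(-1, [1,1,2,2,1,1,0]), (1, [1,1,1,2,2,1,0]), (1, [1,1,1,2,1,1,1]), (-1, [0,1,1,2,2,1,1])]
     else if h = 9 then
       [(1, [1,1,2,2,2,1,0]), (1, [1,1,2,2,1,1,1]), (-1, [1,1,1,2,2,1,1]), (0, [0,1,1,2,2,2,1])]
     else if h = 10 then
       [(-1, [1,1,2,3,2,1,0]), (-1, [1,1,2,2,2,1,1]), (1, [1,1,1,2,2,2,1])]
     else if h = 11 then
       [(1, [1,2,2,3,2,1,0]), (-1, [1,1,2,3,2,1,1]), (-1, [1,1,2,2,2,2,1])]
     else if h = 12 then
       [(1, [1,2,2,3,2,1,1]), (1, [1,1,2,3,2,2,1])]
     else if h = 13 then
       [(-1, [1,2,2,3,2,2,1]), (1, [1,1,2,3,3,2,1])]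
     else if h = 14 then
       [(-1, [1,2,2,3,3,2,1])]
     else if h = 15 then
       [(-1, [1,2,2,4,3,2,1])]
     else if h = 16 then
       [(1, [1,2,3,4,3,2,1])]
     else if h = 17 then
       [(0, [2,2,3,4,3,2,1])]
     else [])"

definition table_E8 :: "int \<Rightarrow> (int \<times> int list) list" where
  "table_E8 h =
    (if h = 1 then
       [(-1, [1,0,0,0,0,0,0,0]), (0, [0,1,0,0,0,0,0,0]), (0, [0,0,1,0,0,0,0,0]),
        (1, [0,0,0,1,0,0,0,0]), (0, [0,0,0,0,1,0,0,0]), (-1, [0,0,0,0,0,1,0,0]),
        (0, [0,0,0,0,0,0,1,0]), (-1, [0,0,0,0,0,0,0,1])]
     else if h = 2 then
       [(1, [1,0,1,0,0,0,0,0]), (1, [0,1,0,1,0,0,0,0]), (-1, [0,0,1,1,0,0,0,0]),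
        (-1, [0,0,0,1,1,0,0,0]), (1, [0,0,0,0,1,1,0,0]), (1, [0,0,0,0,0,1,1,0]),
        (-1, [0,0,0,0,0,0,1,1])]
     else if h = 3 then
       [(1, [1,0,1,1,0,0,0,0]), (-1, [0,1,1,1,0,0,0,0]), (1, [0,1,0,1,1,0,0,0]),
        (-1, [0,0,1,1,1,0,0,0]), (1, [0,0,0,1,1,1,0,0]), (1, [0,0,0,0,1,1,1,0]),
        (-1, [0,0,0,0,0,1,1,1])]
     else if h = 4 then
       [(1, [1,1,1,1,0,0,0,0]), (-1, [1,0,1,1,1,0,0,0]), (1, [0,1,1,1,1,0,0,0]),
        (-1, [0,1,0,1,1,1,0,0]), (-1, [0,0,1,1,1,1,0,0]), (-1, [0,0,0,1,1,1,1,0]),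
        (1, [0,0,0,0,1,1,1,1])]
     else if h = 5 then
       [(1, [1,1,1,1,1,0,0,0]), (1, [1,0,1,1,1,1,0,0]), (0, [0,1,1,2,1,0,0,0]),
        (-1, [0,1,1,1,1,1,0,0]), (-1, [0,1,0,1,1,1,1,0]), (1, [0,0,1,1,1,1,1,0]),
        (1, [0,0,0,1,1,1,1,1])]
     else if h = 6 then
       [(-1, [1,1,1,2,1,0,0,0]), (-1, [1,1,1,1,1,1,0,0]), (-1, [1,0,1,1,1,1,1,0]),
        (-1, [0,1,1,2,1,1,0,0]), (1, [0,1,1,1,1,1,1,0]), (1, [0,1,0,1,1,1,1,1]),
        (1, [0,0,1,1,1,1,1,1])]
     else if h = 7 then
       [(1, [1,1,2,2,1,0,0,0]), (1, [1,1,1,2,1,1,0,0]), (1, [1,1,1,1,1,1,1,0]),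
        (-1, [1,0,1,1,1,1,1,1]), (-1, [0,1,1,2,2,1,0,0]), (1, [0,1,1,2,1,1,1,0]),
        (-1, [0,1,1,1,1,1,1,1])]
     else if h = 8 then
       [(1, [1,1,2,2,1,1,0,0]), (1, [1,1,1,2,2,1,0,0]), (-1, [1,1,1,2,1,1,1,0]),
        (1, [1,1,1,1,1,1,1,1]), (-1, [0,1,1,2,2,1,1,0]), (-1, [0,1,1,2,1,1,1,1])]
     else if h = 9 then
       [(-1, [1,1,2,2,2,1,0,0]), (-1, [1,1,2,2,1,1,1,0]), (1, [1,1,1,2,2,1,1,0]),
        (-1, [1,1,1,2,1,1,1,1]), (0, [0,1,1,2,2,2,1,0]), (1, [0,1,1,2,2,1,1,1])]
     else if h = 10 then
       [(1, [1,1,2,3,2,1,0,0]), (-1, [1,1,2,2,2,1,1,0]), (-1, [1,1,2,2,1,1,1,1]),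
        (-1, [1,1,1,2,2,2,1,0]), (1, [1,1,1,2,2,1,1,1]), (1, [0,1,1,2,2,2,1,1])]
     else if h = 11 then
       [(-1, [1,2,2,3,2,1,0,0]), (1, [1,1,2,3,2,1,1,0]), (-1, [1,1,2,2,2,2,1,0]),
        (1, [1,1,2,2,2,1,1,1]), (1, [1,1,1,2,2,2,1,1]), (-1, [0,1,1,2,2,2,2,1])]
     else if h = 12 then
       [(1, [1,2,2,3,2,1,1,0]), (1, [1,1,2,3,2,2,1,0]), (-1, [1,1,2,3,2,1,1,1]),
        (1, [1,1,2,2,2,2,1,1]), (-1, [1,1,1,2,2,2,2,1])]
     else if h = 13 then
       [(-1, [1,2,2,3,2,2,1,0]), (1, [1,2,2,3,2,1,1,1]), (1, [1,1,2,3,3,2,1,0]),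
        (-1, [1,1,2,3,2,2,1,1]), (-1, [1,1,2,2,2,2,2,1])]
     else if h = 14 then
       [(-1, [1,2,2,3,3,2,1,0]), (1, [1,2,2,3,2,2,1,1]), (1, [1,1,2,3,3,2,1,1]),
        (-1, [1,1,2,3,2,2,2,1])]
     else if h = 15 then
       [(-1, [1,2,2,4,3,2,1,0]), (-1, [1,2,2,3,3,2,1,1]), (1, [1,2,2,3,2,2,2,1]),
        (1, [1,1,2,3,3,2,2,1])]
     else if h = 16 then
       [(1, [1,2,3,4,3,2,1,0]), (-1, [1,2,2,4,3,2,1,1]), (-1, [1,2,2,3,3,2,2,1]),
        (1, [1,1,2,3,3,3,2,1])]
     else if h = 17 then
       [(0, [2,2,3,4,3,2,1,0]), (1, [1,2,3,4,3,2,1,1]), (1, [1,2,2,4,3,2,2,1]),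
        (-1, [1,2,2,3,3,3,2,1])]
     else if h = 18 then
       [(-1, [2,2,3,4,3,2,1,1]), (-1, [1,2,3,4,3,2,2,1]), (1, [1,2,2,4,3,3,2,1])]
     else if h = 19 then
       [(-1, [2,2,3,4,3,2,2,1]), (1, [1,2,3,4,3,3,2,1]), (-1, [1,2,2,4,4,3,2,1])]
     else if h = 20 then
       [(1, [2,2,3,4,3,3,2,1]), (1, [1,2,3,4,4,3,2,1])]
     else if h = 21 then
       [(-1, [2,2,3,4,4,3,2,1]), (-1, [1,2,3,5,4,3,2,1])]
     else if h = 22 then
       [(1, [2,2,3,5,4,3,2,1]), (1, [1,3,3,5,4,3,2,1])]
     else if h = 23 then
       [(-1, [2,3,3,5,4,3,2,1]), (-1, [2,2,4,5,4,3,2,1])]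
     else if h = 24 then
       [(1, [2,3,4,5,4,3,2,1])]
     else if h = 25 then
       [(1, [2,3,4,6,4,3,2,1])]
     else if h = 26 then
       [(-1, [2,3,4,6,5,3,2,1])]
     else if h = 27 then
       [(-1, [2,3,4,6,5,4,2,1])]
     else if h = 28 then
       [(1, [2,3,4,6,5,4,3,1])]
     else if h = 29 then
       [(0, [2,3,4,6,5,4,3,2])]
     else [])"

lemma well_balanced_table_G2: "is_well_balanced_table Type_G2 table_G2 5 2"
  by code_simp

lemma well_balanced_table_F4: "is_well_balanced_table Type_F4 table_F4 11 4"
  by code_simp

lemma well_balanced_table_E6: "is_well_balanced_table Type_E6 table_E6 11 4"
  by code_simp

lemma well_balanced_table_E7: "is_well_balanced_table Type_E7 table_E7 17 7"
  by code_simp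

lemma well_balanced_table_E8: "is_well_balanced_table Type_E8 table_E8 29 8"
  by code_simp

lemma no_five_strongly_orthogonal_E6: "\<not> has_clique (table_orthogonal table_E6 11) 5 (map snd (entries table_E6 11))"
  by code_simp

section \<open>The theorem\<close>

theorem theorem4p1:
  fixes R P :: "'a::euclidean_space set" and n :: nat
  assumes "simple_root_system R"
    and "dim R = n"
    and "positive_roots R P"
  shows
    "(has_dynkin_type R (Type_A n) \<longrightarrow> (\<forall>k.
        (n = 4*k \<longrightarrow> is_max_cocardinality R P 0) \<and>
        (n = 4*k + 1 \<longrightarrow> is_max_cocardinality R P (2*k + 1)) \<and>
        (n = 4*k + 2 \<longrightarrow> is_max_cocardinality R P 0) \<and>
        (n = 4*k + 3 \<longrightarrow> is_max_cocardinality R P (2*k + 2)))) \<and>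
     (has_dynkin_type R (Type_B n) \<longrightarrow> (\<forall>k.
        (n = 4*k \<longrightarrow> is_max_cocardinality R P (2*k)) \<and>
        (n = 4*k + 1 \<longrightarrow> is_max_cocardinality R P (2*k + 1)) \<and>
        (n = 4*k + 2 \<longrightarrow> is_max_cocardinality R P (2*k + 1)) \<and>
        (n = 4*k + 3 \<longrightarrow> is_max_cocardinality R P (2*k + 2)))) \<and>
     (has_dynkin_type R (Type_C n) \<longrightarrow> (\<forall>k.
        (n = 4*k \<longrightarrow> is_max_cocardinality R P (4*k)) \<and>
        (n = 4*k + 1 \<longrightarrow> is_max_cocardinality R P (4*k + 1)) \<and>
        (n = 4*k + 2 \<longrightarrow> is_max_cocardinality R P (4*k + 1)) \<and>
        (n = 4*k + 3 \<longrightarrow> is_max_cocardinality R P (4*k + 2)))) \<and>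
     (has_dynkin_type R (Type_D n) \<longrightarrow> (\<forall>k.
        (n = 4*k \<longrightarrow> is_max_cocardinality R P (4*k)) \<and>
        (n = 4*k + 1 \<longrightarrow> is_max_cocardinality R P (4*k)) \<and>
        (n = 4*k + 2 \<longrightarrow> is_max_cocardinality R P (4*k + 2)) \<and>
        (n = 4*k + 3 \<longrightarrow> is_max_cocardinality R P (4*k + 2)))) \<and>
     (has_dynkin_type R Type_E6 \<longrightarrow> is_max_cocardinality R P 4) \<and>
     (has_dynkin_type R Type_E7 \<longrightarrow> is_max_cocardinality R P 7) \<and>
     (has_dynkin_type R Type_E8 \<longrightarrow> is_max_cocardinality R P 8) \<and>
     (has_dynkin_type R Type_F4 \<longrightarrow> is_max_cocardinality R P 4) \<and>
     (has_dynkin_type R Type_G2 \<longrightarrow> is_max_cocardinality R P 2)"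
proof (intro conjI impI allI)
  have R: "root_system R" using assms(1) by (simp add: simple_root_system_def)
  have P: "half_of R P" using assms(3) by (rule half_of_positive_roots)
  show "is_max_cocardinality R P 0" if "has_dynkin_type R (Type_A n)" "n = 4 * k" for k
    using type_A_max[OF R P that(1)] that(2) by simp
  show "is_max_cocardinality R P (2 * k + 1)" if "has_dynkin_type R (Type_A n)" "n = 4 * k + 1" for k
    using type_A_max[OF R P that(1)] that(2) by simp
  show "is_max_cocardinality R P 0" if "has_dynkin_type R (Type_A n)" "n = 4 * k + 2" for k
    using type_A_max[OF R P that(1)] that(2) by simp
  show "is_max_cocardinality R P (2 * k + 2)" if "has_dynkin_type R (Type_A n)" "n = 4 * k + 3" for k
    using type_A_max[OF R P that(1)] that(2) by simp
  have B: "is_max_cocardinality R P ((n + 1) div 2)" if "has_dynkin_type R (Type_B n)"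
    using type_B_coordinates[OF R that] coordinates.type_B_max R P by blast
  show "is_max_cocardinality R P (2 * k)" if "has_dynkin_type R (Type_B n)" "n = 4 * k" for k
    using B[OF that(1)] that(2) by simp
  show "is_max_cocardinality R P (2 * k + 1)" if "has_dynkin_type R (Type_B n)" "n = 4 * k + 1" for k
    using B[OF that(1)] that(2) by simp
  show "is_max_cocardinality R P (2 * k + 1)" if "has_dynkin_type R (Type_B n)" "n = 4 * k + 2" for k
    using B[OF that(1)] that(2) by simp
  show "is_max_cocardinality R P (2 * k + 2)" if "has_dynkin_type R (Type_B n)" "n = 4 * k + 3" for k
    using B[OF that(1)] that(2) by simp
  have C: "is_max_cocardinality R P (if n mod 4 \<in> {2, 3} then n - 1 else n)" if "has_dynkin_type R (Type_C n)"
    using type_C_coordinates[OF R that] coordinates.type_C_max R P by blast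
  show "is_max_cocardinality R P (4 * k)" if "has_dynkin_type R (Type_C n)" "n = 4 * k" for k
    using C[OF that(1)] that(2) by simp
  show "is_max_cocardinality R P (4 * k + 1)" if "has_dynkin_type R (Type_C n)" "n = 4 * k + 1" for k
  proof -
    have "n mod 4 = 1" using that(2) by presburger
    then show ?thesis using C[OF that(1)] that(2) by simp
  qed
  show "is_max_cocardinality R P (4 * k + 1)" if "has_dynkin_type R (Type_C n)" "n = 4 * k + 2" for k
  proof -
    have "n mod 4 = 2" using that(2) by presburger
    then show ?thesis using C[OF that(1)] that(2) by simp
  qed
  show "is_max_cocardinality R P (4 * k + 2)" if "has_dynkin_type R (Type_C n)" "n = 4 * k + 3" for k
  proof -
    have "n mod 4 = 3" using that(2) by presburger
    then show ?thesis using C[OF that(1)] that(2) by simp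
  qed
  have D: "is_max_cocardinality R P (2 * (n div 2))" if "has_dynkin_type R (Type_D n)"
    using type_D_coordinates[OF R that] coordinates.type_D_max R P by blast
  show "is_max_cocardinality R P (4 * k)" if "has_dynkin_type R (Type_D n)" "n = 4 * k" for k
    using D[OF that(1)] that(2) by simp
  show "is_max_cocardinality R P (4 * k)" if "has_dynkin_type R (Type_D n)" "n = 4 * k + 1" for k
    using D[OF that(1)] that(2) by simp
  show "is_max_cocardinality R P (4 * k + 2)" if "has_dynkin_type R (Type_D n)" "n = 4 * k + 2" for k
    using D[OF that(1)] that(2) by simp
  show "is_max_cocardinality R P (4 * k + 2)" if "has_dynkin_type R (Type_D n)" "n = 4 * k + 3" for k
    using D[OF that(1)] that(2) by simp
  show "is_max_cocardinality R P 4" if "has_dynkin_type R Type_E6"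
    using exceptional_max[OF R P that well_balanced_table_E6] no_five_strongly_orthogonal_E6 by simp
  show "is_max_cocardinality R P 7" if "has_dynkin_type R Type_E7"
    using exceptional_max[OF R P that well_balanced_table_E7] by simp
  show "is_max_cocardinality R P 8" if "has_dynkin_type R Type_E8"
    using exceptional_max[OF R P that well_balanced_table_E8] by simp
  show "is_max_cocardinality R P 4" if "has_dynkin_type R Type_F4"
    using exceptional_max[OF R P that well_balanced_table_F4] by simp
  show "is_max_cocardinality R P 2" if "has_dynkin_type R Type_G2"
    using exceptional_max[OF R P that well_balanced_table_G2] by simp
qed

end
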